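(* Let $G$ be a stratified nilpotent Lie group with Lie algebra $\mathfrak g$ and first layer $V_1$ of the grading, equipped with a left-invariant Riemannian metric, and let $k\in\mathbb N$. Suppose that there exist a lattice $\Gamma\subset G$ with $s_2(\Gamma)\subset\Gamma$ and a $(k+1)$-dimensional $\Omega$-isotropic, $\Omega$-regular subspace $S\subset V_1$. Then $$\operatorname{Div}^j_G(r)\succcurlyeq r^{j+1}\qquad\text{for all } 1\le j\le k .$$
   Context: Groups. A stratified nilpotent Lie group is a simply connected $d$-step nilpotent Lie group $G$ with Lie algebra $\mathfrak g$ together with a grading $\mathfrak g=V_1\oplus\dots\oplus V_d$ such that $[V_1,V_j]=V_{j+1}$, where $V_m=0$ for $m>d$. For $t>0$ the scaling automorphism $s_t:G\to G$ is the unique Lie group automorphism whose differential at the identity is $\hat s_t:\mathfrak g\to\mathfrak g$, $\hat s_t(v)=t^jv$ for $v\in V_j$. Curvature form. Let $n=\dim G$, $n_1=\dim V_1$. The left-invariant horizontal distribution spanned by $V_1$ is the set of common zeros of $1$-forms $\eta_1,\dots,\eta_{n-n_1}$ (one may take the left-invariant forms dual to the last $n-n_1$ vectors of a basis $b_1,\dots,b_n$ of $\mathfrak g$ with $V_1=\langle b_1,\dots,b_{n_1}\rangle$; then $d\eta_i(X,Y)=\tfrac12 b_{n_1+i}^*([X,Y])$ up to sign convention). Put $\omega_i=d\eta_i$ and $\Omega=(\omega_1,\dots,\omega_{n-n_1}):\Lambda^2V_1\to\mathfrak g/V_1\cong\mathbb R^{n-n_1}$. A subspace $S\subset V_1$ with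 basis $X_1,\dots,X_q$ is $\Omega$-regular if for every $(\sigma_{ij})\in\mathbb R^{(n-n_1)\times q}$ the system $\omega_i(\xi,X_j)=\sigma_{ij}$ ($1\le i\le n-n_1$, $1\le j\le q$) has a solution $\xi\in V_1$. It is $\Omega$-isotropic if $\Omega$ restricted to $\Lambda^2S$ is zero. Chains. A Lipschitz $m$-chain in a metric space $X$ is a finite formal sum $a=\sum_j z_j\alpha_j$ with $z_j\in\mathbb Z$ and Lipschitz maps $\alpha_j:\Delta^m\to X$, where $\Delta^m$ is the Euclidean $m$-simplex; $\partial$ is the usual boundary operator; $a$ is an $m$-cycle if $\partial a=0$ (for $m=0$: if its total coefficient is zero). Its mass is $\operatorname{mass}(a)=\sum_j|z_j|\operatorname{vol}_m(\alpha_j(\Delta^m))$, $\operatorname{vol}_m$ being $m$-dimensional Hausdorff measure; in a Riemannian manifold the volume of a summand is given by $\int_{\Delta^m}J_{\alpha_j}\,d\lambda$ with $J_{\alpha_j}$ the Jacobian. Higher divergence. Let $X$ be a simply connected metric space with basepoint $\mathfrak o$ and $r>0$. A Lipschitz chain is $r$-avoidant if its image does not meet the ball $B_r(\mathfrak o)$. For $0<\rho\le1$, $X$ is $(\rho,N)$-acyclic at infinity if for all $0\le j\le N$ every $r$-avoidant Lipschitz $j$-cycle has a $\rho r$-avoidant filling, i.e. is the boundary of a $\rho r$-avoidant Lipschitz $(j+1)$-chain; $\operatorname{divdim}(X)$ is the largest $N$ such that $X$ is $(\rho,N)$-acyclic at infinity for some $\rho$. For $m\le\operatorname{divdim}(X)$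 (a standing assumption whenever $\operatorname{Div}^m$ is considered), $0<\rho\le1$ and $\alpha>0$ put $\operatorname{div}^m_{\rho,\alpha}(r)=\sup_a\inf_b\operatorname{mass}(b)$, the infimum over $\rho r$-avoidant Lipschitz $(m+1)$-chains $b$ with $\partial b=a$, the supremum over $r$-avoidant Lipschitz $m$-cycles $a$ with $\operatorname{mass}(a)\le\alpha r^m$. $\operatorname{Div}^m_X$ is the 2-parameter family $\{\operatorname{div}^m_{\rho,\alpha}\}_{\rho,\alpha}$. Comparison. For 2-parameter families $F=\{f_{s,t}\}$, $H=\{h_{s,t}\}$ of functions $\mathbb R^+\to\mathbb R^+$ ($0<s\le1$, $t>0$) with fixed integer $m$ (here the degree of $\operatorname{Div}$), $F\preccurlyeq H$ (equivalently $H\succcurlyeq F$) means: there are $0<s_0\le1$, $t_0>0$, $L,M\ge1$ such that for all $s\le s_0$, $t\ge t_0$ there is $A\ge1$ with $f_{s,t}(x)\le A\,h_{Ls,Mt}(Ax+A)+O(x^m)$; only the behaviour for large $x$ matters. $F\sim H$ means $F\preccurlyeq H$ and $H\preccurlyeq F$. A single function $h$ stands for the constant family $\{h\}_{s,t}$. *)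

theory Defs
  imports
    "HOL-Analysis.Analysis"
    "HOL-Algebra.Group"
    "HOL-Homology.Homology"
begin

section \<open>Lie groups\<close>

text \<open>For open \<open>S\<close> in a finite-dimensional space, \<open>C_k_on k S f\<close> says that \<open>f\<close> is \<open>k\<close> times
  continuously differentiable on \<open>S\<close>.\<close>

primrec C_k_on :: "nat \<Rightarrow> 'a::real_normed_vector set \<Rightarrow> ('a \<Rightarrow> 'b::real_normed_vector) \<Rightarrow> bool" where
  "C_k_on 0 S f \<longleftrightarrow> continuous_on S f"
| "C_k_on (Suc k) S f \<longleftrightarrow>
     (\<exists>f'. (\<forall>x\<in>S. (f has_derivative f' x) (at x)) \<and> (\<forall>v. C_k_on k S (\<lambda>x. f' x v)))"

definition smooth_on :: "'a::real_normed_vector set \<Rightarrow> ('a \<Rightarrow> 'b::real_normed_vector) \<Rightarrow> bool" where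
  "smooth_on S f \<longleftrightarrow> (\<forall>k. C_k_on k S f)"

type_synonym ('m, 'e) chart = "'m set \<times> ('m \<Rightarrow> 'e)"

definition chart_param :: "('m, 'e) chart \<Rightarrow> 'e \<Rightarrow> 'm" where
  "chart_param c = inv_into (fst c) (snd c)"

definition smooth_map ::
  "('m::topological_space, 'e::real_normed_vector) chart set \<Rightarrow>
   ('n::topological_space, 'f::real_normed_vector) chart set \<Rightarrow> ('m \<Rightarrow> 'n) \<Rightarrow> bool" where
  "smooth_map A B f \<longleftrightarrow> continuous_on UNIV f \<and>
     (\<forall>c\<in>A. \<forall>c'\<in>B. smooth_on (snd c ` (fst c \<inter> f -` fst c')) (snd c' \<circ> f \<circ> chart_param c))"

definition smooth_atlas ::
  "('m::{t2_space,second_countable_topology}, 'e::euclidean_space) chart set \<Rightarrow> bool" where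
  "smooth_atlas A \<longleftrightarrow> \<Union> (fst ` A) = UNIV \<and>
     (\<forall>c\<in>A. open (fst c) \<and> open (snd c ` fst c) \<and>
        homeomorphism (fst c) (snd c ` fst c) (snd c) (chart_param c)) \<and>
     smooth_map A A id"

definition prod_atlas :: "('m, 'e) chart set \<Rightarrow> ('n, 'f) chart set \<Rightarrow> ('m \<times> 'n, 'e \<times> 'f) chart set" where
  "prod_atlas A B = (\<lambda>(c, c'). (fst c \<times> fst c', map_prod (snd c) (snd c'))) ` (A \<times> B)"

definition lie_group ::
  "'g::{t2_space,second_countable_topology} monoid \<Rightarrow> ('g, 'e::euclidean_space) chart set \<Rightarrow> bool" where
  "lie_group G A \<longleftrightarrow> group G \<and> carrier G = UNIV \<and> smooth_atlas A \<and>
     smooth_map (prod_atlas A A) A (\<lambda>(x, y). x \<otimes>\<^bsub>G\<^esub> y) \<and>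
     smooth_map A A (\<lambda>x. inv\<^bsub>G\<^esub> x)"

text \<open>From here on \<open>c\<close> is a chart around the identity. Its differential identifies the tangent
  space at the identity, and hence the Lie algebra, with the model space \<open>'e\<close>.
  \<open>left_deriv G c v F\<close> is the derivative of \<open>F\<close> along the left-invariant vector field
  generated by \<open>v\<close>.\<close>

definition left_deriv ::
  "'g monoid \<Rightarrow> ('g, 'e::euclidean_space) chart \<Rightarrow> 'e \<Rightarrow> ('g \<Rightarrow> 'b::real_normed_vector) \<Rightarrow> 'g \<Rightarrow> 'b" where
  "left_deriv G c v F g =
     vector_derivative
       (\<lambda>t::real. F (g \<otimes>\<^bsub>G\<^esub> chart_param c (snd c \<one>\<^bsub>G\<^esub> + t *\<^sub>R v))) (at 0)"

text \<open>The commutator of two left-invariant vector fields at the identity; its components are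
  obtained by applying it to the coordinate functions of the chart.\<close>

definition lie_bracket :: "'g monoid \<Rightarrow> ('g, 'e::euclidean_space) chart \<Rightarrow> 'e \<Rightarrow> 'e \<Rightarrow> 'e" where
  "lie_bracket G c v w =
     left_deriv G c v (left_deriv G c w (snd c)) \<one>\<^bsub>G\<^esub>
     - left_deriv G c w (left_deriv G c v (snd c)) \<one>\<^bsub>G\<^esub>"


section \<open>Stratified nilpotent Lie groups\<close>

primrec lower_central :: "('e::real_vector \<Rightarrow> 'e \<Rightarrow> 'e) \<Rightarrow> nat \<Rightarrow> 'e set" where
  "lower_central br 0 = UNIV"
| "lower_central br (Suc i) = span {br u v | u v. v \<in> lower_central br i}"

definition nilpotent_of_step :: "('e::real_vector \<Rightarrow> 'e \<Rightarrow> 'e) \<Rightarrow> nat \<Rightarrow> bool" where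
  "nilpotent_of_step br d \<longleftrightarrow> lower_central br d = {0} \<and> (\<forall>i<d. lower_central br i \<noteq> {0})"

definition stratification ::
  "('e::euclidean_space \<Rightarrow> 'e \<Rightarrow> 'e) \<Rightarrow> nat \<Rightarrow> (nat \<Rightarrow> 'e set) \<Rightarrow> bool" where
  "stratification br d V \<longleftrightarrow>
     (\<forall>i\<ge>1. subspace (V i)) \<and> (\<forall>i>d. V i = {0}) \<and>
     (\<forall>x. \<exists>!v. v \<in> (\<Pi>\<^sub>E i\<in>{1..d}. V i) \<and> x = (\<Sum>i=1..d. v i)) \<and>
     (\<forall>j\<ge>1. span {br u v | u v. u \<in> V 1 \<and> v \<in> V j} = V (Suc j))"

definition stratified_nilpotent_group ::
  "'g::{t2_space,second_countable_topology} monoid \<Rightarrow> ('g, 'e::euclidean_space) chart set \<Rightarrow>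
   ('g, 'e) chart \<Rightarrow> nat \<Rightarrow> (nat \<Rightarrow> 'e set) \<Rightarrow> bool" where
  "stratified_nilpotent_group G A c d V \<longleftrightarrow>
     lie_group G A \<and> simply_connected (UNIV :: 'g set) \<and> c \<in> A \<and> \<one>\<^bsub>G\<^esub> \<in> fst c \<and>
     nilpotent_of_step (lie_bracket G c) d \<and> stratification (lie_bracket G c) d V"

definition lie_automorphism ::
  "'g::topological_space monoid \<Rightarrow> ('g, 'e::real_normed_vector) chart set \<Rightarrow> ('g \<Rightarrow> 'g) \<Rightarrow> bool" where
  "lie_automorphism G A \<sigma> \<longleftrightarrow>
     \<sigma> \<in> iso G G \<and> smooth_map A A \<sigma> \<and> smooth_map A A (inv_into (carrier G) \<sigma>)"

definition scaling_automorphism ::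
  "'g::topological_space monoid \<Rightarrow> ('g, 'e::euclidean_space) chart set \<Rightarrow> ('g, 'e) chart \<Rightarrow>
   nat \<Rightarrow> (nat \<Rightarrow> 'e set) \<Rightarrow> real \<Rightarrow> 'g \<Rightarrow> 'g" where
  "scaling_automorphism G A c d V t =
     (THE \<sigma>. lie_automorphism G A \<sigma> \<and>
        (\<exists>D. ((snd c \<circ> \<sigma> \<circ> chart_param c) has_derivative D) (at (snd c \<one>\<^bsub>G\<^esub>)) \<and>
             (\<forall>j\<in>{1..d}. \<forall>v\<in>V j. D v = t ^ j *\<^sub>R v)))"

definition left_haar_measure :: "'g::topological_space monoid \<Rightarrow> 'g measure \<Rightarrow> bool" where
  "left_haar_measure G M \<longleftrightarrow> sets M = sets borel \<and> emeasure M UNIV \<noteq> 0 \<and>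
     (\<forall>K. compact K \<longrightarrow> emeasure M K < \<infinity>) \<and>
     (\<forall>g. \<forall>E\<in>sets borel. emeasure M ((\<lambda>x. g \<otimes>\<^bsub>G\<^esub> x) ` E) = emeasure M E)"

text \<open>A discrete subgroup of finite covolume.\<close>

definition lattice_in :: "'g::topological_space monoid \<Rightarrow> 'g set \<Rightarrow> bool" where
  "lattice_in G \<Gamma> \<longleftrightarrow> subgroup \<Gamma> G \<and> discrete \<Gamma> \<and>
     (\<exists>M F. left_haar_measure G M \<and> F \<in> sets borel \<and> emeasure M F < \<infinity> \<and>
        (\<Union>\<gamma>\<in>\<Gamma>. (\<lambda>x. \<gamma> \<otimes>\<^bsub>G\<^esub> x) ` F) = carrier G)"


section \<open>The curvature form of the horizontal distribution\<close>

text \<open>Left-invariant 1-forms \<open>\<eta> 0, \<dots>, \<eta> (n - n\<^sub>1 - 1)\<close>, given as linear forms on the Lie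
  algebra, whose common zero set is \<open>V\<^sub>1\<close>.\<close>

definition horizontal_coframe :: "'e::euclidean_space set \<Rightarrow> (nat \<Rightarrow> 'e \<Rightarrow> real) \<Rightarrow> bool" where
  "horizontal_coframe V1 \<eta> \<longleftrightarrow>
     (\<forall>i < DIM('e) - dim V1. linear (\<eta> i)) \<and> V1 = {v. \<forall>i < DIM('e) - dim V1. \<eta> i v = 0}"

text \<open>The differential of a left-invariant 1-form (up to the sign convention).\<close>

definition curvature ::
  "('e::real_vector \<Rightarrow> 'e \<Rightarrow> 'e) \<Rightarrow> (nat \<Rightarrow> 'e \<Rightarrow> real) \<Rightarrow> nat \<Rightarrow> 'e \<Rightarrow> 'e \<Rightarrow> real" where
  "curvature br \<eta> i X Y = (1/2) * \<eta> i (br X Y)"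

definition Omega_isotropic ::
  "('e::euclidean_space \<Rightarrow> 'e \<Rightarrow> 'e) \<Rightarrow> 'e set \<Rightarrow> (nat \<Rightarrow> 'e \<Rightarrow> real) \<Rightarrow> 'e set \<Rightarrow> bool" where
  "Omega_isotropic br V1 \<eta> S \<longleftrightarrow>
     (\<forall>i < DIM('e) - dim V1. \<forall>X\<in>S. \<forall>Y\<in>S. curvature br \<eta> i X Y = 0)"

definition Omega_regular ::
  "('e::euclidean_space \<Rightarrow> 'e \<Rightarrow> 'e) \<Rightarrow> 'e set \<Rightarrow> (nat \<Rightarrow> 'e \<Rightarrow> real) \<Rightarrow> 'e set \<Rightarrow> bool" where
  "Omega_regular br V1 \<eta> S \<longleftrightarrow>
     (\<exists>X :: nat \<Rightarrow> 'e. inj_on X {..<dim S} \<and> independent (X ` {..<dim S}) \<and>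
        span (X ` {..<dim S}) = S \<and>
        (\<forall>\<sigma> :: nat \<Rightarrow> nat \<Rightarrow> real. \<exists>\<xi>\<in>V1. \<forall>i < DIM('e) - dim V1. \<forall>j < dim S.
           curvature br \<eta> i \<xi> (X j) = \<sigma> i j))"


section \<open>The distance of a left-invariant Riemannian metric\<close>

definition inner_product_form :: "('e::euclidean_space \<Rightarrow> 'e \<Rightarrow> real) \<Rightarrow> bool" where
  "inner_product_form B \<longleftrightarrow>
     bilinear B \<and> (\<forall>v w. B v w = B w v) \<and> (\<forall>v. v \<noteq> 0 \<longrightarrow> B v v > 0)"

definition piecewise_C1_curve ::
  "('m::topological_space, 'e::real_normed_vector) chart set \<Rightarrow> (real \<Rightarrow> 'm) \<Rightarrow> bool" where
  "piecewise_C1_curve A \<gamma> \<longleftrightarrow> path \<gamma> \<and>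
     (\<exists>T. finite T \<and>
        (\<forall>c\<in>A. (snd c \<circ> \<gamma>) C1_differentiable_on ({t\<in>{0..1}. \<gamma> t \<in> fst c} - T)))"

text \<open>The velocity of \<open>\<gamma>\<close> at time \<open>t\<close>, translated back to the identity by \<open>\<gamma>(t)\<^sup>-\<^sup>1\<close>.\<close>

definition left_velocity ::
  "'g monoid \<Rightarrow> ('g, 'e::real_normed_vector) chart \<Rightarrow> (real \<Rightarrow> 'g) \<Rightarrow> real \<Rightarrow> 'e" where
  "left_velocity G c \<gamma> t =
     vector_derivative (\<lambda>s. snd c (inv\<^bsub>G\<^esub> (\<gamma> t) \<otimes>\<^bsub>G\<^esub> \<gamma> s)) (at t)"

text \<open>\<open>B\<close> is the inner product on the Lie algebra that determines the left-invariant metric.\<close>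

definition riemannian_length ::
  "'g monoid \<Rightarrow> ('g, 'e::real_normed_vector) chart \<Rightarrow> ('e \<Rightarrow> 'e \<Rightarrow> real) \<Rightarrow> (real \<Rightarrow> 'g) \<Rightarrow> ennreal" where
  "riemannian_length G c B \<gamma> =
     (\<integral>\<^sup>+t\<in>{0..1}. ennreal (sqrt (B (left_velocity G c \<gamma> t) (left_velocity G c \<gamma> t))) \<partial>lborel)"

definition riemannian_dist ::
  "'g::topological_space monoid \<Rightarrow> ('g, 'e::real_normed_vector) chart set \<Rightarrow> ('g, 'e) chart \<Rightarrow>
   ('e \<Rightarrow> 'e \<Rightarrow> real) \<Rightarrow> 'g \<Rightarrow> 'g \<Rightarrow> real" where
  "riemannian_dist G A c B x y =
     enn2real (INF \<gamma>\<in>{\<gamma>. piecewise_C1_curve A \<gamma> \<and> pathstart \<gamma> = x \<and> pathfinish \<gamma> = y}.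
       riemannian_length G c B \<gamma>)"


section \<open>Hausdorff measure and Lipschitz chains\<close>

text \<open>Here and below \<open>dst\<close> is the distance function of a metric space with underlying set the
  whole type \<open>'x\<close>. The normalisation makes the \<open>m\<close>-dimensional Hausdorff measure of
  \<open>\<real>\<^sup>m\<close> the Lebesgue measure.\<close>

definition ediam :: "('x \<Rightarrow> 'x \<Rightarrow> real) \<Rightarrow> 'x set \<Rightarrow> ennreal" where
  "ediam dst E = (SUP x\<in>E. SUP y\<in>E. ennreal (dst x y))"

definition hausdorff_gauge :: "('x \<Rightarrow> 'x \<Rightarrow> real) \<Rightarrow> nat \<Rightarrow> 'x set \<Rightarrow> ennreal" where
  "hausdorff_gauge dst m E =
     (if E = {} then 0 else ennreal (unit_ball_vol (real m)) * (ediam dst E / 2) ^ m)"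

definition hausdorff_measure :: "('x \<Rightarrow> 'x \<Rightarrow> real) \<Rightarrow> nat \<Rightarrow> 'x set \<Rightarrow> ennreal" where
  "hausdorff_measure dst m S =
     (SUP \<delta>\<in>{0<..}. INF E\<in>{E :: nat \<Rightarrow> 'x set. S \<subseteq> (\<Union>i. E i) \<and> (\<forall>i. ediam dst (E i) \<le> ennreal \<delta>)}.
        suminf (\<lambda>i. hausdorff_gauge dst m (E i)))"

definition lipschitz_simplex :: "('x \<Rightarrow> 'x \<Rightarrow> real) \<Rightarrow> nat \<Rightarrow> ((nat \<Rightarrow> real) \<Rightarrow> 'x) \<Rightarrow> bool" where
  "lipschitz_simplex dst m f \<longleftrightarrow> f \<in> extensional (standard_simplex m) \<and>
     (\<exists>L. \<forall>x\<in>standard_simplex m. \<forall>y\<in>standard_simplex m.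
        dst (f x) (f y) \<le> L * sqrt (\<Sum>i\<le>m. (x i - y i)\<^sup>2))"

definition lipschitz_chain :: "('x \<Rightarrow> 'x \<Rightarrow> real) \<Rightarrow> nat \<Rightarrow> 'x chain \<Rightarrow> bool" where
  "lipschitz_chain dst m a \<longleftrightarrow> (\<forall>f\<in>Poly_Mapping.keys a. lipschitz_simplex dst m f)"

text \<open>\<open>chain_boundary 0\<close> is zero, so 0-cycles need the condition on the total coefficient.\<close>

definition lipschitz_cycle :: "('x \<Rightarrow> 'x \<Rightarrow> real) \<Rightarrow> nat \<Rightarrow> 'x chain \<Rightarrow> bool" where
  "lipschitz_cycle dst m a \<longleftrightarrow> lipschitz_chain dst m a \<and>
     (if m = 0 then (\<Sum>f\<in>Poly_Mapping.keys a. Poly_Mapping.lookup a f) = 0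
      else chain_boundary m a = 0)"

definition mass :: "('x \<Rightarrow> 'x \<Rightarrow> real) \<Rightarrow> nat \<Rightarrow> 'x chain \<Rightarrow> ennreal" where
  "mass dst m a = (\<Sum>f\<in>Poly_Mapping.keys a.
     ennreal (real_of_int \<bar>Poly_Mapping.lookup a f\<bar>) * hausdorff_measure dst m (f ` standard_simplex m))"


section \<open>Higher divergence functions\<close>

definition avoidant :: "('x \<Rightarrow> 'x \<Rightarrow> real) \<Rightarrow> 'x \<Rightarrow> real \<Rightarrow> nat \<Rightarrow> 'x chain \<Rightarrow> bool" where
  "avoidant dst bp r m a \<longleftrightarrow>
     (\<forall>f\<in>Poly_Mapping.keys a. f ` standard_simplex m \<inter> {x. dst bp x < r} = {})"

definition acyclic_at_infinity :: "('x \<Rightarrow> 'x \<Rightarrow> real) \<Rightarrow> 'x \<Rightarrow> real \<Rightarrow> nat \<Rightarrow> bool" where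
  "acyclic_at_infinity dst bp \<rho> N \<longleftrightarrow>
     (\<forall>j\<le>N. \<forall>r>0. \<forall>a. lipschitz_cycle dst j a \<and> avoidant dst bp r j a \<longrightarrow>
        (\<exists>b. lipschitz_chain dst (Suc j) b \<and> avoidant dst bp (\<rho> * r) (Suc j) b \<and>
             chain_boundary (Suc j) b = a))"

text \<open>Extended-real valued: the value is \<open>-\<infinity>\<close> if no \<open>N\<close> is admissible and \<open>\<infinity>\<close> if all are.\<close>

definition divdim :: "('x \<Rightarrow> 'x \<Rightarrow> real) \<Rightarrow> 'x \<Rightarrow> ereal" where
  "divdim dst bp =
     (SUP N\<in>{N. \<exists>\<rho>. 0 < \<rho> \<and> \<rho> \<le> 1 \<and> acyclic_at_infinity dst bp \<rho> N}. ereal (real N))"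

definition Div ::
  "('x \<Rightarrow> 'x \<Rightarrow> real) \<Rightarrow> 'x \<Rightarrow> nat \<Rightarrow> real \<Rightarrow> real \<Rightarrow> real \<Rightarrow> ennreal" where
  "Div dst bp m \<rho> \<alpha> r =
     (SUP a\<in>{a. lipschitz_cycle dst m a \<and> avoidant dst bp r m a \<and>
                mass dst m a \<le> ennreal (\<alpha> * r ^ m)}.
      INF b\<in>{b. lipschitz_chain dst (Suc m) b \<and> avoidant dst bp (\<rho> * r) (Suc m) b \<and>
                chain_boundary (Suc m) b = a}.
        mass dst (Suc m) b)"

text \<open>The families are only meaningful for a first parameter in \<open>(0,1]\<close>; the condition
  \<open>L * s\<^sub>0 \<le> 1\<close> keeps \<open>L * s\<close> in this range.\<close>

definition family_le ::
  "nat \<Rightarrow> (real \<Rightarrow> real \<Rightarrow> real \<Rightarrow> ennreal) \<Rightarrow> (real \<Rightarrow> real \<Rightarrow> real \<Rightarrow> ennreal) \<Rightarrow> bool" where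
  "family_le m F H \<longleftrightarrow>
     (\<exists>s\<^sub>0 t\<^sub>0 L M. 0 < s\<^sub>0 \<and> s\<^sub>0 \<le> 1 \<and> 0 < t\<^sub>0 \<and> 1 \<le> L \<and> 1 \<le> M \<and> L * s\<^sub>0 \<le> 1 \<and>
        (\<forall>s t. 0 < s \<and> s \<le> s\<^sub>0 \<and> t\<^sub>0 \<le> t \<longrightarrow>
           (\<exists>A\<ge>1. \<exists>C\<ge>0. \<exists>x\<^sub>0>0. \<forall>x\<ge>x\<^sub>0.
              F s t x \<le> ennreal A * H (L * s) (M * t) (A * x + A) + ennreal (C * x ^ m))))"

end

theory Submission
  imports Defs
begin

text \<open>Put \<open>m = j + 1\<close>. The lower bound comes from a flat: the group contains a copy of \<open>\<real>\<^sup>m\<close>, the image of a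
homomorphism \<open>\<phi>\<close> with directions in \<open>S\<close>, together with \<open>m\<close> Lipschitz homomorphisms \<open>\<pi> i\<close> from the whole group
to \<open>\<real>\<close> that restrict to the coordinates of the flat. Given such a flat (\<open>divergence_of_flat\<close>), let the cycle be
the boundary of an affine \<open>m\<close>-simplex of side proportional to \<open>R\<close> in the flat. It has mass of order at most
\<open>R ^ j\<close> and stays at distance \<open>R\<close> from the base point. In the coordinates \<open>\<pi> i\<close> every filling of it,
wherever it runs, has to pass through every interior point of the simplex: otherwise a fine subdivision of the
filling would contradict Sperner's lemma modulo two (\<open>filling_hits_interior_point\<close>). So the coordinate image of
the filling contains a cube of volume of order \<open>R ^ m\<close>, and since Lipschitz maps do not increase Hausdorff measure
by more than a constant factor, the filling has mass of at least this order.

The flat is found as follows. By isotropy the bracket of two elements of \<open>S\<close> lies in \<open>V 1\<close>, and by the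
stratification it lies in \<open>V 2\<close>, so it vanishes. Hence the one-parameter subgroups with directions in \<open>S\<close>
commute (\<open>commuting_one_parameter_subgroups\<close>) and their product is the homomorphism \<open>\<phi>\<close>. By regularity,
bracketing with a nonzero element \<open>s\<close> of \<open>S\<close> maps \<open>V 1\<close> onto \<open>V 2\<close>, and the algebra is the sum of
\<open>V 1\<close> and \<open>V 2\<close>. If \<open>s\<close> were a linear combination of brackets, all of \<open>V 2\<close> would lie in
every term of the lower central series, so \<open>V 2\<close> would be zero by nilpotency, and with it all brackets and \<open>s\<close>
(\<open>regular_subspace_avoids_brackets\<close>). Therefore
the coordinates on \<open>S\<close> extend to linear forms on the Lie algebra that vanish on all brackets. The left-invariant
\<open>1\<close>-form of such a form is closed, so it has a primitive near the identity that is additive for the group product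
(\<open>local_homomorphism\<close>), and simple connectedness extends this primitive to a homomorphism \<open>\<pi> i\<close> on the
group (\<open>global_homomorphism\<close>). Its derivative is bounded in left-invariant terms, which makes it Lipschitz for the
Riemannian distance (\<open>homomorphism_lipschitz\<close>).\<close>

section \<open>Fillings of the boundary of a simplex\<close>

text \<open>The total coefficient of the generators with property \<open>P\<close>. Written with \<open>frag_extend\<close> it is additive by
construction; only its parity will matter.\<close>

definition weight :: "('a \<Rightarrow> bool) \<Rightarrow> ('a \<Rightarrow>\<^sub>0 int) \<Rightarrow> int" where
  "weight P c = poly_mapping.lookup (frag_extend (\<lambda>f. frag_of (P f)) c) True"

lemma weight_add: "weight P (a + b) = weight P a + weight P b"
  by (simp add: weight_def frag_extend_add lookup_add)

lemma weight_0 [simp]: "weight P 0 = 0"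
  by (simp add: weight_def)

lemma weight_minus: "weight P (- a) = - weight P a"
  using weight_add[of P a "- a"] by simp

lemma weight_diff: "weight P (a - b) = weight P a - weight P b"
  using weight_add[of P "a - b" b] by simp

lemma weight_of: "weight P (frag_of f) = of_bool (P f)"
  by (simp add: weight_def)

lemma weight_sum: "weight P (sum g I) = (\<Sum>i\<in>I. weight P (g i))"
  by (induction I rule: infinite_finite_induct) (simp_all add: weight_add)

lemma weight_sign: "even (weight P (frag_cmul ((-1) ^ k) c)) \<longleftrightarrow> even (weight P c)"
  by (cases "even k") (simp_all add: weight_minus)

lemma weight_eq_0:
  assumes "\<And>f. f \<in> Poly_Mapping.keys c \<Longrightarrow> \<not> P f"
  shows "weight P c = 0"
proof -
  have "Poly_Mapping.keys c \<subseteq> {f. \<not> P f}" using assms by auto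
  then show ?thesis
    by (induction c rule: frag_induction) (simp_all add: weight_of weight_diff)
qed

definition corner :: "nat \<Rightarrow> nat \<Rightarrow> real" where
  "corner k = (\<lambda>j. if j = k then 1 else 0)"

lemma corner_in_simplex [simp]: "corner k \<in> standard_simplex p \<longleftrightarrow> k \<le> p"
  by (simp add: corner_def)

lemma simplical_face_corner:
  "simplical_face k (corner i) = corner (if i < k then i else Suc i)"
  by (auto simp: simplical_face_def corner_def fun_eq_iff)

definition labels :: "('a \<Rightarrow> nat) \<Rightarrow> nat \<Rightarrow> ((nat \<Rightarrow> real) \<Rightarrow> 'a) \<Rightarrow> nat set" where
  "labels l p f = (\<lambda>k. l (f (corner k))) ` {..p}"

lemma labels_singular_face:
  assumes "k \<le> Suc p"
  shows "labels l p (singular_face (Suc p) k f) = (\<lambda>i. l (f (corner i))) ` ({..Suc p} - {k})"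
proof -
  have image_face: "(\<lambda>i. if i < k then i else Suc i) ` {..p} = {..Suc p} - {k}"
  proof (intro subset_antisym subsetI)
    fix i assume i: "i \<in> {..Suc p} - {k}"
    show "i \<in> (\<lambda>i. if i < k then i else Suc i) ` {..p}"
      using i assms by (cases "i < k") (force intro: image_eqI[of _ _ i], force intro: image_eqI[of _ _ "i - 1"])
  qed (use assms in \<open>auto split: if_splits\<close>)
  show ?thesis
    unfolding labels_def image_face[symmetric] image_image
    by (rule image_cong) (simp_all add: singular_face_def simplical_face_corner)
qed

text \<open>The counting step of Sperner's lemma. Call a facet a door if its labels are \<open>{1..Suc p}\<close>. If all labels occur, the
only door is opposite to the vertex with label \<open>0\<close>. Otherwise a door can exist only if exactly one label occurs
twice, and then the two doors are opposite to the two vertices that share it.\<close>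

lemma odd_doors:
  fixes l :: "nat \<Rightarrow> nat"
  assumes range: "l ` {..Suc p} \<subseteq> {..Suc p}"
  shows "odd (card {k. k \<le> Suc p \<and> l ` ({..Suc p} - {k}) = {1..Suc p}}) \<longleftrightarrow> l ` {..Suc p} = {..Suc p}"
    (is "odd (card ?K) \<longleftrightarrow> ?full")
proof (cases ?full)
  case True
  then have inj: "inj_on l {..Suc p}"
    by (simp add: eq_card_imp_inj_on)
  have "0 \<in> l ` {..Suc p}" using True by simp
  then obtain k0 where k0: "k0 \<le> Suc p" "l k0 = 0"
    by auto
  have "l ` ({..Suc p} - {k}) = {..Suc p} - {l k}" if "k \<le> Suc p" for k
    using that True by (subst inj_on_image_set_diff[OF inj]) auto
  moreover have "{..Suc p} - {i} = {1..Suc p} \<longleftrightarrow> i = 0" for i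
  proof
    assume "{..Suc p} - {i} = {1..Suc p}"
    then have "0 \<notin> {..Suc p} - {i}" by auto
    then show "i = 0" by auto
  qed auto
  ultimately have "?K = {k. k \<le> Suc p \<and> l k = 0}" by auto
  also have "\<dots> = {k0}" using k0 inj by (auto simp: inj_on_def)
  finally show ?thesis using True by simp
next
  case False
  show ?thesis
  proof (cases "?K = {}")
    case True then show ?thesis using False unfolding True by simp
  next
    case ne: False
    then obtain k1 where k1: "k1 \<le> Suc p" "l ` ({..Suc p} - {k1}) = {1..Suc p}" by auto
    have img: "l ` {..Suc p} = {1..Suc p}"
    proof -
      have "l ` {..Suc p} = insert (l k1) (l ` ({..Suc p} - {k1}))" using k1(1) by auto
      then have eq: "l ` {..Suc p} = insert (l k1) {1..Suc p}" using k1(2) by simp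
      moreover have "insert 0 {1..Suc p} = {..Suc p}" by auto
      ultimately have "l k1 \<noteq> 0" using False by metis
      moreover have "l k1 \<le> Suc p" using range k1(1) by auto
      ultimately show ?thesis using eq by auto
    qed
    have "\<not> inj_on l {..Suc p}"
    proof
      assume "inj_on l {..Suc p}"
      then have "card (l ` {..Suc p}) = card {..Suc p}" by (rule card_image)
      then show False unfolding img by simp
    qed
    then obtain a b where ab: "a \<le> Suc p" "b \<le> Suc p" "a \<noteq> b" "l a = l b"
      by (auto simp: inj_on_def)
    have drop: "l ` ({..Suc p} - {u}) = {1..Suc p}" if "v \<le> Suc p" "u \<noteq> v" "l u = l v" for u v
      unfolding img[symmetric]
    proof (intro subset_antisym subsetI)
      fix y assume "y \<in> l ` {..Suc p}"
      then obtain w where "w \<le> Suc p" "y = l w" by blast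
      then show "y \<in> l ` ({..Suc p} - {u})" using that by (cases "w = u") auto
    qed blast
    have imga: "l ` ({..Suc p} - {a}) = {1..Suc p}" and imgb: "l ` ({..Suc p} - {b}) = {1..Suc p}"
      using drop ab by metis+
    have inja: "inj_on l ({..Suc p} - {a})"
      by (rule eq_card_imp_inj_on) (use ab in \<open>auto simp: imga\<close>)
    have "k = a \<or> k = b" if k: "k \<le> Suc p" "l ` ({..Suc p} - {k}) = {1..Suc p}" for k
    proof (rule ccontr)
      assume n: "\<not> (k = a \<or> k = b)"
      have "l k \<in> l ` ({..Suc p} - {k})" using k img by auto
      then obtain j0 where "l k = l j0" "j0 \<in> {..Suc p} - {k}" by (rule imageE)
      then have j: "j0 \<le> Suc p" "j0 \<noteq> k" "l j0 = l k" by auto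
      show False
      proof (cases "j0 = a")
        case True
        then have "l b = l k" using ab j by simp
        then show False using inja ab n k by (auto simp: inj_on_def)
      next
        case False
        then show False using inja j k n by (auto simp: inj_on_def)
      qed
    qed
    then have "?K = {a, b}" using ab imga imgb by auto
    then show ?thesis using ab False by simp
  qed
qed

text \<open>Sperner's double counting for chains: modulo two the signs in the boundary disappear, so the boundary counts the
doors of all simplices, and \<open>odd_doors\<close> turns this into a count of the fully labelled simplices.\<close>

lemma weight_full_eq_weight_door:
  assumes "\<And>f k. f \<in> Poly_Mapping.keys c \<Longrightarrow> k \<le> Suc p \<Longrightarrow> l (f (corner k)) \<le> Suc p"
  shows "even (weight (\<lambda>f. labels l (Suc p) f = {..Suc p}) c
             - weight (\<lambda>g. labels l p g = {1..Suc p}) (chain_boundary (Suc p) c))"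
proof -
  let ?F = "\<lambda>f. labels l (Suc p) f = {..Suc p}" and ?D = "\<lambda>g. labels l p g = {1..Suc p}"
  have "Poly_Mapping.keys c \<subseteq> {f. \<forall>k\<le>Suc p. l (f (corner k)) \<le> Suc p}" using assms by auto
  then show ?thesis
  proof (induction c rule: frag_induction)
    case (one f)
    let ?l = "\<lambda>k. l (f (corner k))"
    have "weight ?D (chain_boundary (Suc p) (frag_of f))
        = (\<Sum>k\<le>Suc p. weight ?D (frag_cmul ((-1) ^ k) (frag_of (singular_face (Suc p) k f))))"
      by (simp add: chain_boundary_of weight_sum del: sum.atMost_Suc)
    moreover have "even (\<Sum>k\<le>Suc p. weight ?D (frag_cmul ((-1) ^ k) (frag_of (singular_face (Suc p) k f)))) \<longleftrightarrow>
        even (card {k \<in> {..Suc p}. odd (weight ?D (frag_cmul ((-1) ^ k) (frag_of (singular_face (Suc p) k f))))})"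
      by (rule even_sum_iff) simp
    moreover have "{k \<in> {..Suc p}. odd (weight ?D (frag_cmul ((-1) ^ k) (frag_of (singular_face (Suc p) k f))))}
        = {k. k \<le> Suc p \<and> ?l ` ({..Suc p} - {k}) = {1..Suc p}}"
      by (rule Collect_cong) (simp add: weight_sign weight_of labels_singular_face cong: conj_cong)
    moreover have "odd (card {k. k \<le> Suc p \<and> ?l ` ({..Suc p} - {k}) = {1..Suc p}}) \<longleftrightarrow> ?F f"
      unfolding labels_def by (rule odd_doors) (use one in auto)
    ultimately have "odd (weight ?D (chain_boundary (Suc p) (frag_of f))) \<longleftrightarrow> ?F f"
      by (simp only:)
    then show ?case by (cases "?F f") (auto simp: weight_of)
  next
    case (diff a b)
    then show ?case by (simp add: weight_diff chain_boundary_diff)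
  qed simp
qed

lemma singular_chain_singular_subdivision_power:
  "singular_chain p X c \<Longrightarrow> singular_chain p X ((singular_subdivision p ^^ n) c)"
  by (induction n) (auto intro: singular_chain_singular_subdivision)

lemma chain_boundary_singular_subdivision_power:
  assumes "singular_chain p X c"
  shows "chain_boundary p ((singular_subdivision p ^^ n) c)
       = (singular_subdivision (p - Suc 0) ^^ n) (chain_boundary p c)"
proof (induction n)
  case (Suc n)
  then show ?case
    using chain_boundary_singular_subdivision[OF singular_chain_singular_subdivision_power[OF assms]]
    by simp
qed simp

text \<open>Suppose that the coordinates \<open>\<beta> i y - q i\<close> are never all equal on the filling, and label a point by the first
\<open>i\<close> for which this number is maximal. The sets on which \<open>i\<close> is not maximal form an open cover, so after enough
subdivisions every simplex of the filling misses some label, and none is fully labelled. The simplex \<open>\<sigma>\<close> with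
the same boundary has its vertices labelled bijectively; the prism operator between \<open>\<sigma>\<close> and its subdivision does
not change the parity, because the face of \<open>\<sigma>\<close> opposite to vertex \<open>k\<close> never carries the label \<open>k\<close>. So the
subdivided \<open>\<sigma>\<close> has an odd number of fully labelled simplices, and by double counting on the common boundary so
does the subdivided filling.

If the \<open>\<beta> i\<close> sum to one, as barycentric coordinates do, equality of the differences means that \<open>\<beta> = q\<close>.\<close>

theorem filling_hits_interior_point:
  fixes \<beta> :: "nat \<Rightarrow> 'a \<Rightarrow> real"
  assumes b: "singular_chain (Suc p) X b" and \<sigma>: "singular_simplex (Suc p) X \<sigma>"
    and bd: "chain_boundary (Suc p) b = chain_boundary (Suc p) (frag_of \<sigma>)"
    and cont: "\<And>i. i \<le> Suc p \<Longrightarrow> continuous_map X euclideanreal (\<beta> i)"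
    and \<beta>\<sigma>: "\<And>x i. x \<in> standard_simplex (Suc p) \<Longrightarrow> i \<le> Suc p \<Longrightarrow> \<beta> i (\<sigma> x) = x i"
    and q: "\<And>i. i \<le> Suc p \<Longrightarrow> 0 < q i" "(\<Sum>i\<le>Suc p. q i) = 1"
  shows "\<exists>f\<in>Poly_Mapping.keys b. \<exists>x\<in>standard_simplex (Suc p).
    \<forall>i\<le>Suc p. \<forall>j\<le>Suc p. \<beta> i (f x) - q i = \<beta> j (f x) - q j"
proof (rule ccontr)
  assume contra: "\<not> ?thesis"
  let ?S = "\<lambda>n. standard_simplex n"
  define \<gamma> where "\<gamma> i y = \<beta> i y - q i" for i y
  define Y where "Y = subtopology X {y. \<not> (\<forall>i\<le>Suc p. \<forall>j\<le>Suc p. \<gamma> i y = \<gamma> j y)}"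
  define W where "W i = {y \<in> topspace Y. \<exists>j\<le>Suc p. \<gamma> i y < \<gamma> j y}" for i
  define top where "top y i \<longleftrightarrow> i \<le> Suc p \<and> (\<forall>j\<le>Suc p. \<gamma> j y \<le> \<gamma> i y)" for y i
  define l where "l y = (LEAST i. top y i)" for y
  have extop: "\<exists>i. top y i" for y
  proof -
    have "Max ((\<lambda>j. \<gamma> j y) ` {..Suc p}) \<in> (\<lambda>j. \<gamma> j y) ` {..Suc p}" by (rule Max_in) auto
    then obtain i where "i \<le> Suc p" "\<gamma> i y = Max ((\<lambda>j. \<gamma> j y) ` {..Suc p})"
      by (auto simp del: Max_in)
    then have "top y i" unfolding top_def by (auto intro: Max_ge)
    then show ?thesis by blast
  qed
  have topl: "top y (l y)" for y
    unfolding l_def by (rule LeastI_ex[OF extop])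
  have lle: "l y \<le> Suc p" for y using topl top_def by auto
  let ?F = "\<lambda>f. labels l (Suc p) f = {..Suc p}" and ?D = "\<lambda>g. labels l p g = {1..Suc p}"
  have parity: "even (weight ?F c - weight ?D (chain_boundary (Suc p) c))" for c
    by (rule weight_full_eq_weight_door) (rule lle)
  (* The contrary assumption confines the filling to the subspace Y, where some i is not maximal. *)
  have bY: "singular_chain (Suc p) Y b"
    unfolding Y_def singular_chain_subtopology
  proof (intro conjI b ballI subsetI)
    fix f y assume f: "f \<in> Poly_Mapping.keys b" and "y \<in> f ` ?S (Suc p)"
    then obtain x where "x \<in> ?S (Suc p)" "y = f x" by auto
    then show "y \<in> {y. \<not> (\<forall>i\<le>Suc p. \<forall>j\<le>Suc p. \<gamma> i y = \<gamma> j y)}"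
      using f contra unfolding \<gamma>_def by blast
  qed
  have cont\<gamma>: "continuous_map Y euclideanreal (\<gamma> i)" if "i \<le> Suc p" for i
    unfolding Y_def \<gamma>_def using cont[OF that]
    by (intro continuous_map_from_subtopology continuous_map_diff) auto
  have opW: "openin Y U" if "U \<in> W ` {..Suc p}" for U
  proof -
    from that obtain i0 where "U = W i0" "i0 \<in> {..Suc p}" by (rule imageE)
    then obtain i where i: "i \<le> Suc p" "U = W i" by simp
    have "U = (\<Union>j\<le>Suc p. {y \<in> topspace Y. \<gamma> j y - \<gamma> i y \<in> {0<..}})"
      unfolding i W_def by auto
    moreover have "openin Y {y \<in> topspace Y. \<gamma> j y - \<gamma> i y \<in> {0<..}}" if "j \<le> Suc p" for j
      by (rule openin_continuous_map_preimage[of _ euclideanreal])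
         (use that i in \<open>auto intro!: continuous_map_diff cont\<gamma>\<close>)
    ultimately show ?thesis by auto
  qed
  have cov: "topspace Y \<subseteq> \<Union> (W ` {..Suc p})"
  proof
    fix y assume y: "y \<in> topspace Y"
    then obtain i j where "i \<le> Suc p" "j \<le> Suc p" "\<gamma> i y \<noteq> \<gamma> j y" unfolding Y_def by auto
    then have "y \<in> W i \<or> y \<in> W j" using y unfolding W_def by (metis (mono_tags, lifting) linorder_neqE mem_Collect_eq)
    then show "y \<in> \<Union> (W ` {..Suc p})" using \<open>i \<le> _\<close> \<open>j \<le> _\<close> by auto
  qed
  obtain n where n: "\<And>m f. n \<le> m \<Longrightarrow> f \<in> Poly_Mapping.keys ((singular_subdivision (Suc p) ^^ m) b)
      \<Longrightarrow> \<exists>V\<in>W ` {..Suc p}. f \<in> ?S (Suc p) \<rightarrow> V"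
    using sufficient_iterated_singular_subdivision_exists[OF opW cov bY] by blast
  let ?sd = "\<lambda>c. (singular_subdivision (Suc p) ^^ n) c"
  (* A simplex inside W i has no vertex with label i. *)
  have small: "weight ?F (?sd b) = 0"
  proof (rule weight_eq_0)
    fix f assume "f \<in> Poly_Mapping.keys (?sd b)"
    then obtain i where i: "i \<le> Suc p" "f \<in> ?S (Suc p) \<rightarrow> W i" using n by blast
    have "l (f (corner k)) \<noteq> i" if "k \<le> Suc p" for k
    proof -
      have "f (corner k) \<in> W i" using i that by auto
      then show ?thesis using topl[of "f (corner k)"] unfolding W_def top_def by fastforce
    qed
    then have "i \<notin> labels l (Suc p) f" unfolding labels_def by auto
    then show "labels l (Suc p) f \<noteq> {..Suc p}" using i by auto
  qed
  obtain h :: "nat \<Rightarrow> 'a chain \<Rightarrow> 'a chain" where h: "\<And>p. h p 0 = 0"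
        "\<And>p c1 c2. h p (c1-c2) = h p c1 - h p c2"
        "\<And>p X c. singular_chain p X c \<Longrightarrow> singular_chain (Suc p) X (h p c)"
        "\<And>p X c. singular_chain p X c
                 \<Longrightarrow> chain_boundary (Suc p) (h p c) + h (p - Suc 0) (chain_boundary p c)
                   = (singular_subdivision p ^^ n) c - c"
    by (blast intro: chain_homotopic_iterated_singular_subdivision[of n])
  have hneg: "h r (- c) = - h r c" for r c using h(2)[of r 0 c] h(1) by simp
  have hadd: "h r (c + d) = h r c + h r d" for r c d
    using h(2)[of r c "- d"] by (simp add: hneg)
  have hsum: "h r (sum g I) = (\<Sum>i\<in>I. h r (g i))" for r g and I :: "nat set"
    by (induction I rule: infinite_finite_induct) (simp_all add: hadd h(1))
  have hsign: "h r (frag_cmul ((-1) ^ k) c) = frag_cmul ((-1) ^ k) (h r c)" for r k c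
    by (cases "even k") (simp_all add: hneg)
  have \<sigma>c: "singular_chain (Suc p) X (frag_of \<sigma>)" using \<sigma> by (simp add: singular_chain_of)
  (* On face k the coordinate k vanishes, so k can be maximal only if all coordinates x j - q j are
     negative; but their sum is zero. *)
  have side: "even (weight ?F (h p (frag_of (singular_face (Suc p) k \<sigma>))))" if k: "k \<le> Suc p" for k
  proof -
    let ?g = "singular_face (Suc p) k \<sigma>"
    have "singular_simplex p (subtopology X (?g ` ?S p)) ?g"
      using singular_simplex_singular_face[OF \<sigma>, of k] k by (simp add: singular_simplex_subtopology)
    then have ch: "singular_chain (Suc p) (subtopology X (?g ` ?S p)) (h p (frag_of ?g))"
      by (intro h(3)) (simp add: singular_chain_of)
    have "weight ?F (h p (frag_of ?g)) = 0"
    proof (rule weight_eq_0)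
      fix f assume "f \<in> Poly_Mapping.keys (h p (frag_of ?g))"
      then have f: "f ` ?S (Suc p) \<subseteq> ?g ` ?S p" using ch unfolding singular_chain_subtopology by auto
      have "l (f (corner i)) \<noteq> k" if i: "i \<le> Suc p" for i
      proof
        assume lk: "l (f (corner i)) = k"
        have "f (corner i) \<in> ?g ` ?S p" by (rule subsetD[OF f]) (use i in simp)
        then obtain z where z: "f (corner i) = ?g z" "z \<in> ?S p" by (rule imageE)
        define x where "x = simplical_face k z"
        have x: "x \<in> ?S (Suc p)" "x k = 0" "f (corner i) = \<sigma> x"
          using simplical_face_in_standard_simplex[of "Suc p" k z] z k
          unfolding x_def by (auto simp: simplical_face_def singular_face_def)
        have "\<gamma> j (\<sigma> x) = x j - q j" if "j \<le> Suc p" for j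
          using \<beta>\<sigma>[OF x(1) that] unfolding \<gamma>_def by simp
        moreover have "\<gamma> j (\<sigma> x) \<le> \<gamma> k (\<sigma> x)" if "j \<le> Suc p" for j
          using topl[of "\<sigma> x"] lk x that unfolding top_def by auto
        ultimately have "x j - q j \<le> - q k" if "j \<le> Suc p" for j
          using that k x(2) by fastforce
        then have "x j - q j < 0" if "j \<le> Suc p" for j
          using that q(1)[OF k] by fastforce
        then have "(\<Sum>j\<le>Suc p. x j - q j) < 0"
          using sum_strict_mono[of "{..Suc p}" "\<lambda>j. x j - q j" "\<lambda>_. 0"] by simp
        moreover have "(\<Sum>j\<le>Suc p. x j - q j) = 0"
          using x(1) q(2) by (simp add: sum_subtractf standard_simplex_def)
        ultimately show False by simp
      qed
      then have "k \<notin> labels l (Suc p) f" unfolding labels_def by auto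
      then show "labels l (Suc p) f \<noteq> {..Suc p}" using k by auto
    qed
    then show ?thesis by simp
  qed
  (* The prism formula: the first part lies over the faces of \<sigma>, the second is a boundary. *)
  have "even (weight ?F (h p (chain_boundary (Suc p) (frag_of \<sigma>))))"
    by (simp add: chain_boundary_of hsum hsign weight_sum del: sum.atMost_Suc)
       (intro dvd_sum, simp add: weight_sign side)
  moreover have "even (weight ?F (chain_boundary (Suc (Suc p)) (h (Suc p) (frag_of \<sigma>))))"
  proof -
    have "chain_boundary (Suc p) (chain_boundary (Suc (Suc p)) (h (Suc p) (frag_of \<sigma>))) = 0"
      using chain_boundary_boundary_alt h(3)[OF \<sigma>c] by fastforce
    then show ?thesis using parity[of "chain_boundary (Suc (Suc p)) (h (Suc p) (frag_of \<sigma>))"] by simp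
  qed
  moreover have "?sd (frag_of \<sigma>) = frag_of \<sigma> + chain_boundary (Suc (Suc p)) (h (Suc p) (frag_of \<sigma>))
                     + h p (chain_boundary (Suc p) (frag_of \<sigma>))"
    using h(4)[OF \<sigma>c] by (simp add: algebra_simps)
  ultimately have "even (weight ?F (?sd (frag_of \<sigma>)) - weight ?F (frag_of \<sigma>))"
    by (simp add: weight_add)
  moreover have "weight ?F (frag_of \<sigma>) = 1"
  proof -
    have "l (\<sigma> (corner k)) = k" if k: "k \<le> Suc p" for k
    proof (rule ccontr)
      assume ne: "l (\<sigma> (corner k)) \<noteq> k"
      let ?i = "l (\<sigma> (corner k))"
      have i: "?i \<le> Suc p" by (rule lle)
      have "\<gamma> k (\<sigma> (corner k)) \<le> \<gamma> ?i (\<sigma> (corner k))"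
        using topl[of "\<sigma> (corner k)"] k unfolding top_def by auto
      then have "1 - q k \<le> - q ?i"
        using \<beta>\<sigma>[of "corner k" k] \<beta>\<sigma>[of "corner k" ?i] k i ne unfolding \<gamma>_def by (simp add: corner_def)
      moreover have "q k \<le> 1"
        unfolding q(2)[symmetric] by (rule member_le_sum) (use k q(1) less_imp_le in auto)
      ultimately show False using q(1)[OF i] by simp
    qed
    then have "labels l (Suc p) \<sigma> = {..Suc p}" unfolding labels_def by auto
    then show ?thesis by (simp add: weight_of)
  qed
  ultimately have "odd (weight ?F (?sd (frag_of \<sigma>)))" by simp
  moreover have "chain_boundary (Suc p) (?sd b) = chain_boundary (Suc p) (?sd (frag_of \<sigma>))"
    using chain_boundary_singular_subdivision_power[OF b] chain_boundary_singular_subdivision_power[OF \<sigma>c] bd by simp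
  ultimately show False using parity[of "?sd b"] parity[of "?sd (frag_of \<sigma>)"] small by simp
qed

section \<open>Hausdorff measure and Lipschitz coordinates\<close>

definition coord_map :: "nat \<Rightarrow> (nat \<Rightarrow> 'x \<Rightarrow> real) \<Rightarrow> 'x \<Rightarrow> nat \<Rightarrow> real" where
  "coord_map m \<beta> x = (\<lambda>i\<in>{..<m}. \<beta> i x)"

interpretation lborel_prod: product_sigma_finite "\<lambda>_::nat. lborel :: real measure"
  by unfold_locales

abbreviation lebesgue_coord :: "nat \<Rightarrow> (nat \<Rightarrow> real) measure" where
  "lebesgue_coord m \<equiv> Pi\<^sub>M {..<m} (\<lambda>_. lborel)"

lemma dst_le_ediam:
  assumes "x \<in> E" "y \<in> E"
  shows "ennreal (dst x y) \<le> ediam dst E"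
  unfolding ediam_def using assms by (intro SUP_upper2[of x] SUP_upper2[of y]) auto

text \<open>The coordinates of a set of diameter \<open>d\<close> lie in a box with sides \<open>2 * K * d\<close>, whose volume is a fixed multiple
of the Hausdorff gauge of the set.\<close>

lemma gauge_bounds_coord_box:
  fixes dst :: "'x \<Rightarrow> 'x \<Rightarrow> real"
  assumes K: "K > 0" and m: "m > 0" and nn: "\<And>x y. 0 \<le> dst x y"
    and lip: "\<And>i x y. i < m \<Longrightarrow> \<bar>\<beta> i x - \<beta> i y\<bar> \<le> K * dst x y"
  shows "\<exists>P\<in>sets (lebesgue_coord m). coord_map m \<beta> ` E \<subseteq> P \<and>
           ennreal (unit_ball_vol (real m) / (4 * K) ^ m) * emeasure (lebesgue_coord m) P \<le> hausdorff_gauge dst m E"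
proof (cases "E = {} \<or> ediam dst E = \<infinity>")
  case True
  then show ?thesis
  proof
    assume "E = {}"
    then show ?thesis by (intro bexI[of _ "{}"]) (auto simp: hausdorff_gauge_def)
  next
    assume inf: "ediam dst E = \<infinity>"
    have "\<infinity> / 2 = (\<infinity> :: ennreal)" by (simp add: divide_ennreal_def ennreal_top_mult)
    then have "(ediam dst E / 2) ^ m = \<infinity>" using inf m by (simp add: power_eq_top_ennreal)
    moreover have "E \<noteq> {}"
    proof
      assume "E = {}"
      then have "ediam dst E = 0" by (simp add: ediam_def bot_ennreal)
      then show False using inf by simp
    qed
    ultimately have "hausdorff_gauge dst m E = \<infinity>"
      using less_imp_neq[OF unit_ball_vol_pos[of "real m"]] by (simp add: hausdorff_gauge_def ennreal_mult_eq_top_iff)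
    moreover have "coord_map m \<beta> ` E \<subseteq> space (lebesgue_coord m)"
      unfolding coord_map_def space_PiM by (intro image_subsetI) (simp add: restrict_PiE_iff)
    ultimately show ?thesis by (intro bexI[of _ "space (lebesgue_coord m)"]) auto
  qed
next
  case False
  then obtain x0 where x0: "x0 \<in> E" by auto
  obtain d where d: "d \<ge> 0" "ediam dst E = ennreal d"
    using False by (cases "ediam dst E") auto
  have dst: "dst x0 y \<le> d" if "y \<in> E" for y
    using dst_le_ediam[OF x0 that, of dst] d by (simp add: ennreal_le_iff)
  define P where "P = Pi\<^sub>E {..<m} (\<lambda>i. {\<beta> i x0 - K * d .. \<beta> i x0 + K * d})"
  have "P \<in> sets (lebesgue_coord m)" unfolding P_def by (intro sets_PiM_I_finite) auto
  moreover have "coord_map m \<beta> ` E \<subseteq> P"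
  proof clarify
    fix y assume y: "y \<in> E"
    have "\<bar>\<beta> i x0 - \<beta> i y\<bar> \<le> K * d" if "i < m" for i
      using lip[OF that, of x0 y] dst[OF y] K by (meson less_imp_le mult_left_mono order_trans)
    then show "coord_map m \<beta> y \<in> P" unfolding P_def coord_map_def
      by (auto simp: PiE_iff abs_le_iff algebra_simps)
  qed
  moreover have "emeasure (lebesgue_coord m) P = ennreal ((2 * K * d) ^ m)"
  proof -
    have "emeasure lborel {\<beta> i x0 - K * d..\<beta> i x0 + K * d} = ennreal (2 * K * d)" for i
      using K d(1) by (simp add: mult_nonneg_nonneg)
    then show ?thesis
      unfolding P_def using K d(1)
      by (subst lborel_prod.emeasure_PiM) (simp_all only: sets_lborel finite_lessThan prod_constant card_lessThan ennreal_power mult_nonneg_nonneg less_imp_le closed_atLeastAtMost borel_closed zero_le_numeral)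
  qed
  moreover have "hausdorff_gauge dst m E = ennreal (unit_ball_vol (real m) * (d / 2) ^ m)"
    using False d(1) unfolding hausdorff_gauge_def d(2)
    by (simp add: ennreal_mult ennreal_power divide_ennreal flip: ennreal_numeral)
  moreover have "unit_ball_vol (real m) / (4 * K) ^ m * (2 * K * d) ^ m = unit_ball_vol (real m) * (d / 2) ^ m"
  proof -
    have "(2 * K * d) ^ m / (4 * K) ^ m = (d / 2) ^ m"
      unfolding power_divide[symmetric] using K by (intro arg_cong[of _ _ "\<lambda>x. x ^ m"]) (simp add: field_simps)
    then show ?thesis by (metis times_divide_eq_left times_divide_eq_right)
  qed
  ultimately show ?thesis using K d(1)
    by (intro bexI[of _ P] conjI) (simp_all add: ennreal_mult[symmetric])
qed

text \<open>The outer measure is used because coordinate images of arbitrary sets need not be measurable.\<close>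

lemma outer_measure_coord_le_hausdorff_measure:
  fixes dst :: "'x \<Rightarrow> 'x \<Rightarrow> real"
  assumes K: "K > 0" and m: "m > 0" and nn: "\<And>x y. 0 \<le> dst x y"
    and lip: "\<And>i x y. i < m \<Longrightarrow> \<bar>\<beta> i x - \<beta> i y\<bar> \<le> K * dst x y"
  shows "ennreal (unit_ball_vol (real m) / (4 * K) ^ m) * outer_measure_of (lebesgue_coord m) (coord_map m \<beta> ` T)
          \<le> hausdorff_measure dst m T"
proof -
  let ?M = "lebesgue_coord m" and ?\<kappa> = "ennreal (unit_ball_vol (real m) / (4 * K) ^ m)"
  have "?\<kappa> * outer_measure_of ?M (coord_map m \<beta> ` T) \<le> suminf (\<lambda>i. hausdorff_gauge dst m (E i))"
    if E: "T \<subseteq> (\<Union>i. E i)" for E :: "nat \<Rightarrow> 'x set"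
  proof -
    have "\<forall>i. \<exists>P\<in>sets ?M. coord_map m \<beta> ` E i \<subseteq> P \<and> ?\<kappa> * emeasure ?M P \<le> hausdorff_gauge dst m (E i)"
      by (intro allI gauge_bounds_coord_box[OF K m nn lip])
    then obtain P where P: "\<And>i. P i \<in> sets ?M" "\<And>i. coord_map m \<beta> ` E i \<subseteq> P i"
      "\<And>i. ?\<kappa> * emeasure ?M (P i) \<le> hausdorff_gauge dst m (E i)" by metis
    have "coord_map m \<beta> ` T \<subseteq> (\<Union>i. P i)" using E P(2) by blast
    then have "outer_measure_of ?M (coord_map m \<beta> ` T) \<le> outer_measure_of ?M (\<Union>i. P i)"
      by (rule outer_measure_of_mono)
    also have "\<dots> = emeasure ?M (\<Union>i. P i)" using P(1) by (intro outer_measure_of_eq) auto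
    also have "\<dots> \<le> suminf (\<lambda>i. emeasure ?M (P i))" using P(1) by (intro emeasure_subadditive_countably) auto
    finally have "?\<kappa> * outer_measure_of ?M (coord_map m \<beta> ` T) \<le> ?\<kappa> * suminf (\<lambda>i. emeasure ?M (P i))"
      by (rule mult_left_mono) simp
    also have "\<dots> = suminf (\<lambda>i. ?\<kappa> * emeasure ?M (P i))" by simp
    also have "\<dots> \<le> suminf (\<lambda>i. hausdorff_gauge dst m (E i))" by (intro suminf_le P(3)) auto
    finally show ?thesis .
  qed
  then show ?thesis unfolding hausdorff_measure_def
    by (intro SUP_upper2[of 1] INF_greatest) auto
qed

text \<open>The coordinate images of the sets \<open>T f\<close> cover a cube of side \<open>s\<close>, so their outer measures add up to at least
\<open>s ^ m\<close>.\<close>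

theorem hausdorff_sum_ge_of_covers_box:
  fixes dst :: "'x \<Rightarrow> 'x \<Rightarrow> real"
  assumes K: "K > 0" and m: "m > 0" and nn: "\<And>x y. 0 \<le> dst x y"
    and lip: "\<And>i x y. i < m \<Longrightarrow> \<bar>\<beta> i x - \<beta> i y\<bar> \<le> K * dst x y"
    and fin: "finite I" and s: "s \<ge> 0"
    and cov: "\<And>q. (\<And>i. i < m \<Longrightarrow> a i \<le> q i \<and> q i \<le> a i + s) \<Longrightarrow> \<exists>f\<in>I. \<exists>x\<in>T f. \<forall>i<m. \<beta> i x = q i"
  shows "ennreal (unit_ball_vol (real m) * (s / (4 * K)) ^ m) \<le> (\<Sum>f\<in>I. hausdorff_measure dst m (T f))"
proof -
  let ?M = "lebesgue_coord m" and ?\<kappa> = "ennreal (unit_ball_vol (real m) / (4 * K) ^ m)"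
  define Q where "Q = Pi\<^sub>E {..<m} (\<lambda>i. {a i .. a i + s})"
  have "\<exists>E. E \<in> sets ?M \<and> coord_map m \<beta> ` T f \<subseteq> E \<and> outer_measure_of ?M (coord_map m \<beta> ` T f) = emeasure ?M E" for f
  proof -
    have "coord_map m \<beta> ` T f \<subseteq> space ?M"
      unfolding coord_map_def space_PiM by (intro image_subsetI) (simp add: restrict_PiE_iff)
    then show ?thesis using outer_measure_of_attain[of "coord_map m \<beta> ` T f" ?M] by blast
  qed
  then obtain E where E: "\<And>f. E f \<in> sets ?M" "\<And>f. coord_map m \<beta> ` T f \<subseteq> E f"
    "\<And>f. outer_measure_of ?M (coord_map m \<beta> ` T f) = emeasure ?M (E f)" by metis
  have "Q \<subseteq> (\<Union>f\<in>I. E f)"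
  proof
    fix q assume q: "q \<in> Q"
    then obtain f x where fx: "f \<in> I" "x \<in> T f" "\<forall>i<m. \<beta> i x = q i"
      using cov[of q] unfolding Q_def by (auto simp: PiE_iff)
    have "coord_map m \<beta> x = q"
      using q fx(3) unfolding Q_def coord_map_def by (auto simp: PiE_iff extensional_def fun_eq_iff)
    then show "q \<in> (\<Union>f\<in>I. E f)" using fx E(2) by blast
  qed
  then have "emeasure ?M Q \<le> emeasure ?M (\<Union>f\<in>I. E f)"
    using E(1) fin by (intro emeasure_mono) auto
  also have "\<dots> \<le> (\<Sum>f\<in>I. emeasure ?M (E f))"
    using E(1) fin by (intro emeasure_subadditive_finite) auto
  finally have "?\<kappa> * emeasure ?M Q \<le> (\<Sum>f\<in>I. ?\<kappa> * emeasure ?M (E f))"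
    by (simp add: sum_distrib_left[symmetric] mult_left_mono)
  also have "\<dots> \<le> (\<Sum>f\<in>I. hausdorff_measure dst m (T f))"
    using outer_measure_coord_le_hausdorff_measure[OF K m nn lip] by (intro sum_mono) (simp add: E(3)[symmetric])
  finally have "?\<kappa> * emeasure ?M Q \<le> (\<Sum>f\<in>I. hausdorff_measure dst m (T f))" .
  moreover have "emeasure ?M Q = ennreal (s ^ m)"
    unfolding Q_def using s by (subst lborel_prod.emeasure_PiM) (auto simp: ennreal_power[symmetric])
  moreover have "unit_ball_vol (real m) / (4 * K) ^ m * s ^ m = unit_ball_vol (real m) * (s / (4 * K)) ^ m"
    by (simp add: power_divide)
  ultimately show ?thesis using K s by (simp add: ennreal_mult[symmetric])
qed

text \<open>A cover by at most \<open>(2 * N) ^ m\<close> sets of diameter \<open>c / N\<close> has a total gauge that does not depend on \<open>N\<close>, while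
its mesh tends to zero.\<close>

lemma hausdorff_measure_le_of_grid_covers:
  fixes dst :: "'x \<Rightarrow> 'x \<Rightarrow> real" and E :: "nat \<Rightarrow> 'i \<Rightarrow> 'x set"
  assumes c: "c \<ge> 0" and fin: "\<And>N. N > 0 \<Longrightarrow> finite (I N)" and card: "\<And>N. N > 0 \<Longrightarrow> card (I N) \<le> (2 * N) ^ m"
    and cov: "\<And>N. N > 0 \<Longrightarrow> T \<subseteq> (\<Union>i\<in>I N. E N i)"
    and small: "\<And>N i x y. N > 0 \<Longrightarrow> i \<in> I N \<Longrightarrow> x \<in> E N i \<Longrightarrow> y \<in> E N i \<Longrightarrow> dst x y \<le> c / N"
  shows "hausdorff_measure dst m T \<le> ennreal (unit_ball_vol (real m) * c ^ m)"
  unfolding hausdorff_measure_def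
proof (intro SUP_least)
  fix \<delta> :: real assume "\<delta> \<in> {0<..}"
  then have \<delta>: "\<delta> > 0" by simp
  obtain N :: nat where N: "N > 0" "c / N \<le> \<delta>"
  proof -
    obtain n :: nat where "c / \<delta> < real n" using reals_Archimedean2 by blast
    then have "c / real (Suc n) \<le> \<delta>" using \<delta> c by (simp add: field_simps)
    then show thesis using that[of "Suc n"] by simp
  qed
  have diam: "ediam dst (E N i) \<le> ennreal (c / N)" if "i \<in> I N" for i
    unfolding ediam_def using small[OF N(1) that] by (intro SUP_least ennreal_leI) auto
  obtain e where e: "bij_betw e {..<card (I N)} (I N)"
    using ex_bij_betw_nat_finite[OF fin[OF N(1)]] by (auto simp: lessThan_atLeast0)
  define F where "F n = (if n < card (I N) then E N (e n) else {})" for n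
  have eI: "e n \<in> I N" if "n < card (I N)" for n using e that by (auto simp: bij_betw_def)
  have "T \<subseteq> (\<Union>n. F n)"
  proof
    fix x assume "x \<in> T"
    then obtain i where i: "i \<in> I N" "x \<in> E N i" using cov[OF N(1)] by auto
    then obtain n where "n < card (I N)" "e n = i" using e by (metis bij_betw_iff_bijections lessThan_iff)
    then show "x \<in> (\<Union>n. F n)" using i unfolding F_def by auto
  qed
  moreover have "ediam dst (F n) \<le> ennreal \<delta>" for n
  proof (cases "n < card (I N)")
    case True
    then show ?thesis using order_trans[OF diam[OF eI[OF True]] ennreal_leI[OF N(2)]] by (simp add: F_def)
  qed (simp add: F_def ediam_def bot_ennreal)
  ultimately have "(INF E\<in>{E. T \<subseteq> (\<Union>i. E i) \<and> (\<forall>i. ediam dst (E i) \<le> ennreal \<delta>)}. suminf (\<lambda>i. hausdorff_gauge dst m (E i)))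
      \<le> suminf (\<lambda>n. hausdorff_gauge dst m (F n))" by (intro INF_lower) auto
  also have "\<dots> = (\<Sum>n<card (I N). hausdorff_gauge dst m (F n))"
    by (intro suminf_finite) (auto simp: F_def hausdorff_gauge_def)
  also have "\<dots> \<le> (\<Sum>n<card (I N). ennreal (unit_ball_vol (real m) * (c / N / 2) ^ m))"
  proof (intro sum_mono)
    fix n assume "n \<in> {..<card (I N)}"
    then have "ediam dst (F n) \<le> ennreal (c / N)" using diam[OF eI] unfolding F_def by auto
    then have "ediam dst (F n) / 2 \<le> ennreal (c / N) / 2"
      by (rule divide_right_mono_ennreal)
    also have "\<dots> = ennreal (c / N / 2)"
      using c by (simp add: divide_ennreal flip: ennreal_numeral)
    finally have "ediam dst (F n) / 2 \<le> ennreal (c / N / 2)" .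
    then have "ennreal (unit_ball_vol (real m)) * (ediam dst (F n) / 2) ^ m \<le> ennreal (unit_ball_vol (real m)) * ennreal (c / N / 2) ^ m"
      by (intro mult_left_mono power_mono) auto
    then show "hausdorff_gauge dst m (F n) \<le> ennreal (unit_ball_vol (real m) * (c / N / 2) ^ m)"
      using c by (simp add: hausdorff_gauge_def ennreal_mult ennreal_power)
  qed
  also have "\<dots> = ennreal (real (card (I N)) * (unit_ball_vol (real m) * (c / N / 2) ^ m))"
    using c by (simp add: ennreal_mult ennreal_of_nat_eq_real_of_nat)
  also have "\<dots> \<le> ennreal (unit_ball_vol (real m) * c ^ m)"
  proof (rule ennreal_leI)
    have "real (card (I N)) * (unit_ball_vol (real m) * (c / N / 2) ^ m)
        \<le> real ((2 * N) ^ m) * (unit_ball_vol (real m) * (c / N / 2) ^ m)"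
      using c by (intro mult_right_mono iffD2[OF of_nat_le_iff] card[OF N(1)]) simp
    also have "\<dots> = unit_ball_vol (real m) * c ^ m"
    proof -
      have "real ((2 * N) ^ m) * (c / N / 2) ^ m = (2 * real N * (c / N / 2)) ^ m"
        by (simp only: of_nat_power of_nat_mult of_nat_numeral power_mult_distrib)
      also have "2 * real N * (c / N / 2) = c" using N(1) by simp
      finally show ?thesis by (metis mult.left_commute)
    qed
    finally show "real (card (I N)) * (unit_ball_vol (real m) * (c / N / 2) ^ m) \<le> unit_ball_vol (real m) * c ^ m" .
  qed
  finally show "(INF E\<in>{E. T \<subseteq> (\<Union>i. E i) \<and> (\<forall>i. ediam dst (E i) \<le> ennreal \<delta>)}. suminf (\<lambda>i. hausdorff_gauge dst m (E i)))
      \<le> ennreal (unit_ball_vol (real m) * c ^ m)" .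
qed

text \<open>The simplex is cut by the grid of mesh \<open>1 / N\<close> in the coordinates \<open>1, \<dots>, m\<close>. The coordinate \<open>0\<close> is
determined by these and varies by at most \<open>m / N\<close> on a cell, so a cell has diameter at most \<open>2 * m / N\<close>.\<close>

theorem hausdorff_measure_lipschitz_simplex_le:
  fixes dst :: "'x \<Rightarrow> 'x \<Rightarrow> real"
  assumes L: "L \<ge> 0"
    and lip: "\<And>x y. x \<in> standard_simplex m \<Longrightarrow> y \<in> standard_simplex m \<Longrightarrow>
       dst (g x) (g y) \<le> L * sqrt (\<Sum>i\<le>m. (x i - y i)\<^sup>2)"
  shows "hausdorff_measure dst m (g ` standard_simplex m) \<le> ennreal (unit_ball_vol (real m) * (L * (2 * real m)) ^ m)"
proof (rule hausdorff_measure_le_of_grid_covers[where I="\<lambda>N. Pi\<^sub>E {1..m} (\<lambda>_. {..N})"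
      and E="\<lambda>N k. g ` {x \<in> standard_simplex m. \<forall>i\<in>{1..m}. nat \<lfloor>real N * x i\<rfloor> = k i}"])
  show "0 \<le> L * (2 * real m)" using L by simp
next
  fix N :: nat assume N: "N > 0"
  show "finite (Pi\<^sub>E {1..m} (\<lambda>_. {..N}))" by (intro finite_PiE) auto
  have "Suc N ^ m \<le> (2 * N) ^ m" using N by (intro power_mono) auto
  then show "card (Pi\<^sub>E {1..m} (\<lambda>_. {..N})) \<le> (2 * N) ^ m" by (simp add: card_PiE)
  show "g ` standard_simplex m \<subseteq> (\<Union>k\<in>Pi\<^sub>E {1..m} (\<lambda>_. {..N}). g ` {x \<in> standard_simplex m. \<forall>i\<in>{1..m}. nat \<lfloor>real N * x i\<rfloor> = k i})"
  proof clarify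
    fix x assume x: "x \<in> standard_simplex m"
    define k where "k = (\<lambda>i\<in>{1..m}. nat \<lfloor>real N * x i\<rfloor>)"
    have "nat \<lfloor>real N * x i\<rfloor> \<le> N" for i
    proof -
      have "x i \<le> 1" using x by (simp add: standard_simplex_def)
      then have "real N * x i \<le> real N" by (simp add: mult_left_le)
      then have "\<lfloor>real N * x i\<rfloor> \<le> int N" by linarith
      then show ?thesis by simp
    qed
    then have "k \<in> Pi\<^sub>E {1..m} (\<lambda>_. {..N})" unfolding k_def by auto
    moreover have "\<forall>i\<in>{1..m}. nat \<lfloor>real N * x i\<rfloor> = k i" unfolding k_def by auto
    ultimately show "g x \<in> (\<Union>k\<in>Pi\<^sub>E {1..m} (\<lambda>_. {..N}). g ` {x \<in> standard_simplex m. \<forall>i\<in>{1..m}. nat \<lfloor>real N * x i\<rfloor> = k i})"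
      using x by blast
  qed
  fix k p q
  assume "p \<in> g ` {x \<in> standard_simplex m. \<forall>i\<in>{1..m}. nat \<lfloor>real N * x i\<rfloor> = k i}"
    "q \<in> g ` {x \<in> standard_simplex m. \<forall>i\<in>{1..m}. nat \<lfloor>real N * x i\<rfloor> = k i}"
  then obtain x y where xy: "x \<in> standard_simplex m" "y \<in> standard_simplex m" "p = g x" "q = g y"
    and k: "\<And>i. i \<in> {1..m} \<Longrightarrow> nat \<lfloor>real N * x i\<rfloor> = nat \<lfloor>real N * y i\<rfloor>" by auto
  have near: "\<bar>x i - y i\<bar> \<le> 1 / N" if "i \<in> {1..m}" for i
  proof -
    have "0 \<le> x i" "0 \<le> y i" using xy by (auto simp: standard_simplex_def)
    then have "\<lfloor>real N * x i\<rfloor> = \<lfloor>real N * y i\<rfloor>" using k[OF that] by (simp add: eq_nat_nat_iff)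
    then have "\<bar>real N * x i - real N * y i\<bar> \<le> 1" by linarith
    then have "real N * \<bar>x i - y i\<bar> \<le> 1" by (simp add: abs_mult flip: right_diff_distrib)
    then show ?thesis using N by (simp add: field_simps)
  qed
  have split: "(\<Sum>i\<le>m. h i) = h 0 + (\<Sum>i=1..m. h i)" for h :: "nat \<Rightarrow> real"
    by (simp add: atMost_atLeast0 sum.atLeast_Suc_atMost)
  have near': "(\<Sum>i=1..m. \<bar>x i - y i\<bar>) \<le> real m / N"
    using sum_mono[of "{1..m}" "\<lambda>i. \<bar>x i - y i\<bar>" "\<lambda>_. 1 / real N"] near by simp
  have "x 0 - y 0 = - (\<Sum>i=1..m. x i - y i)"
    using xy split[of x] split[of y] by (simp add: standard_simplex_def sum_subtractf)
  then have "\<bar>x 0 - y 0\<bar> \<le> (\<Sum>i=1..m. \<bar>x i - y i\<bar>)" by (metis abs_minus_cancel sum_abs)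
  then have "(\<Sum>i\<le>m. \<bar>x i - y i\<bar>) \<le> 2 * real m / N" using near' split[of "\<lambda>i. \<bar>x i - y i\<bar>"] by simp
  moreover have "sqrt (\<Sum>i\<le>m. (x i - y i)\<^sup>2) \<le> (\<Sum>i\<le>m. \<bar>x i - y i\<bar>)"
    using L2_set_le_sum_abs[of "\<lambda>i. x i - y i" "{..m}"] by (simp add: L2_set_def)
  ultimately have "L * sqrt (\<Sum>i\<le>m. (x i - y i)\<^sup>2) \<le> L * (2 * real m / N)" using L by (intro mult_left_mono) auto
  then show "dst p q \<le> L * (2 * real m) / real N" using lip[OF xy(1,2)] xy by (simp add: algebra_simps)
qed

section \<open>Continuously differentiable functions\<close>

text \<open>The recursive equation would make the simplifier replace differentiability statements by existential
quantifiers over derivatives; introduction and elimination rules take its place.\<close>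

declare C_k_on.simps(2) [simp del]

lemma C_k_on_SucI:
  "(\<And>x. x \<in> S \<Longrightarrow> (f has_derivative f' x) (at x)) \<Longrightarrow> (\<And>v. C_k_on k S (\<lambda>x. f' x v)) \<Longrightarrow> C_k_on (Suc k) S f"
  by (auto simp: C_k_on.simps(2))

lemma C_k_on_SucE:
  assumes "C_k_on (Suc k) S f"
  obtains f' where "\<And>x. x \<in> S \<Longrightarrow> (f has_derivative f' x) (at x)" "\<And>v. C_k_on k S (\<lambda>x. f' x v)"
  using assms by (auto simp: C_k_on.simps(2))

lemma C_k_on_cong:
  assumes "open S" "\<And>x. x \<in> S \<Longrightarrow> f x = g x"
  shows "C_k_on k S f \<longleftrightarrow> C_k_on k S g"
proof -
  have "C_k_on k S f \<Longrightarrow> C_k_on k S g" if "open S" "\<And>x. x \<in> S \<Longrightarrow> f x = g x" for f g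
  proof (cases k)
    case 0 then show "C_k_on k S f \<Longrightarrow> C_k_on k S g" using that(2) by (simp cong: continuous_on_cong)
  next
    case (Suc n)
    assume "C_k_on k S f"
    then obtain f' where f': "\<And>x. x \<in> S \<Longrightarrow> (f has_derivative f' x) (at x)" "\<And>v. C_k_on n S (\<lambda>x. f' x v)"
      using Suc C_k_on_SucE by metis
    have "(g has_derivative f' x) (at x)" if "x \<in> S" for x
      using has_derivative_transform_within_open[OF f'(1)[OF that] \<open>open S\<close> that] \<open>\<And>x. x \<in> S \<Longrightarrow> f x = g x\<close> by simp
    then show "C_k_on k S g" unfolding Suc using f'(2) by (rule C_k_on_SucI)
  qed
  from this[of f g] this[of g f] show ?thesis using assms by auto
qed

lemma C_k_on_subset: "C_k_on k S f \<Longrightarrow> T \<subseteq> S \<Longrightarrow> C_k_on k T f"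
proof (induction k arbitrary: f)
  case 0 then show ?case by (simp add: continuous_on_subset)
next
  case (Suc k)
  show ?case by (rule C_k_on_SucE[OF Suc.prems(1)], rule C_k_on_SucI) (use Suc in auto)
qed

lemma C_k_on_Suc_imp: "C_k_on (Suc k) S f \<Longrightarrow> C_k_on k S f"
proof (induction k arbitrary: f)
  case 0
  then obtain f' where "\<And>x. x \<in> S \<Longrightarrow> (f has_derivative f' x) (at x)" by (metis C_k_on_SucE)
  then show ?case
    by (metis C_k_on.simps(1) continuous_at_imp_continuous_on has_derivative_continuous)
next
  case (Suc k)
  show ?case by (rule C_k_on_SucE[OF Suc.prems], rule C_k_on_SucI) (use Suc.IH in auto)
qed

lemma C_k_on_imp_continuous_on: "C_k_on k S f \<Longrightarrow> continuous_on S f"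
proof (induction k)
  case (Suc k) then show ?case using C_k_on_Suc_imp by blast
qed simp

lemma C_k_on_const [simp]: "C_k_on k S (\<lambda>x. c)"
  by (induction k arbitrary: c) (auto intro!: C_k_on_SucI[where f'="\<lambda>x v. 0"])

lemma C_k_on_linear: "bounded_linear h \<Longrightarrow> C_k_on k S h"
proof (cases k)
  case 0 assume "bounded_linear h" then show ?thesis using 0 by (simp add: linear_continuous_on)
next
  case (Suc n) assume "bounded_linear h" then show ?thesis using Suc
    by (auto intro!: C_k_on_SucI[where f'="\<lambda>x. h"] bounded_linear_imp_has_derivative)
qed

lemma C_k_on_linear_comp: "bounded_linear h \<Longrightarrow> C_k_on k S f \<Longrightarrow> C_k_on k S (\<lambda>x. h (f x))"
proof (induction k arbitrary: f)
  case 0 then show ?case by (simp add: bounded_linear.continuous_on)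
next
  case (Suc k)
  obtain f' where f': "\<And>x. x \<in> S \<Longrightarrow> (f has_derivative f' x) (at x)" "\<And>v. C_k_on k S (\<lambda>x. f' x v)"
    using C_k_on_SucE[OF Suc.prems(2)] by blast
  have "((\<lambda>x. h (f x)) has_derivative (\<lambda>v. h (f' x v))) (at x)" if "x \<in> S" for x
    by (rule bounded_linear.has_derivative[OF Suc.prems(1) f'(1)[OF that]])
  then show ?case using Suc.IH[OF Suc.prems(1) f'(2)] by (rule C_k_on_SucI)
qed

lemma C_k_on_Pair: "C_k_on k S f \<Longrightarrow> C_k_on k S g \<Longrightarrow> C_k_on k S (\<lambda>x. (f x, g x))"
proof (induction k arbitrary: f g)
  case 0 then show ?case by (simp add: continuous_on_Pair)
next
  case (Suc k)
  obtain f' where f': "\<And>x. x \<in> S \<Longrightarrow> (f has_derivative f' x) (at x)" "\<And>v. C_k_on k S (\<lambda>x. f' x v)"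
    using C_k_on_SucE[OF Suc.prems(1)] by blast
  obtain g' where g': "\<And>x. x \<in> S \<Longrightarrow> (g has_derivative g' x) (at x)" "\<And>v. C_k_on k S (\<lambda>x. g' x v)"
    using C_k_on_SucE[OF Suc.prems(2)] by blast
  show ?case using f' g' Suc.IH[OF f'(2) g'(2)]
    by (intro C_k_on_SucI[where f'="\<lambda>x v. (f' x v, g' x v)"] has_derivative_Pair)
qed

lemma C_k_on_add: "C_k_on k S f \<Longrightarrow> C_k_on k S g \<Longrightarrow> C_k_on k S (\<lambda>x. f x + g x)"
  using C_k_on_linear_comp[OF bounded_linear_add[OF bounded_linear_fst bounded_linear_snd] C_k_on_Pair]
  by force

lemma C_k_on_sum: "(\<And>i. i \<in> I \<Longrightarrow> C_k_on k S (f i)) \<Longrightarrow> C_k_on k S (\<lambda>x. \<Sum>i\<in>I. f i x)"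
  by (induction I rule: infinite_finite_induct) (auto intro: C_k_on_add)

lemma C_k_on_bilinear:
  assumes h: "bounded_bilinear h"
  shows "C_k_on k S f \<Longrightarrow> C_k_on k S g \<Longrightarrow> C_k_on k S (\<lambda>x. h (f x) (g x))"
proof (induction k arbitrary: f g)
  case 0 then show ?case using h by (simp add: bounded_bilinear.continuous_on)
next
  case (Suc k)
  obtain f' where f': "\<And>x. x \<in> S \<Longrightarrow> (f has_derivative f' x) (at x)" "\<And>v. C_k_on k S (\<lambda>x. f' x v)"
    using C_k_on_SucE[OF Suc.prems(1)] by blast
  obtain g' where g': "\<And>x. x \<in> S \<Longrightarrow> (g has_derivative g' x) (at x)" "\<And>v. C_k_on k S (\<lambda>x. g' x v)"
    using C_k_on_SucE[OF Suc.prems(2)] by blast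
  have "C_k_on k S f" "C_k_on k S g" using Suc.prems C_k_on_Suc_imp by blast+
  then have "C_k_on k S (\<lambda>x. h (f x) (g' x v) + h (f' x v) (g x))" for v
    using Suc.IH f' g' by (intro C_k_on_add) auto
  then show ?case using f' g'
    by (intro C_k_on_SucI[where f'="\<lambda>x v. h (f x) (g' x v) + h (f' x v) (g x)"] bounded_bilinear.FDERIV[OF h])
qed

lemma linear_eq_sum_Basis:
  fixes L :: "'a::euclidean_space \<Rightarrow> 'b::real_vector"
  assumes "linear L"
  shows "L w = (\<Sum>b\<in>Basis. (w \<bullet> b) *\<^sub>R L b)"
proof -
  have "(\<Sum>b\<in>Basis. (w \<bullet> b) *\<^sub>R L b) = L (\<Sum>b\<in>Basis. (w \<bullet> b) *\<^sub>R b)"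
    by (simp add: linear_sum[OF assms] linear_scale[OF assms])
  then show ?thesis by (simp add: euclidean_representation)
qed

text \<open>The derivative of the composition, expanded in a basis of the middle space, is a sum of products of functions that
are \<open>C\<^sup>k\<close> by induction.\<close>

lemma C_k_on_compose:
  fixes f :: "'a::real_normed_vector \<Rightarrow> 'b::euclidean_space" and g :: "'b \<Rightarrow> 'c::real_normed_vector"
  shows "C_k_on k S f \<Longrightarrow> C_k_on k T g \<Longrightarrow> f ` S \<subseteq> T \<Longrightarrow> C_k_on k S (\<lambda>x. g (f x))"
proof (induction k arbitrary: f g)
  case 0 then show ?case by (auto intro: continuous_on_compose2)
next
  case (Suc k)
  obtain f' where f': "\<And>x. x \<in> S \<Longrightarrow> (f has_derivative f' x) (at x)" "\<And>v. C_k_on k S (\<lambda>x. f' x v)"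
    using C_k_on_SucE[OF Suc.prems(1)] by blast
  obtain g' where g': "\<And>x. x \<in> T \<Longrightarrow> (g has_derivative g' x) (at x)" "\<And>v. C_k_on k T (\<lambda>x. g' x v)"
    using C_k_on_SucE[OF Suc.prems(2)] by blast
  have fS: "f x \<in> T" if "x \<in> S" for x using Suc.prems that by auto
  have "((\<lambda>x. g (f x)) has_derivative (\<lambda>v. \<Sum>b\<in>Basis. (f' x v \<bullet> b) *\<^sub>R g' (f x) b)) (at x)" if "x \<in> S" for x
  proof -
    have "((\<lambda>x. g (f x)) has_derivative (\<lambda>v. g' (f x) (f' x v))) (at x)"
      using has_derivative_compose[OF f'(1)[OF that], of g "g' (f x)"] g'(1)[OF fS[OF that]] by simp
    moreover have "linear (g' (f x))" using g'(1)[OF fS[OF that]] has_derivative_linear by blast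
    then have "(\<lambda>v. g' (f x) (f' x v)) = (\<lambda>v. \<Sum>b\<in>Basis. (f' x v \<bullet> b) *\<^sub>R g' (f x) b)"
      by (intro ext linear_eq_sum_Basis)
    ultimately show ?thesis by (simp only:)
  qed
  moreover have "C_k_on k S (\<lambda>x. \<Sum>b\<in>Basis. (f' x v \<bullet> b) *\<^sub>R g' (f x) b)" for v
    using Suc.IH[OF C_k_on_Suc_imp[OF Suc.prems(1)] g'(2) Suc.prems(3)]
    by (intro C_k_on_sum C_k_on_bilinear[OF bounded_bilinear_scaleR] C_k_on_linear_comp[OF bounded_linear_inner_left] f'(2)) auto
  ultimately show ?case by (auto intro!: C_k_on_SucI[where f'="\<lambda>x v. \<Sum>b\<in>Basis. (f' x v \<bullet> b) *\<^sub>R g' (f x) b"])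
qed

text \<open>On an open set derivatives are unique, so the unspecified derivative in the definition of \<open>C_k_on\<close> can be taken to
be \<open>frechet_derivative\<close>.\<close>

lemma C_k_on_derivative:
  assumes "C_k_on (Suc k) S f" "open S"
  shows "\<And>x. x \<in> S \<Longrightarrow> (f has_derivative frechet_derivative f (at x)) (at x)"
    "\<And>v. C_k_on k S (\<lambda>x. frechet_derivative f (at x) v)"
proof -
  obtain f' where f': "\<And>x. x \<in> S \<Longrightarrow> (f has_derivative f' x) (at x)" "\<And>v. C_k_on k S (\<lambda>x. f' x v)"
    using assms(1) by (metis C_k_on_SucE)
  have eq: "f' x = frechet_derivative f (at x)" if "x \<in> S" for x using f'(1)[OF that] frechet_derivative_at by blast
  show "(f has_derivative frechet_derivative f (at x)) (at x)" if "x \<in> S" for x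
    using f'(1)[OF that] eq[OF that] by simp
  show "C_k_on k S (\<lambda>x. frechet_derivative f (at x) v)" for v
    using f'(2)[of v] C_k_on_cong[OF assms(2), of "\<lambda>x. f' x v" "\<lambda>x. frechet_derivative f (at x) v"] eq by simp
qed

lemma C_k_on_derivative_dir:
  fixes f :: "'a::euclidean_space \<Rightarrow> 'b::real_normed_vector"
  assumes f: "C_k_on (Suc k) S f" "open S" and u: "C_k_on k T u" "u ` T \<subseteq> S" and v: "C_k_on k T v"
    and T: "open T"
  shows "C_k_on k T (\<lambda>x. frechet_derivative f (at (u x)) (v x))"
proof -
  let ?g = "\<lambda>x. \<Sum>b\<in>Basis. (v x \<bullet> b) *\<^sub>R frechet_derivative f (at (u x)) b"
  have "C_k_on k T ?g"
    by (intro C_k_on_sum C_k_on_bilinear[OF bounded_bilinear_scaleR] C_k_on_linear_comp[OF bounded_linear_inner_left] v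
        C_k_on_compose[OF u(1) C_k_on_derivative(2)[OF f] u(2)])
  moreover have eq: "?g x = frechet_derivative f (at (u x)) (v x)" if "x \<in> T" for x
  proof -
    have "linear (frechet_derivative f (at (u x)))"
      using C_k_on_derivative(1)[OF f] u(2) that has_derivative_linear by blast
    then show ?thesis by (rule linear_eq_sum_Basis[symmetric])
  qed
  ultimately show ?thesis using iffD1[OF C_k_on_cong[OF T eq]] by fast
qed

lemma has_vector_derivative_along_line:
  assumes "(f has_derivative f') (at (x + s *\<^sub>R v))"
  shows "((\<lambda>s. f (x + s *\<^sub>R v)) has_vector_derivative f' v) (at s)"
proof -
  have "((\<lambda>s. x + s *\<^sub>R v) has_derivative (\<lambda>h. h *\<^sub>R v)) (at s)"
    by (auto intro!: derivative_eq_intros)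
  then have "((\<lambda>s. f (x + s *\<^sub>R v)) has_derivative (\<lambda>h. f' (h *\<^sub>R v))) (at s)"
    using has_derivative_compose[of _ _ s UNIV f f'] assms by simp
  moreover have "f' (h *\<^sub>R v) = h *\<^sub>R f' v" for h
    using assms has_derivative_linear linear_scale by blast
  ultimately show ?thesis by (simp add: has_vector_derivative_def)
qed

lemma has_vector_derivative_affine:
  fixes f :: "real \<Rightarrow> 'a::real_normed_vector"
  assumes "(f has_vector_derivative D) (at (a * t + b))"
  shows "((\<lambda>s. f (a * s + b)) has_vector_derivative a *\<^sub>R D) (at t)"
proof -
  have "((\<lambda>s. a * s + b) has_real_derivative a) (at t)" by (auto intro!: derivative_eq_intros)
  then have "((\<lambda>s. a * s + b) has_vector_derivative a) (at t)"
    by (simp add: has_real_derivative_iff_has_vector_derivative)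
  from vector_diff_chain_at[OF this assms] show ?thesis by (simp add: comp_def)
qed

lemma has_vector_derivative_shift:
  fixes f :: "real \<Rightarrow> 'a::real_normed_vector"
  assumes "(f has_vector_derivative D) (at (t + b))"
  shows "((\<lambda>s. f (s + b)) has_vector_derivative D) (at t)"
  using has_vector_derivative_affine[of f D 1 t b] assms by simp

text \<open>Two applications of the mean value theorem, first in the direction \<open>v\<close> and then in the direction \<open>w\<close>, turn a
second difference over a parallelogram into a second derivative at an intermediate point.\<close>

lemma mixed_difference_mean_value:
  fixes g :: "'a::real_normed_vector \<Rightarrow> real"
  assumes h: "h > 0"
    and g: "\<And>s t. 0 \<le> s \<Longrightarrow> s \<le> h \<Longrightarrow> 0 \<le> t \<Longrightarrow> t \<le> h \<Longrightarrow>
        (g has_derivative G (x + s *\<^sub>R v + t *\<^sub>R w)) (at (x + s *\<^sub>R v + t *\<^sub>R w))"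
    and G: "\<And>s t. 0 \<le> s \<Longrightarrow> s \<le> h \<Longrightarrow> 0 \<le> t \<Longrightarrow> t \<le> h \<Longrightarrow>
        ((\<lambda>y. G y v) has_derivative H (x + s *\<^sub>R v + t *\<^sub>R w)) (at (x + s *\<^sub>R v + t *\<^sub>R w))"
  obtains s t where "0 < s" "s < h" "0 < t" "t < h"
    "g (x + h *\<^sub>R v + h *\<^sub>R w) - g (x + h *\<^sub>R v) - g (x + h *\<^sub>R w) + g x = h * (h * H (x + s *\<^sub>R v + t *\<^sub>R w) w)"
proof -
  let ?\<phi> = "\<lambda>s. g ((x + h *\<^sub>R w) + s *\<^sub>R v) - g (x + s *\<^sub>R v)"
  have comm: "x + t *\<^sub>R w + s *\<^sub>R v = x + s *\<^sub>R v + t *\<^sub>R w" for s t by simp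
  have "DERIV ?\<phi> s :> G (x + h *\<^sub>R w + s *\<^sub>R v) v - G (x + s *\<^sub>R v) v" if "0 \<le> s" "s \<le> h" for s
  proof -
    have "(g has_derivative G (x + h *\<^sub>R w + s *\<^sub>R v)) (at (x + h *\<^sub>R w + s *\<^sub>R v))"
      unfolding comm using g[of s h] that h by simp
    moreover have "(g has_derivative G (x + s *\<^sub>R v)) (at (x + s *\<^sub>R v))"
      using g[of s 0] that h by simp
    ultimately show ?thesis
      unfolding has_real_derivative_iff_has_vector_derivative
      by (intro has_vector_derivative_diff has_vector_derivative_along_line)
  qed
  from MVT2[OF h this] obtain s where s: "0 < s" "s < h"
    "?\<phi> h - ?\<phi> 0 = (h - 0) * (G (x + h *\<^sub>R w + s *\<^sub>R v) v - G (x + s *\<^sub>R v) v)" by blast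
  let ?\<psi> = "\<lambda>t. G ((x + s *\<^sub>R v) + t *\<^sub>R w) v"
  have "DERIV ?\<psi> t :> H (x + s *\<^sub>R v + t *\<^sub>R w) w" if "0 \<le> t" "t \<le> h" for t
    unfolding has_real_derivative_iff_has_vector_derivative
    by (rule has_vector_derivative_along_line) (use G[of s t] that s in simp)
  from MVT2[OF h this] obtain t where t: "0 < t" "t < h" "?\<psi> h - ?\<psi> 0 = (h - 0) * H (x + s *\<^sub>R v + t *\<^sub>R w) w" by blast
  have "G (x + h *\<^sub>R w + s *\<^sub>R v) v - G (x + s *\<^sub>R v) v = h * H (x + s *\<^sub>R v + t *\<^sub>R w) w"
    unfolding comm using t(3) by simp
  then have "?\<phi> h - ?\<phi> 0 = h * (h * H (x + s *\<^sub>R v + t *\<^sub>R w) w)" using s(3) by simp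
  moreover have "?\<phi> h - ?\<phi> 0 = g (x + h *\<^sub>R v + h *\<^sub>R w) - g (x + h *\<^sub>R v) - g (x + h *\<^sub>R w) + g x"
    by (simp add: algebra_simps)
  ultimately show thesis using that[OF s(1,2) t(1,2)] by simp
qed

text \<open>The second difference over a parallelogram does not depend on the order of its two sides. Evaluating it by
\<open>mixed_difference_mean_value\<close> in both orders and letting the parallelogram shrink gives Schwarz's theorem.\<close>

lemma second_derivative_symmetric_real:
  fixes g :: "'a::real_normed_vector \<Rightarrow> real"
  assumes S: "open S" "x \<in> S"
    and g: "\<And>y. y \<in> S \<Longrightarrow> (g has_derivative G y) (at y)"
    and A: "\<And>y. y \<in> S \<Longrightarrow> ((\<lambda>y. G y v) has_derivative A y) (at y)"
    and B: "\<And>y. y \<in> S \<Longrightarrow> ((\<lambda>y. G y w) has_derivative B y) (at y)"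
    and contA: "continuous_on S (\<lambda>y. A y w)" and contB: "continuous_on S (\<lambda>y. B y v)"
  shows "A x w = B x v"
proof (rule ccontr)
  assume ne: "A x w \<noteq> B x v"
  define e where "e = \<bar>A x w - B x v\<bar> / 2"
  have e: "e > 0" using ne by (simp add: e_def)
  obtain r0 where r0: "r0 > 0" "ball x r0 \<subseteq> S" using S open_contains_ball by blast
  have "isCont (\<lambda>y. A y w) x" "isCont (\<lambda>y. B y v) x"
    using contA contB S by (auto simp: continuous_on_eq_continuous_at)
  then obtain r1 r2 where r1: "r1 > 0" "\<And>y. dist y x < r1 \<Longrightarrow> dist (A y w) (A x w) < e"
    and r2: "r2 > 0" "\<And>y. dist y x < r2 \<Longrightarrow> dist (B y v) (B x v) < e"
    using e unfolding continuous_at_eps_delta by (metis dist_norm)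
  define r where "r = min r0 (min r1 r2)"
  have r: "r > 0" using r0 r1 r2 by (simp add: r_def)
  (* The size h keeps the parallelogram with sides h v and h w inside the ball of radius r. *)
  define h where "h = r / (2 * (norm v + norm w + 1))"
  have h: "h > 0" using r by (simp add: h_def add_nonneg_pos)
  have near: "dist (x + s *\<^sub>R v + t *\<^sub>R w) x < r" if "0 \<le> s" "s \<le> h" "0 \<le> t" "t \<le> h" for s t
  proof -
    have "dist (x + s *\<^sub>R v + t *\<^sub>R w) x = norm (s *\<^sub>R v + t *\<^sub>R w)" by (simp add: dist_norm algebra_simps)
    also have "\<dots> \<le> s * norm v + t * norm w" using norm_triangle_ineq[of "s *\<^sub>R v" "t *\<^sub>R w"] that by simp
    also have "\<dots> \<le> h * norm v + h * norm w" using that by (intro add_mono mult_right_mono) auto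
    also have "\<dots> < h * (2 * (norm v + norm w + 1))" using h by (simp add: algebra_simps add_nonneg_pos mult_nonneg_nonneg add_strict_increasing2)
    also have "\<dots> = r" unfolding h_def using add_nonneg_pos[of "norm v + norm w" 1] by simp
    finally show ?thesis .
  qed
  then have inS: "x + s *\<^sub>R v + t *\<^sub>R w \<in> S" if "0 \<le> s" "s \<le> h" "0 \<le> t" "t \<le> h" for s t
    using near[OF that] r0 by (auto simp: r_def dist_commute)
  have comm: "x + t *\<^sub>R w + s *\<^sub>R v = x + s *\<^sub>R v + t *\<^sub>R w" for s t by (simp add: algebra_simps)
  have B': "((\<lambda>y. G y w) has_derivative B (x + t *\<^sub>R w + s *\<^sub>R v)) (at (x + t *\<^sub>R w + s *\<^sub>R v))"
    and g': "(g has_derivative G (x + t *\<^sub>R w + s *\<^sub>R v)) (at (x + t *\<^sub>R w + s *\<^sub>R v))"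
    if "0 \<le> t" "t \<le> h" "0 \<le> s" "s \<le> h" for s t
    unfolding comm using g B inS that by simp_all
  obtain s t where st: "0 < s" "s < h" "0 < t" "t < h"
    "g (x + h *\<^sub>R v + h *\<^sub>R w) - g (x + h *\<^sub>R v) - g (x + h *\<^sub>R w) + g x = h * (h * A (x + s *\<^sub>R v + t *\<^sub>R w) w)"
    using mixed_difference_mean_value[OF h g[OF inS] A[OF inS]] by blast
  obtain t' s' where st': "0 < t'" "t' < h" "0 < s'" "s' < h"
    "g (x + h *\<^sub>R w + h *\<^sub>R v) - g (x + h *\<^sub>R w) - g (x + h *\<^sub>R v) + g x = h * (h * B (x + t' *\<^sub>R w + s' *\<^sub>R v) v)"
    using mixed_difference_mean_value[OF h g' B'] by blast
  have "h * (h * A (x + s *\<^sub>R v + t *\<^sub>R w) w) = h * (h * B (x + s' *\<^sub>R v + t' *\<^sub>R w) v)"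
    using st(5) st'(5) unfolding comm by linarith
  then have "A (x + s *\<^sub>R v + t *\<^sub>R w) w = B (x + s' *\<^sub>R v + t' *\<^sub>R w) v"
    using h by simp
  moreover have "dist (A (x + s *\<^sub>R v + t *\<^sub>R w) w) (A x w) < e"
    using r1(2) near[of s t] st by (simp add: r_def)
  moreover have "dist (B (x + s' *\<^sub>R v + t' *\<^sub>R w) v) (B x v) < e"
    using r2(2) near[of s' t'] st' by (simp add: r_def)
  ultimately show False unfolding e_def dist_real_def by (simp add: abs_if split: if_splits)
qed

lemma second_derivative_symmetric:
  fixes f :: "'a::real_normed_vector \<Rightarrow> 'b::euclidean_space"
  assumes f: "C_k_on 2 S f" and S: "open S" "x \<in> S"
  shows "frechet_derivative (\<lambda>y. frechet_derivative f (at y) v) (at x) w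
       = frechet_derivative (\<lambda>y. frechet_derivative f (at y) w) (at x) v"
proof (rule euclidean_eqI)
  fix b :: 'b assume "b \<in> Basis"
  let ?D = "\<lambda>v y. frechet_derivative f (at y) v"
  have f2: "C_k_on (Suc (Suc 0)) S f" using f by (simp add: numeral_2_eq_2)
  note d1 = C_k_on_derivative[OF f2 S(1)]
  note d2 = C_k_on_derivative[OF d1(2) S(1)]
  show "frechet_derivative (?D v) (at x) w \<bullet> b = frechet_derivative (?D w) (at x) v \<bullet> b"
  proof (rule second_derivative_symmetric_real[OF S, of "\<lambda>y. f y \<bullet> b" "\<lambda>y u. ?D u y \<bullet> b"
        v "\<lambda>y u. frechet_derivative (?D v) (at y) u \<bullet> b" w "\<lambda>y u. frechet_derivative (?D w) (at y) u \<bullet> b"])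
    show "continuous_on S (\<lambda>y. frechet_derivative (?D v) (at y) w \<bullet> b)"
      "continuous_on S (\<lambda>y. frechet_derivative (?D w) (at y) v \<bullet> b)"
      using d2(2) by (auto intro!: continuous_intros)
  qed (use d1(1) d2(1) in \<open>auto intro!: has_derivative_inner_left\<close>)
qed

lemma C_k_on_local:
  assumes "open S" and loc: "\<And>x. x \<in> S \<Longrightarrow> \<exists>N. open N \<and> x \<in> N \<and> C_k_on k N f"
  shows "C_k_on k S f"
  using loc
proof (induction k arbitrary: f)
  case 0
  show ?case unfolding C_k_on.simps(1)
  proof (intro continuous_at_imp_continuous_on ballI)
    fix x assume "x \<in> S"
    then obtain N where "open N" "x \<in> N" "continuous_on N f" using 0 by auto
    then show "isCont f x" by (simp add: continuous_on_eq_continuous_at)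
  qed
next
  case (Suc k)
  show ?case
  proof (rule C_k_on_SucI[where f'="\<lambda>x. frechet_derivative f (at x)"])
    fix x assume "x \<in> S"
    then obtain N where "open N" "x \<in> N" "C_k_on (Suc k) N f" using Suc.prems by blast
    then show "(f has_derivative frechet_derivative f (at x)) (at x)" using C_k_on_derivative(1) by blast
  next
    fix v show "C_k_on k S (\<lambda>x. frechet_derivative f (at x) v)"
    proof (rule Suc.IH)
      fix x assume "x \<in> S"
      then obtain N where "open N" "x \<in> N" "C_k_on (Suc k) N f" using Suc.prems by blast
      then show "\<exists>N. open N \<and> x \<in> N \<and> C_k_on k N (\<lambda>x. frechet_derivative f (at x) v)"
        using C_k_on_derivative(2) by blast
    qed
  qed
qed

text \<open>The product rule for a linear map and a vector that both depend on the point. The family \<open>L\<close> is only assumed to be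
differentiable on each fixed vector, so both sides are expanded in a basis.\<close>

lemma has_derivative_linear_family:
  fixes L :: "'a::real_normed_vector \<Rightarrow> 'b::euclidean_space \<Rightarrow> 'c::real_normed_vector"
  assumes S: "open S" "x \<in> S" and lin: "\<And>y. y \<in> S \<Longrightarrow> linear (L y)"
    and L': "\<And>k. ((\<lambda>y. L y k) has_derivative L' k) (at x)" and V: "(V has_derivative V') (at x)"
  shows "((\<lambda>y. L y (V y)) has_derivative (\<lambda>h. L' (V x) h + L x (V' h))) (at x)"
proof -
  have expand: "L y w = (\<Sum>b\<in>Basis. (w \<bullet> b) *\<^sub>R L y b)" if "y \<in> S" for y w
    by (rule linear_eq_sum_Basis[OF lin[OF that]])
  have D: "((\<lambda>y. L y (w y)) has_derivative (\<lambda>h. \<Sum>b\<in>Basis. (w x \<bullet> b) *\<^sub>R L' b h + (w' h \<bullet> b) *\<^sub>R L x b)) (at x)"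
    if w: "(w has_derivative w') (at x)" for w w'
  proof (rule has_derivative_transform_within_open[OF _ S])
    show "((\<lambda>y. \<Sum>b\<in>Basis. (w y \<bullet> b) *\<^sub>R L y b) has_derivative
        (\<lambda>h. \<Sum>b\<in>Basis. (w x \<bullet> b) *\<^sub>R L' b h + (w' h \<bullet> b) *\<^sub>R L x b)) (at x)"
      by (intro has_derivative_sum has_derivative_scaleR has_derivative_inner_left L' w)
  qed (rule expand[symmetric])
  have "(\<lambda>h. \<Sum>b\<in>Basis. (V x \<bullet> b) *\<^sub>R L' b h + (0 \<bullet> b) *\<^sub>R L x b) = L' (V x)"
    by (rule has_derivative_unique[OF D[of "\<lambda>_. V x"] L']) (rule has_derivative_const)
  then have "(\<Sum>b\<in>Basis. (V x \<bullet> b) *\<^sub>R L' b h) = L' (V x) h" for h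
    by (simp add: fun_eq_iff)
  moreover have "(\<Sum>b\<in>Basis. (V' h \<bullet> b) *\<^sub>R L x b) = L x (V' h)" for h
    by (rule expand[OF S(2), symmetric])
  ultimately show ?thesis using D[OF V] by (simp only: sum.distrib)
qed

lemma frechet_derivative_directional:
  fixes f :: "'a::euclidean_space \<Rightarrow> 'b::real_normed_vector"
  assumes f: "C_k_on (Suc (Suc 0)) S f" and S: "open S" "x \<in> S" and V: "(V has_derivative V') (at x)"
  shows "((\<lambda>y. frechet_derivative f (at y) (V y)) has_derivative
     (\<lambda>h. frechet_derivative (\<lambda>y. frechet_derivative f (at y) (V x)) (at x) h + frechet_derivative f (at x) (V' h))) (at x)"
proof (rule has_derivative_linear_family[OF S _ _ V])
  note d1 = C_k_on_derivative[OF f S(1)]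
  show "linear (frechet_derivative f (at y))" if "y \<in> S" for y using d1(1)[OF that] has_derivative_linear by blast
  show "((\<lambda>y. frechet_derivative f (at y) b) has_derivative frechet_derivative (\<lambda>y. frechet_derivative f (at y) b) (at x)) (at x)" for b
    by (rule C_k_on_derivative(1)[OF d1(2) S])
qed

section \<open>Maps into a Lie group\<close>

text \<open>All local computations are made in one fixed chart \<open>c\<close> around the identity.\<close>

locale lie_chart =
  fixes G :: "'g::{t2_space,second_countable_topology} monoid" (structure)
    and A :: "('g, 'e::euclidean_space) chart set" and c :: "('g, 'e) chart"
  assumes lie: "lie_group G A" and c_in: "c \<in> A" and one_in: "\<one> \<in> fst c"
begin

sublocale group G using lie by (simp add: lie_group_def)

lemma carrier_UNIV [simp]: "carrier G = UNIV" using lie by (simp add: lie_group_def)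

lemma in_carrier [simp]: "x \<in> carrier G" by simp

lemma atlas: "smooth_atlas A" using lie by (simp add: lie_group_def)

lemma chart_facts:
  assumes "c' \<in> A"
  shows "open (fst c')" "open (snd c' ` fst c')"
    "continuous_on (fst c') (snd c')" "continuous_on (snd c' ` fst c') (chart_param c')"
    "x \<in> fst c' \<Longrightarrow> chart_param c' (snd c' x) = x"
    "y \<in> snd c' ` fst c' \<Longrightarrow> snd c' (chart_param c' y) = y"
    "y \<in> snd c' ` fst c' \<Longrightarrow> chart_param c' y \<in> fst c'"
proof -
  have h: "open (fst c')" "open (snd c' ` fst c')" "homeomorphism (fst c') (snd c' ` fst c') (snd c') (chart_param c')"
    using atlas assms by (auto simp: smooth_atlas_def)
  then show "open (fst c')" "open (snd c' ` fst c')"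
    "continuous_on (fst c') (snd c')" "continuous_on (snd c' ` fst c') (chart_param c')"
    "x \<in> fst c' \<Longrightarrow> chart_param c' (snd c' x) = x"
    "y \<in> snd c' ` fst c' \<Longrightarrow> snd c' (chart_param c' y) = y"
    by (auto simp: homeomorphism_def)
  show "y \<in> snd c' ` fst c' \<Longrightarrow> chart_param c' y \<in> fst c'"
    using h(3) by (auto simp: homeomorphism_def)
qed

lemma chart_at: "\<exists>c'\<in>A. x \<in> fst c'"
  using atlas unfolding smooth_atlas_def by blast

lemma continuous_mult: "continuous_on T f \<Longrightarrow> continuous_on T g \<Longrightarrow> continuous_on T (\<lambda>x. f x \<otimes> g x)"
proof -
  have "continuous_on UNIV (\<lambda>(x, y). x \<otimes> y)" using lie unfolding lie_group_def smooth_map_def by blast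
  then show "continuous_on T f \<Longrightarrow> continuous_on T g \<Longrightarrow> continuous_on T (\<lambda>x. f x \<otimes> g x)"
    using continuous_on_compose2[of UNIV "\<lambda>(x, y). x \<otimes> y" T "\<lambda>x. (f x, g x)"] by (auto intro: continuous_on_Pair)
qed

lemma continuous_inv: "continuous_on T f \<Longrightarrow> continuous_on T (\<lambda>x. inv (f x))"
proof -
  have "continuous_on UNIV (\<lambda>x. inv x)" using lie unfolding lie_group_def smooth_map_def by blast
  then show "continuous_on T f \<Longrightarrow> continuous_on T (\<lambda>x. inv (f x))"
    using continuous_on_compose2[of UNIV "\<lambda>x. inv x" T f] by auto
qed

lemma open_chart_preimage:
  assumes "c' \<in> A" "open T" "continuous_on T F"
  shows "open (T \<inter> F -` fst c')"
  using continuous_open_preimage[OF assms(3,2) chart_facts(1)[OF assms(1)]] .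

text \<open>\<open>C\<^sup>k\<close> maps from an open subset of a Euclidean space into the group, tested in all charts of the atlas. The
smoothness of every coordinate expression below follows from the closure properties of this class.\<close>

definition Ck_map :: "nat \<Rightarrow> 'v::euclidean_space set \<Rightarrow> ('v \<Rightarrow> 'g) \<Rightarrow> bool" where
  "Ck_map k T F \<longleftrightarrow> open T \<and> continuous_on T F \<and>
     (\<forall>c'\<in>A. C_k_on k (T \<inter> F -` fst c') (\<lambda>x. snd c' (F x)))"

lemma Ck_map_const: "open T \<Longrightarrow> Ck_map k T (\<lambda>x. g)"
  by (auto simp: Ck_map_def)

lemma Ck_map_compose:
  assumes F: "Ck_map k T F" and h: "C_k_on k S h" "open S" "h ` S \<subseteq> T"
  shows "Ck_map k S (\<lambda>x. F (h x))"
  unfolding Ck_map_def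
proof (intro conjI ballI)
  show "open S" by fact
  have ch: "continuous_on S h" using C_k_on_imp_continuous_on h(1) .
  show "continuous_on S (\<lambda>x. F (h x))"
    using continuous_on_compose2[OF _ ch h(3)] F by (auto simp: Ck_map_def)
  fix c' assume "c' \<in> A"
  then have "C_k_on k (T \<inter> F -` fst c') (\<lambda>x. snd c' (F x))" using F by (simp add: Ck_map_def)
  moreover have "C_k_on k (S \<inter> (\<lambda>x. F (h x)) -` fst c') h" using h(1) by (rule C_k_on_subset) auto
  ultimately show "C_k_on k (S \<inter> (\<lambda>x. F (h x)) -` fst c') (\<lambda>x. snd c' (F (h x)))"
    using C_k_on_compose[of k _ h _ "\<lambda>x. snd c' (F x)"] h(3) by blast
qed

lemma Ck_map_param:
  assumes "c' \<in> A"
  shows "Ck_map k (snd c' ` fst c') (chart_param c')"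
  unfolding Ck_map_def
proof (intro conjI ballI)
  fix d assume d: "d \<in> A"
  have "smooth_map A A id" using atlas by (simp add: smooth_atlas_def)
  then have "C_k_on k (snd c' ` (fst c' \<inter> id -` fst d)) (snd d \<circ> id \<circ> chart_param c')"
    using assms d unfolding smooth_map_def smooth_on_def by blast
  moreover have "snd c' ` fst c' \<inter> chart_param c' -` fst d = snd c' ` (fst c' \<inter> id -` fst d)"
    using chart_facts(5)[OF assms] by auto
  ultimately show "C_k_on k (snd c' ` fst c' \<inter> chart_param c' -` fst d) (\<lambda>x. snd d (chart_param c' x))"
    by (simp add: comp_def)
qed (use chart_facts[OF assms] in auto)

lemma Ck_map_mult:
  assumes F: "Ck_map k T F" and H: "Ck_map k T H"
  shows "Ck_map k T (\<lambda>x. F x \<otimes> H x)"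
  unfolding Ck_map_def
proof (intro conjI ballI)
  show T: "open T" using F by (simp add: Ck_map_def)
  have cF: "continuous_on T F" "continuous_on T H" using F H by (auto simp: Ck_map_def)
  show cm: "continuous_on T (\<lambda>x. F x \<otimes> H x)" by (rule continuous_mult[OF cF])
  fix c3 assume c3: "c3 \<in> A"
  let ?W = "T \<inter> (\<lambda>x. F x \<otimes> H x) -` fst c3"
  have W: "open ?W" by (rule open_chart_preimage[OF c3 T cm])
  show "C_k_on k ?W (\<lambda>x. snd c3 (F x \<otimes> H x))"
  proof (rule C_k_on_local[OF W])
    fix x assume x: "x \<in> ?W"
    obtain c1 c2 where c12: "c1 \<in> A" "F x \<in> fst c1" "c2 \<in> A" "H x \<in> fst c2" using chart_at by metis
    let ?N = "?W \<inter> (T \<inter> F -` fst c1) \<inter> (T \<inter> H -` fst c2)"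
    have N: "open ?N"
      by (rule open_Int[OF open_Int[OF W open_chart_preimage[OF c12(1) T cF(1)]] open_chart_preimage[OF c12(3) T cF(2)]])
    let ?P = "(fst c1 \<times> fst c2, map_prod (snd c1) (snd c2))"
    have "?P \<in> prod_atlas A A" using c12 by (force simp: prod_atlas_def)
    moreover have "smooth_map (prod_atlas A A) A (\<lambda>(x, y). x \<otimes> y)" using lie by (simp add: lie_group_def)
    ultimately have sm: "C_k_on k (map_prod (snd c1) (snd c2) ` ((fst c1 \<times> fst c2) \<inter> (\<lambda>(x, y). x \<otimes> y) -` fst c3))
        (snd c3 \<circ> (\<lambda>(x, y). x \<otimes> y) \<circ> chart_param ?P)"
      using c3 unfolding smooth_map_def smooth_on_def by fastforce
    have inj: "inj_on (map_prod (snd c1) (snd c2)) (fst c1 \<times> fst c2)"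
      using chart_facts(5)[OF c12(1)] chart_facts(5)[OF c12(3)] by (auto simp: inj_on_def) metis+
    have param: "chart_param ?P (snd c1 a, snd c2 b) = (a, b)" if "a \<in> fst c1" "b \<in> fst c2" for a b
      unfolding chart_param_def using inv_into_f_f[OF inj, of "(a, b)"] that by simp
    have "C_k_on k ?N (\<lambda>x. snd c1 (F x))" "C_k_on k ?N (\<lambda>x. snd c2 (H x))"
      using F H c12 unfolding Ck_map_def by (meson C_k_on_subset Int_lower2 Int_lower1 order_trans)+
    then have "C_k_on k ?N (\<lambda>x. (snd c1 (F x), snd c2 (H x)))" by (rule C_k_on_Pair)
    then have "C_k_on k ?N (\<lambda>x. (snd c3 \<circ> (\<lambda>(x, y). x \<otimes> y) \<circ> chart_param ?P) (snd c1 (F x), snd c2 (H x)))"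
    proof (rule C_k_on_compose[OF _ sm], intro image_subsetI)
      fix y assume "y \<in> ?N"
      then show "(snd c1 (F y), snd c2 (H y)) \<in> map_prod (snd c1) (snd c2) ` ((fst c1 \<times> fst c2) \<inter> (\<lambda>(x, y). x \<otimes> y) -` fst c3)"
        by (intro image_eqI[of _ _ "(F y, H y)"]) auto
    qed
    then have "C_k_on k ?N (\<lambda>x. snd c3 (F x \<otimes> H x))"
      by (subst C_k_on_cong[OF N, of _ "\<lambda>x. (snd c3 \<circ> (\<lambda>(x, y). x \<otimes> y) \<circ> chart_param ?P) (snd c1 (F x), snd c2 (H x))"])
         (auto simp: param)
    then show "\<exists>N. open N \<and> x \<in> N \<and> C_k_on k N (\<lambda>x. snd c3 (F x \<otimes> H x))"
      using N x c12 by (intro exI[of _ ?N]) auto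
  qed
qed

lemma Ck_map_inv:
  assumes F: "Ck_map k T F"
  shows "Ck_map k T (\<lambda>x. inv (F x))"
  unfolding Ck_map_def
proof (intro conjI ballI)
  show T: "open T" using F by (simp add: Ck_map_def)
  have cF: "continuous_on T F" using F by (auto simp: Ck_map_def)
  show cm: "continuous_on T (\<lambda>x. inv (F x))" by (rule continuous_inv[OF cF])
  fix c3 assume c3: "c3 \<in> A"
  let ?W = "T \<inter> (\<lambda>x. inv (F x)) -` fst c3"
  have W: "open ?W" by (rule open_chart_preimage[OF c3 T cm])
  show "C_k_on k ?W (\<lambda>x. snd c3 (inv (F x)))"
  proof (rule C_k_on_local[OF W])
    fix x assume x: "x \<in> ?W"
    obtain c1 where c1: "c1 \<in> A" "F x \<in> fst c1" using chart_at by metis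
    let ?N = "?W \<inter> (T \<inter> F -` fst c1)"
    have N: "open ?N"
      by (rule open_Int[OF W open_chart_preimage[OF c1(1) T cF]])
    have sm: "C_k_on k (snd c1 ` (fst c1 \<inter> (\<lambda>x. inv x) -` fst c3)) (snd c3 \<circ> (\<lambda>x. inv x) \<circ> chart_param c1)"
      using lie c1 c3 unfolding lie_group_def smooth_map_def smooth_on_def by blast
    have "C_k_on k ?N (\<lambda>x. snd c1 (F x))"
      using F c1 unfolding Ck_map_def by (meson C_k_on_subset Int_lower2)
    then have "C_k_on k ?N (\<lambda>x. (snd c3 \<circ> (\<lambda>x. inv x) \<circ> chart_param c1) (snd c1 (F x)))"
      by (rule C_k_on_compose[OF _ sm]) auto
    then have "C_k_on k ?N (\<lambda>x. snd c3 (inv (F x)))"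
      by (subst C_k_on_cong[OF N, of _ "\<lambda>x. (snd c3 \<circ> (\<lambda>x. inv x) \<circ> chart_param c1) (snd c1 (F x))"])
         (auto simp: chart_facts(5)[OF c1(1)])
    then show "\<exists>N. open N \<and> x \<in> N \<and> C_k_on k N (\<lambda>x. snd c3 (inv (F x)))"
      using N x c1 by (intro exI[of _ ?N]) auto
  qed
qed


section \<open>Left-invariant vector fields\<close>

text \<open>The group in the coordinates of \<open>c\<close>: \<open>lmult\<close> and \<open>ldiff\<close> express \<open>x y\<close> and \<open>x\<^sup>-\<^sup>1 y\<close>, on the open sets of those
pairs for which the result stays in the chart.\<close>

definition e0 :: 'e where "e0 = snd c \<one>"
definition Ch :: "'e set" where "Ch = snd c ` fst c"
abbreviation par :: "'e \<Rightarrow> 'g" where "par \<equiv> chart_param c"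
abbreviation psi :: "'g \<Rightarrow> 'e" where "psi \<equiv> snd c"

definition lmult :: "'e \<times> 'e \<Rightarrow> 'e" where "lmult z = psi (par (fst z) \<otimes> par (snd z))"
definition lmult_dom :: "('e \<times> 'e) set" where
  "lmult_dom = {z \<in> Ch \<times> Ch. par (fst z) \<otimes> par (snd z) \<in> fst c}"
definition ldiff :: "'e \<times> 'e \<Rightarrow> 'e" where "ldiff z = psi (inv par (fst z) \<otimes> par (snd z))"
definition ldiff_dom :: "('e \<times> 'e) set" where
  "ldiff_dom = {z \<in> Ch \<times> Ch. inv par (fst z) \<otimes> par (snd z) \<in> fst c}"

lemma e0_in [simp]: "e0 \<in> Ch" using one_in by (simp add: e0_def Ch_def)
lemma open_Ch: "open Ch" using chart_facts(2)[OF c_in] by (simp add: Ch_def)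
lemma par_e0 [simp]: "par e0 = \<one>" using chart_facts(5)[OF c_in one_in] by (simp add: e0_def)
lemma psi_par: "y \<in> Ch \<Longrightarrow> psi (par y) = y" using chart_facts(6)[OF c_in] by (simp add: Ch_def)
lemma par_in: "y \<in> Ch \<Longrightarrow> par y \<in> fst c" using chart_facts(7)[OF c_in] by (simp add: Ch_def)
lemma par_psi: "x \<in> fst c \<Longrightarrow> par (psi x) = x" using chart_facts(5)[OF c_in] .
lemma psi_in: "x \<in> fst c \<Longrightarrow> psi x \<in> Ch" by (simp add: Ch_def)
lemma psi_one [simp]: "psi \<one> = e0" by (simp add: e0_def)

lemma Ck_map_par: "Ck_map k Ch par" unfolding Ch_def by (rule Ck_map_param[OF c_in])

lemma Ck_map_par_fst: "Ck_map k (Ch \<times> Ch) (\<lambda>z. par (fst z))"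
  by (rule Ck_map_compose[OF Ck_map_par]) (auto intro: C_k_on_linear bounded_linear_fst open_Times open_Ch)
lemma Ck_map_par_snd: "Ck_map k (Ch \<times> Ch) (\<lambda>z. par (snd z))"
  by (rule Ck_map_compose[OF Ck_map_par]) (auto intro: C_k_on_linear bounded_linear_snd open_Times open_Ch)

lemma Ck_map_on_chart:
  assumes "Ck_map k T F" "c' \<in> A"
  shows "open {x \<in> T. F x \<in> fst c'}" "C_k_on k {x \<in> T. F x \<in> fst c'} (\<lambda>x. snd c' (F x))"
proof -
  have eq: "{x \<in> T. F x \<in> fst c'} = T \<inter> F -` fst c'" by auto
  show "open {x \<in> T. F x \<in> fst c'}" "C_k_on k {x \<in> T. F x \<in> fst c'} (\<lambda>x. snd c' (F x))"
    unfolding eq using assms open_chart_preimage[OF assms(2), of T F] by (auto simp: Ck_map_def)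
qed

lemma lmult_smooth: "open lmult_dom" "C_k_on k lmult_dom lmult"
  using Ck_map_on_chart[OF Ck_map_mult[OF Ck_map_par_fst Ck_map_par_snd] c_in]
  unfolding lmult_dom_def lmult_def by auto

lemma ldiff_smooth: "open ldiff_dom" "C_k_on k ldiff_dom ldiff"
  using Ck_map_on_chart[OF Ck_map_mult[OF Ck_map_inv[OF Ck_map_par_fst] Ck_map_par_snd] c_in]
  unfolding ldiff_dom_def ldiff_def by auto

lemma lmult_dom_e0 [simp]: "x \<in> Ch \<Longrightarrow> (x, e0) \<in> lmult_dom" by (simp add: lmult_dom_def par_in)
lemma lmult_e0: "x \<in> Ch \<Longrightarrow> lmult (x, e0) = x" by (simp add: lmult_def psi_par)
lemma e0_lmult: "x \<in> Ch \<Longrightarrow> lmult (e0, x) = x" by (simp add: lmult_def psi_par)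
lemma e0_lmult_dom [simp]: "x \<in> Ch \<Longrightarrow> (e0, x) \<in> lmult_dom" by (simp add: lmult_dom_def par_in)

lemma open_right_factors:
  assumes "x \<in> Ch"
  shows "open ({y. (x, y) \<in> lmult_dom} \<inter> Ch)" "e0 \<in> {y. (x, y) \<in> lmult_dom} \<inter> Ch"
  using open_vimage[OF lmult_smooth(1), of "\<lambda>y. (x, y)"] assms open_Ch
  by (auto simp: vimage_def continuous_on_Pair)

text \<open>\<open>X v\<close> is the left-invariant vector field with value \<open>v\<close> at the identity.\<close>

definition X :: "'e \<Rightarrow> 'e \<Rightarrow> 'e" where "X v x = frechet_derivative lmult (at (x, e0)) (0, v)"

lemma has_derivative_Pair_right:
  assumes "(f has_derivative f') (at (x, y))"
  shows "((\<lambda>y. f (x, y)) has_derivative (\<lambda>h. f' (0, h))) (at y)"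
proof -
  have "((\<lambda>y. (x, y)) has_derivative (\<lambda>h. (0, h))) (at y)" by (intro has_derivative_Pair) (auto intro: derivative_intros)
  from has_derivative_compose[OF this, of f f'] assms show ?thesis by simp
qed

lemma lmult_has_derivative: "z \<in> lmult_dom \<Longrightarrow> (lmult has_derivative frechet_derivative lmult (at z)) (at z)"
  by (rule C_k_on_derivative(1)[OF lmult_smooth(2)[of "Suc 0"] lmult_smooth(1)])

lemma X_has_derivative: "x \<in> Ch \<Longrightarrow> ((\<lambda>y. lmult (x, y)) has_derivative (\<lambda>v. X v x)) (at e0)"
  unfolding X_def by (rule has_derivative_Pair_right[OF lmult_has_derivative]) simp

lemma X_smooth: "C_k_on k Ch (X v)"
proof -
  have "C_k_on k Ch (\<lambda>x. (x, e0))"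
    by (intro C_k_on_Pair C_k_on_const C_k_on_linear[OF bounded_linear_ident])
  then show ?thesis unfolding X_def[abs_def]
    by (intro C_k_on_derivative_dir[OF lmult_smooth(2,1)]) (auto simp: open_Ch)
qed

lemma linear_X: "x \<in> Ch \<Longrightarrow> linear (\<lambda>v. X v x)"
  using X_has_derivative has_derivative_linear by blast

lemma X_e0 [simp]: "X v e0 = v"
proof -
  have "((\<lambda>y. lmult (e0, y)) has_derivative (\<lambda>v. v)) (at e0)"
    by (rule has_derivative_transform_within_open[of "\<lambda>y. y" _ _ _ Ch]) (auto simp: open_Ch e0_lmult)
  then show ?thesis using X_has_derivative[OF e0_in] has_derivative_unique by metis
qed

lemma left_mult_has_derivative:
  assumes "(x, y) \<in> lmult_dom"
  shows "((\<lambda>y. lmult (x, y)) has_derivative (\<lambda>h. frechet_derivative lmult (at (x, y)) (0, h))) (at y)"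
  by (rule has_derivative_Pair_right[OF lmult_has_derivative[OF assms]])

text \<open>Differentiate the associative law \<open>(x y) z = x (y z)\<close> in \<open>z\<close> at the identity.\<close>

lemma X_left_invariant:
  assumes xy: "(x, y) \<in> lmult_dom"
  shows "frechet_derivative lmult (at (x, y)) (0, X w y) = X w (lmult (x, y))"
proof -
  have C: "x \<in> Ch" "y \<in> Ch" "lmult (x, y) \<in> Ch" "par (lmult (x, y)) = par x \<otimes> par y"
    using xy by (auto simp: lmult_dom_def lmult_def psi_in par_psi)
  let ?N = "{z. (y, z) \<in> lmult_dom} \<inter> Ch"
  note N = open_right_factors[OF C(2)]
  have "((\<lambda>z. lmult (x, lmult (y, z))) has_derivative (\<lambda>v. frechet_derivative lmult (at (x, y)) (0, X v y))) (at e0)"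
    using has_derivative_compose[OF X_has_derivative[OF C(2)], of "\<lambda>y. lmult (x, y)"]
      left_mult_has_derivative[OF xy] lmult_e0[OF C(2)] by simp
  moreover have "((\<lambda>z. lmult (x, lmult (y, z))) has_derivative (\<lambda>v. X v (lmult (x, y)))) (at e0)"
  proof (rule has_derivative_transform_within_open[OF X_has_derivative[OF C(3)] N])
    fix z assume "z \<in> ?N"
    then have z: "(y, z) \<in> lmult_dom" by auto
    then have "par (lmult (y, z)) = par y \<otimes> par z" by (auto simp: lmult_dom_def lmult_def par_psi)
    then show "lmult (lmult (x, y), z) = lmult (x, lmult (y, z))"
      using C(4) by (simp add: lmult_def m_assoc)
  qed
  ultimately show ?thesis using has_derivative_unique by metis
qed

abbreviation br :: "'e \<Rightarrow> 'e \<Rightarrow> 'e" where "br \<equiv> lie_bracket G c"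
definition DX :: "'e \<Rightarrow> 'e \<Rightarrow> 'e \<Rightarrow> 'e" where "DX w x = frechet_derivative (X w) (at x)"

lemma X_deriv: "x \<in> Ch \<Longrightarrow> (X w has_derivative DX w x) (at x)"
  unfolding DX_def by (rule C_k_on_derivative(1)[OF X_smooth[of "Suc 0"] open_Ch])

lemma left_deriv_psi: "x \<in> Ch \<Longrightarrow> left_deriv G c w psi (par x) = X w x"
proof -
  assume x: "x \<in> Ch"
  have "((\<lambda>t. lmult (x, e0 + t *\<^sub>R w)) has_vector_derivative X w x) (at 0)"
    using has_vector_derivative_along_line[of "\<lambda>y. lmult (x, y)" "\<lambda>v. X v x" e0 0 w] X_has_derivative[OF x] by simp
  then show ?thesis unfolding left_deriv_def lmult_def e0_def[symmetric]
    by (simp add: vector_derivative_at)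
qed

text \<open>Deriving the coordinate functions along \<open>X w\<close> gives \<open>X w\<close> itself in coordinates; a second derivation takes place at
the identity, where the field \<open>X v\<close> is \<open>v\<close>.\<close>

lemma br_eq: "br v w = DX w e0 v - DX v e0 w"
proof -
  have "left_deriv G c v (left_deriv G c w psi) \<one> = DX w e0 v" for v w
  proof -
    have "((\<lambda>t. X w (e0 + t *\<^sub>R v)) has_vector_derivative DX w e0 v) (at 0)"
      by (rule has_vector_derivative_along_line) (simp add: X_deriv)
    then have D: "((\<lambda>t. X w (e0 + t *\<^sub>R v)) has_derivative (\<lambda>x. x *\<^sub>R DX w e0 v)) (at 0)"
      unfolding has_vector_derivative_def .
    have "open ((\<lambda>t::real. e0 + t *\<^sub>R v) -` Ch)"
      by (intro open_vimage open_Ch continuous_intros)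
    then have "((\<lambda>t. left_deriv G c w psi (par (e0 + t *\<^sub>R v))) has_vector_derivative DX w e0 v) (at 0)"
      unfolding has_vector_derivative_def
      by (rule has_derivative_transform_within_open[OF D]) (use left_deriv_psi in auto)
    then show ?thesis unfolding left_deriv_def[of G c v] e0_def[symmetric] by (simp add: vector_derivative_at)
  qed
  then show ?thesis by (simp add: lie_bracket_def)
qed

lemma br_antisym: "br v w = - br w v" by (simp add: br_eq)

lemma linear_DX_dir: "x \<in> Ch \<Longrightarrow> linear (DX w x)"
  using X_deriv has_derivative_linear by blast

lemma linear_DX_field: "x \<in> Ch \<Longrightarrow> linear (\<lambda>w. DX w x h)"
proof (rule linearI)
  assume x: "x \<in> Ch"
  fix a b :: 'e and r :: real
  have "(X (a + b) has_derivative (\<lambda>h. DX a x h + DX b x h)) (at x)"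
    by (rule has_derivative_transform_within_open[of "\<lambda>x. X a x + X b x" _ _ _ Ch])
       (use x in \<open>auto simp: open_Ch linear_add[OF linear_X] intro!: has_derivative_add X_deriv\<close>)
  then have "DX (a + b) x = (\<lambda>h. DX a x h + DX b x h)" using X_deriv[OF x] has_derivative_unique by blast
  then show "DX (a + b) x h = DX a x h + DX b x h" by simp
  have "(X (r *\<^sub>R a) has_derivative (\<lambda>h. r *\<^sub>R DX a x h)) (at x)"
    by (rule has_derivative_transform_within_open[of "\<lambda>x. r *\<^sub>R X a x" _ _ _ Ch])
       (use x in \<open>auto simp: open_Ch linear_scale[OF linear_X] intro!: has_derivative_scaleR_right X_deriv\<close>)
  then have "DX (r *\<^sub>R a) x = (\<lambda>h. r *\<^sub>R DX a x h)" using X_deriv[OF x] has_derivative_unique by blast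
  then show "DX (r *\<^sub>R a) x h = r *\<^sub>R DX a x h" by simp
qed

lemma bilinear_br: "bilinear br"
  unfolding bilinear_def br_eq[abs_def] using linear_DX_dir linear_DX_field
  by (auto intro!: linear_compose_sub)

text \<open>At the identity this is \<open>br_eq\<close>. Left translation by \<open>x\<close> carries the formula to the point \<open>x\<close>: it preserves the
fields, and its second derivative, being symmetric, cancels in the commutator.\<close>

theorem commutator_left_invariant_fields:
  assumes x: "x \<in> Ch"
  shows "DX w x (X v x) - DX v x (X w x) = X (br v w) x"
proof -
  let ?u = "\<lambda>y. lmult (x, y)"
  let ?N = "{y. (x, y) \<in> lmult_dom} \<inter> Ch"
  note N = open_right_factors[OF x]
  have "C_k_on 2 ?N (\<lambda>y. (x, y))"
    by (intro C_k_on_Pair C_k_on_const C_k_on_linear[OF bounded_linear_ident])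
  then have u2: "C_k_on 2 ?N ?u"
    by (rule C_k_on_compose[OF _ lmult_smooth(2)]) auto
  have du: "frechet_derivative ?u (at y) = (\<lambda>h. frechet_derivative lmult (at (x, y)) (0, h))" if "y \<in> ?N" for y
    using frechet_derivative_at[OF left_mult_has_derivative[of x y]] that by auto
  have du0: "frechet_derivative ?u (at e0) = (\<lambda>h. X h x)"
    using frechet_derivative_at[OF X_has_derivative[OF x]] by simp
  have main: "frechet_derivative (\<lambda>y. frechet_derivative ?u (at y) w) (at e0) v + X (DX w e0 v) x = DX w x (X v x)" for v w
  proof -
    have "((\<lambda>y. frechet_derivative ?u (at y) (X w y)) has_derivative
      (\<lambda>h. frechet_derivative (\<lambda>y. frechet_derivative ?u (at y) (X w e0)) (at e0) h + frechet_derivative ?u (at e0) (DX w e0 h))) (at e0)"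
      using u2 by (intro frechet_derivative_directional[OF _ N] X_deriv) (auto simp: numeral_2_eq_2)
    moreover have "((\<lambda>y. frechet_derivative ?u (at y) (X w y)) has_derivative (\<lambda>h. DX w x (X h x))) (at e0)"
    proof (rule has_derivative_transform_within_open[OF _ N])
      show "((\<lambda>y. X w (lmult (x, y))) has_derivative (\<lambda>h. DX w x (X h x))) (at e0)"
        using has_derivative_compose[OF X_has_derivative[OF x], of "X w"] X_deriv[OF x] lmult_e0[OF x] by simp
    qed (use X_left_invariant du in auto)
    ultimately have "(\<lambda>h. frechet_derivative (\<lambda>y. frechet_derivative ?u (at y) (X w e0)) (at e0) h + frechet_derivative ?u (at e0) (DX w e0 h)) = (\<lambda>h. DX w x (X h x))"
      by (rule has_derivative_unique)
    from fun_cong[OF this, of v] show ?thesis by (simp add: du0)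
  qed
  have "frechet_derivative (\<lambda>y. frechet_derivative ?u (at y) w) (at e0) v
      = frechet_derivative (\<lambda>y. frechet_derivative ?u (at y) v) (at e0) w"
    by (rule second_derivative_symmetric[OF u2 N])
  then have "DX w x (X v x) - DX v x (X w x) = X (DX w e0 v) x - X (DX v e0 w) x"
    unfolding main[of v w, symmetric] main[of w v, symmetric] by simp
  then show ?thesis unfolding br_eq linear_diff[OF linear_X[OF x]] .
qed

end

section \<open>Isotropic and regular subspaces\<close>

text \<open>The form of directness of the sum of the layers that is needed below: comparison of two decompositions of \<open>z\<close>.\<close>

lemma layers_independent:
  fixes br :: "'e::euclidean_space \<Rightarrow> 'e \<Rightarrow> 'e"
  assumes strat: "stratification br d V" and j: "j \<ge> 2" "z \<in> V j"
    and z: "z = v1 + v2" "v1 \<in> V 1" "v2 \<in> V 2" "j = 2 \<longrightarrow> v2 = 0"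
  shows "z = 0"
proof (cases "j \<le> d")
  case False
  then show ?thesis using strat j by (auto simp: stratification_def)
next
  case True
  have sub: "subspace (V i)" if "i \<ge> 1" for i using strat that by (simp add: stratification_def)
  have unique: "\<exists>!v. v \<in> (\<Pi>\<^sub>E i\<in>{1..d}. V i) \<and> z = (\<Sum>i=1..d. v i)"
    using strat by (simp add: stratification_def)
  define p where "p = (\<lambda>i\<in>{1..d}. if i = j then z else 0)"
  define q where "q = (\<lambda>i\<in>{1..d}. if i = 1 then v1 else if i = 2 then v2 else 0)"
  have "p \<in> (\<Pi>\<^sub>E i\<in>{1..d}. V i)" "q \<in> (\<Pi>\<^sub>E i\<in>{1..d}. V i)"
    using j z subspace_0[OF sub] by (auto simp: p_def q_def)
  moreover have "(\<Sum>i=1..d. p i) = z"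
  proof -
    have "(\<Sum>i=1..d. p i) = (\<Sum>i\<in>{1..d}. if i = j then z else 0)" by (intro sum.cong) (auto simp: p_def)
    then show ?thesis using True j by simp
  qed
  moreover have "(\<Sum>i=1..d. q i) = v1 + v2"
  proof -
    have "(\<Sum>i=1..d. q i) = (\<Sum>i\<in>{1,2}. q i)"
      using True j by (intro sum.mono_neutral_right) (auto simp: q_def)
    then show ?thesis using True j by (simp add: q_def)
  qed
  ultimately have "p = q" using unique z(1) by (metis (no_types, lifting))
  then have "p j = q j" by simp
  then show ?thesis using True j z(4) by (auto simp: p_def q_def split: if_splits)
qed

text \<open>Let \<open>s\<close> be a nonzero element of \<open>S\<close>. By regularity \<open>br \<xi> s\<close> with \<open>\<xi> \<in> V 1\<close> takes all values modulo \<open>V 1\<close>.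
Since it lies in \<open>V 2\<close>, the algebra is \<open>V 1 + V 2\<close>, the layer \<open>V 3\<close> is zero, and every element of \<open>V 2\<close> is
a bracket with \<open>s\<close>. If \<open>s\<close> is itself in the span of the brackets, this puts \<open>V 2\<close> into every term of the
lower central series: once \<open>V 2\<close> is in a term, so are all brackets, hence \<open>s\<close>, hence \<open>V 2\<close> is in the next
term. Nilpotency then gives \<open>V 2 = {0}\<close>, so all brackets vanish and so does \<open>s\<close>.\<close>

lemma regular_subspace_avoids_brackets:
  fixes br :: "'e::euclidean_space \<Rightarrow> 'e \<Rightarrow> 'e"
  assumes bil: "bilinear br" and anti: "\<And>v w. br v w = - br w v"
    and nil: "nilpotent_of_step br d" and strat: "stratification br d V"
    and cof: "horizontal_coframe (V 1) \<eta>"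
    and S: "subspace S" "S \<subseteq> V 1"
    and reg: "Omega_regular br (V 1) \<eta> S"
    and s: "s \<in> S" "s \<in> span {br u v | u v. True}"
  shows "s = 0"
proof (rule ccontr)
  assume s0: "s \<noteq> 0"
  note badd = bilinear_ladd[OF bil] bilinear_radd[OF bil] bilinear_lmul[OF bil] bilinear_rmul[OF bil]
  have sub: "subspace (V i)" if "i \<ge> 1" for i using strat that by (simp add: stratification_def)
  have step: "br u v \<in> V (Suc j)" if "j \<ge> 1" "u \<in> V 1" "v \<in> V j" for u v j
  proof -
    have "span {br u v | u v. u \<in> V 1 \<and> v \<in> V j} = V (Suc j)" using strat that by (simp add: stratification_def)
    moreover have "br u v \<in> span {br u v | u v. u \<in> V 1 \<and> v \<in> V j}" using that by (intro span_base) auto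
    ultimately show ?thesis by simp
  qed
  have onto: "\<exists>\<xi>\<in>V 1. z - br \<xi> s \<in> V 1" for z
  proof -
    obtain B where B: "inj_on B {..<dim S}" "independent (B ` {..<dim S})" "span (B ` {..<dim S}) = S"
      and sol: "\<And>\<sigma> :: nat \<Rightarrow> nat \<Rightarrow> real. \<exists>\<xi>\<in>V 1. \<forall>i < DIM('e) - dim (V 1). \<forall>j < dim S. curvature br \<eta> i \<xi> (B j) = \<sigma> i j"
      using reg unfolding Omega_regular_def by metis
    have "s \<in> span (B ` {..<dim S})" using B(3) s by simp
    then obtain a where a: "s = (\<Sum>x\<in>B ` {..<dim S}. a x *\<^sub>R x)" by (auto simp: span_finite)
    then have a': "s = (\<Sum>j<dim S. a (B j) *\<^sub>R B j)" using B(1) by (simp add: sum.reindex)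
    (* To hit z it suffices to prescribe the bracket with one basis vector that occurs in s, and zero
       for the others. *)
    obtain j0 where j0: "j0 < dim S" "a (B j0) \<noteq> 0"
    proof (rule ccontr)
      assume "\<not> thesis"
      then have "(\<Sum>j<dim S. a (B j) *\<^sub>R B j) = 0" using that by (intro sum.neutral) auto
      then show False using a' s0 by simp
    qed
    obtain \<xi> where \<xi>: "\<xi> \<in> V 1" "\<And>i j. i < DIM('e) - dim (V 1) \<Longrightarrow> j < dim S \<Longrightarrow>
        curvature br \<eta> i \<xi> (B j) = (if j = j0 then \<eta> i z / (2 * a (B j0)) else 0)"
      using sol[of "\<lambda>i j. if j = j0 then \<eta> i z / (2 * a (B j0)) else 0"] by blast
    have "\<eta> i (br \<xi> s) = \<eta> i z" if i: "i < DIM('e) - dim (V 1)" for i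
    proof -
      have lin: "linear (\<eta> i)" using cof i by (simp add: horizontal_coframe_def)
      have linbr: "linear (br \<xi>)" using bil by (simp add: bilinear_def)
      have "\<eta> i (br \<xi> s) = (\<Sum>j<dim S. a (B j) * \<eta> i (br \<xi> (B j)))"
        by (subst a') (simp add: linear_sum[OF linbr] linear_sum[OF lin] linear_scale[OF linbr] linear_scale[OF lin])
      also have "\<dots> = (\<Sum>j<dim S. if j = j0 then \<eta> i z else 0)"
        using \<xi>(2)[OF i] j0 by (intro sum.cong) (auto simp: curvature_def field_simps split: if_splits)
      finally show ?thesis using j0 by simp
    qed
    then have "\<eta> i (z - br \<xi> s) = 0" if "i < DIM('e) - dim (V 1)" for i
      using cof that linear_diff[of "\<eta> i"] by (simp add: horizontal_coframe_def)
    then have "z - br \<xi> s \<in> V 1" using cof unfolding horizontal_coframe_def by blast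
    then show ?thesis using \<xi>(1) by blast
  qed
  have sV: "s \<in> V 1" using s S by auto
  have brs: "br \<xi> s \<in> V 2" if "\<xi> \<in> V 1" for \<xi> using step[of 1 \<xi> s] that sV by (simp add: numeral_2_eq_2)
  have V2: "\<exists>\<xi>\<in>V 1. z = br \<xi> s" if z: "z \<in> V 2" for z
  proof -
    obtain \<xi> where \<xi>: "\<xi> \<in> V 1" "z - br \<xi> s \<in> V 1" using onto by blast
    have "z - br \<xi> s \<in> V 2" using subspace_diff[OF sub] z brs[OF \<xi>(1)] by simp
    then have "z - br \<xi> s = 0" using layers_independent[OF strat, of 2 "z - br \<xi> s" "z - br \<xi> s" 0] \<xi>(2) subspace_0[OF sub] by simp
    then show ?thesis using \<xi> by auto
  qed
  have V3: "z = 0" if "z \<in> V 3" for z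
  proof -
    obtain \<xi> where \<xi>: "\<xi> \<in> V 1" "z - br \<xi> s \<in> V 1" using onto by blast
    then show ?thesis using layers_independent[OF strat, of 3 z "z - br \<xi> s" "br \<xi> s"] that brs by simp
  qed
  have split: "\<exists>a\<in>V 1. \<exists>b\<in>V 2. z = a + b" for z
  proof -
    obtain \<xi> where \<xi>: "\<xi> \<in> V 1" "z - br \<xi> s \<in> V 1" using onto by blast
    then show ?thesis using brs by (intro bexI[of _ "z - br \<xi> s"] bexI[of _ "br \<xi> s"]) auto
  qed
  have LCsub: "subspace (lower_central br i)" for i by (cases i) (auto simp: subspace_UNIV)
  have LCdec: "lower_central br (Suc i) \<subseteq> lower_central br i" for i
  proof (induction i)
    case (Suc i)
    show ?case unfolding lower_central.simps(2)[of br "Suc i"] lower_central.simps(2)[of br i]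
      by (intro span_mono) (use Suc in auto)
  qed simp
  have brLC: "br u v \<in> lower_central br (Suc i)" if "v \<in> lower_central br i" for u v i
    using that by (auto intro!: span_base)
  have in_s: "s \<in> lower_central br i \<Longrightarrow> V 2 \<subseteq> lower_central br (Suc i)" for i
    using V2 brLC by blast
  have main: "V 2 \<subseteq> lower_central br i" for i
  proof (induction i)
    case (Suc i)
    have "{br u v | u v. True} \<subseteq> lower_central br i"
    proof clarify
      fix u v
      obtain a b a' b' where ab: "u = a + b" "v = a' + b'" "a \<in> V 1" "a' \<in> V 1" "b \<in> V 2" "b' \<in> V 2" using split by metis
      have "br a a' \<in> V 2" using step[of 1 a a'] ab by (simp add: numeral_2_eq_2)
      moreover have "br a b' = 0" using step[of 2 a b'] ab V3 by (simp add: numeral_3_eq_3 numeral_2_eq_2)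
      moreover have "br b a' = 0" using step[of 2 a' b] ab V3 anti[of b a'] by (simp add: numeral_3_eq_3 numeral_2_eq_2)
      moreover have "br b b' \<in> lower_central br i" using brLC[of b' i b] Suc ab LCdec by blast
      moreover have "br u v = br a a' + br a b' + (br b a' + br b b')" unfolding ab by (simp add: badd algebra_simps)
      ultimately show "br u v \<in> lower_central br i" using Suc subspace_add[OF LCsub] by auto
    qed
    then have "span {br u v | u v. True} \<subseteq> lower_central br i" using LCsub span_minimal by blast
    then show ?case using s in_s by blast
  qed simp
  have "lower_central br d = {0}" using nil by (simp add: nilpotent_of_step_def)
  then have V20: "V 2 \<subseteq> {0}" using main[of d] by simp
  have "br u v = 0" for u v
  proof -
    obtain a b a' b' where ab: "u = a + b" "v = a' + b'" "a \<in> V 1" "a' \<in> V 1" "b \<in> V 2" "b' \<in> V 2" using split by metis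
    then have "b = 0" "b' = 0" using V20 by auto
    then show ?thesis using step[of 1 a a'] ab V20 by (auto simp: numeral_2_eq_2)
  qed
  then have "{br u v | u v. True} \<subseteq> {0}" by auto
  then have "s \<in> span {0}" using s(2) span_mono by blast
  then show False using s0 by simp
qed

text \<open>By isotropy the bracket is killed by the forms that cut out \<open>V 1\<close>, so it lies in \<open>V 1\<close>; it also lies in
\<open>V 2\<close>.\<close>

lemma isotropic_subspace_abelian:
  fixes br :: "'e::euclidean_space \<Rightarrow> 'e \<Rightarrow> 'e"
  assumes strat: "stratification br d V" and cof: "horizontal_coframe (V 1) \<eta>"
    and iso: "Omega_isotropic br (V 1) \<eta> S" and S: "S \<subseteq> V 1" "u \<in> S" "w \<in> S"
  shows "br u w = 0"
proof -
  have "\<eta> i (br u w) = 0" if "i < DIM('e) - dim (V 1)" for i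
    using iso S that by (auto simp: Omega_isotropic_def curvature_def)
  then have 1: "br u w \<in> V 1" using cof unfolding horizontal_coframe_def by blast
  have sp: "span {br u v | u v. u \<in> V 1 \<and> v \<in> V 1} = V 2" and "0 \<in> V 2"
    using strat by (auto simp: stratification_def numeral_2_eq_2 subspace_0)
  have "br u w \<in> V 2" unfolding sp[symmetric] using S by (intro span_base) blast
  from layers_independent[OF strat _ this _ 1 \<open>0 \<in> V 2\<close>] show ?thesis by simp
qed

text \<open>Bases of \<open>S\<close> and \<open>L\<close> are jointly independent, so the coordinate forms on \<open>S\<close> can be extended by zero on
\<open>L\<close>.\<close>

lemma dual_functionals:
  fixes S L :: "'e::euclidean_space set"
  assumes S: "subspace S" and L: "subspace L" and triv: "S \<inter> L = {0}" and m: "m \<le> dim S"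
  obtains v :: "nat \<Rightarrow> 'e" and \<mu> :: "nat \<Rightarrow> 'e \<Rightarrow> real"
  where "\<And>i. i < m \<Longrightarrow> v i \<in> S" "\<And>i. i < m \<Longrightarrow> linear (\<mu> i)"
    "\<And>i x. i < m \<Longrightarrow> x \<in> L \<Longrightarrow> \<mu> i x = 0"
    "\<And>i j. i < m \<Longrightarrow> j < m \<Longrightarrow> \<mu> i (v j) = (if i = j then 1 else 0)"
proof -
  obtain B where B: "B \<subseteq> S" "independent B" "S \<subseteq> span B" "card B = dim S"
    by (rule basis_exists[of S])
  obtain C where C: "C \<subseteq> L" "independent C" "L \<subseteq> span C" "card C = dim L"
    by (rule basis_exists[of L])
  have spans: "span B = S" "span C = L"
    using B C S L span_minimal by blast+
  have fin: "finite B" "finite C" using independent_imp_finite[OF B(2)] independent_imp_finite[OF C(2)] by simp_all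
  obtain e where e: "bij_betw e {..<dim S} B"
    using ex_bij_betw_nat_finite[OF fin(1)] B(4) by (auto simp: lessThan_atLeast0)
  have BC: "B \<inter> C = {}"
  proof -
    have "B \<inter> C \<subseteq> {0}" using B(1) C(1) triv by auto
    moreover have "0 \<notin> B" using B(2) dependent_zero by blast
    ultimately show ?thesis by auto
  qed
  have "independent (B \<union> C)"
  proof (rule card_le_dim_spanning[of _ "span (B \<union> C)"])
    have "span (B \<union> C) = {x + y | x y. x \<in> S \<and> y \<in> L}" using spans by (simp add: span_Un)
    then have "dim (span (B \<union> C)) + dim (S \<inter> L) = dim S + dim L" using dim_sums_Int[OF S L] by simp
    then have "dim (span (B \<union> C)) = dim S + dim L" using triv by simp
    then show "card (B \<union> C) \<le> dim (span (B \<union> C))" using B(4) C(4) card_Un_le[of B C] by simp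
  qed (use fin in \<open>auto intro: span_base\<close>)
  then have "\<exists>g. linear g \<and> (\<forall>x\<in>B \<union> C. g x = (if x = e i then 1 else 0 :: real))" for i
    by (rule linear_independent_extend)
  then obtain \<mu> where \<mu>: "\<And>i. linear (\<mu> i)" "\<And>i x. x \<in> B \<union> C \<Longrightarrow> \<mu> i x = (if x = e i then 1 else 0 :: real)"
    by metis
  have eB: "e i \<in> B" if "i < m" for i using e that m by (auto simp: bij_betw_def)
  show thesis
  proof (rule that[of e \<mu>])
    show "e i \<in> S" if "i < m" for i using eB[OF that] B(1) by auto
    show "linear (\<mu> i)" for i by (rule \<mu>(1))
    show "\<mu> i x = 0" if i: "i < m" and "x \<in> L" for i x
    proof -
      have "\<mu> i y = 0" if "y \<in> C" for y using \<mu>(2)[of y i] eB[OF i] BC that by auto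
      then show ?thesis using linear_eq_0_on_span[OF \<mu>(1)] spans(2) \<open>x \<in> L\<close> by blast
    qed
    show "\<mu> i (e j) = (if i = j then 1 else 0)" if "i < m" "j < m" for i j
      using \<mu>(2)[of "e j" i] eB[OF that(2)] e that m by (auto simp: bij_betw_def inj_on_def)
  qed
qed

section \<open>Primitives of closed left-invariant forms\<close>

context lie_chart
begin

text \<open>The Maurer-Cartan form: it translates the tangent vector \<open>k\<close> at \<open>x\<close> back to the identity.\<close>

definition MC :: "'e \<Rightarrow> 'e \<Rightarrow> 'e" where "MC x k = frechet_derivative ldiff (at (x, x)) (0, k)"

lemma diag_ldiff_dom [simp]: "x \<in> Ch \<Longrightarrow> (x, x) \<in> ldiff_dom"
  by (simp add: ldiff_dom_def one_in)

lemma ldiff_has_derivative: "z \<in> ldiff_dom \<Longrightarrow> (ldiff has_derivative frechet_derivative ldiff (at z)) (at z)"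
  by (rule C_k_on_derivative(1)[OF ldiff_smooth(2)[of "Suc 0"] ldiff_smooth(1)])

lemma MC_has_derivative: "x \<in> Ch \<Longrightarrow> ((\<lambda>y. ldiff (x, y)) has_derivative MC x) (at x)"
  unfolding MC_def by (rule has_derivative_Pair_right[OF ldiff_has_derivative]) simp

lemma linear_MC: "x \<in> Ch \<Longrightarrow> linear (MC x)"
  using MC_has_derivative has_derivative_linear by blast

lemma MC_smooth: "C_k_on k Ch (\<lambda>x. MC x h)"
proof -
  have "C_k_on k Ch (\<lambda>x. (x, x))" by (intro C_k_on_Pair C_k_on_linear[OF bounded_linear_ident])
  then show ?thesis unfolding MC_def[abs_def]
    by (intro C_k_on_derivative_dir[OF ldiff_smooth(2,1)]) (auto simp: open_Ch)
qed

lemma MC_X: "x \<in> Ch \<Longrightarrow> MC x (X v x) = v"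
proof -
  assume x: "x \<in> Ch"
  let ?N = "{z. (x, z) \<in> lmult_dom} \<inter> Ch"
  note N = open_right_factors[OF x]
  have "((\<lambda>z. ldiff (x, lmult (x, z))) has_derivative (\<lambda>v. MC x (X v x))) (at e0)"
    using has_derivative_compose[OF X_has_derivative[OF x], of "\<lambda>y. ldiff (x, y)"]
      MC_has_derivative[OF x] lmult_e0[OF x] by simp
  moreover have "((\<lambda>z. ldiff (x, lmult (x, z))) has_derivative (\<lambda>v. v)) (at e0)"
  proof (rule has_derivative_transform_within_open[OF has_derivative_ident N])
    fix z assume "z \<in> ?N"
    then have z: "par x \<otimes> par z \<in> fst c" "z \<in> Ch" by (auto simp: lmult_dom_def)
    then show "z = ldiff (x, lmult (x, z))"
      by (simp add: ldiff_def lmult_def par_psi m_assoc[symmetric] psi_par)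
  qed
  ultimately show ?thesis using has_derivative_unique by metis
qed

lemma X_surj: "x \<in> Ch \<Longrightarrow> \<exists>v. X v x = h"
proof -
  assume x: "x \<in> Ch"
  have "inj (\<lambda>v. X v x)" using MC_X[OF x] by (metis injI)
  then have "surj (\<lambda>v. X v x)" using linear_X[OF x] linear_injective_imp_surjective by blast
  then show ?thesis by (metis surjD)
qed

lemma MC_e0: "MC e0 v = v" using MC_X[OF e0_in, of v] by simp

text \<open>The left-invariant form \<open>\<mu> \<circ> MC\<close> is constant on left-invariant fields, so its exterior derivative on two of them is
\<open>\<mu>\<close> of their bracket, up to sign, and this vanishes. The symmetry stated here expresses that the form is closed.\<close>

lemma closed_of_vanishing_on_brackets:
  assumes \<mu>: "linear \<mu>" "\<And>v w. \<mu> (br v w) = (0::real)" and x: "x \<in> Ch"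
  shows "frechet_derivative (\<lambda>y. \<mu> (MC y h)) (at x) k = frechet_derivative (\<lambda>y. \<mu> (MC y k)) (at x) h"
proof -
  let ?L = "\<lambda>y k. \<mu> (MC y k)"
  let ?L' = "\<lambda>k. frechet_derivative (\<lambda>y. \<mu> (MC y k)) (at x)"
  have bl: "bounded_linear \<mu>" using \<mu>(1) by (simp add: linear_conv_bounded_linear)
  have C: "C_k_on (Suc 0) Ch (\<lambda>y. \<mu> (MC y k))" for k by (rule C_k_on_linear_comp[OF bl MC_smooth])
  have L': "((\<lambda>y. ?L y k) has_derivative ?L' k) (at x)" for k by (rule C_k_on_derivative(1)[OF C open_Ch x])
  have lin: "linear (?L y)" if "y \<in> Ch" for y using linear_compose[OF linear_MC[OF that] \<mu>(1)] by (simp add: comp_def)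
  have "?L' (X w x) h + ?L x (DX w x h) = 0" for w h
  proof -
    have "((\<lambda>y. ?L y (X w y)) has_derivative (\<lambda>h. ?L' (X w x) h + ?L x (DX w x h))) (at x)"
      by (rule has_derivative_linear_family[OF open_Ch x lin L' X_deriv[OF x]])
    moreover have "((\<lambda>y. ?L y (X w y)) has_derivative (\<lambda>h. 0)) (at x)"
      by (rule has_derivative_transform_within_open[OF has_derivative_const[of "\<mu> w"] open_Ch x]) (simp add: MC_X)
    ultimately have "(\<lambda>h. ?L' (X w x) h + ?L x (DX w x h)) = (\<lambda>h. 0)" by (rule has_derivative_unique)
    then show ?thesis by (rule fun_cong)
  qed note zero = this
  obtain v w where vw: "X v x = h" "X w x = k" using X_surj[OF x] by metis
  have "?L' h k - ?L' k h = ?L x (DX w x (X v x)) - ?L x (DX v x (X w x))"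
    using zero[of v k] zero[of w h] vw by simp
  also have "\<dots> = ?L x (X (br v w) x)"
    using linear_diff[OF lin[OF x]] commutator_left_invariant_fields[OF x, of w v] by metis
  also have "\<dots> = 0" using \<mu>(2) by (simp add: MC_X[OF x])
  finally show ?thesis by simp
qed

text \<open>The Poincare lemma on a ball: integrate the form along the radial segments and differentiate under the integral.\<close>

lemma local_primitive:
  assumes \<mu>: "linear \<mu>" "\<And>v w. \<mu> (br v w) = (0::real)" and r: "ball e0 r \<subseteq> Ch"
  shows "\<exists>f. \<forall>x\<in>ball e0 r. (f has_derivative (\<lambda>k. \<mu> (MC x k))) (at x)"
proof -
  let ?L = "\<lambda>y k. \<mu> (MC y k)"
  let ?L' = "\<lambda>x k. frechet_derivative (\<lambda>y. \<mu> (MC y k)) (at x)"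
  let ?B = "ball e0 r"
  have bl: "bounded_linear \<mu>" using \<mu>(1) by (simp add: linear_conv_bounded_linear)
  have C: "C_k_on (Suc 0) Ch (\<lambda>y. \<mu> (MC y k))" for k by (rule C_k_on_linear_comp[OF bl MC_smooth])
  have L': "((\<lambda>y. ?L y k) has_derivative ?L' x k) (at x)" if "x \<in> Ch" for k x by (rule C_k_on_derivative(1)[OF C open_Ch that])
  have cL': "continuous_on Ch (\<lambda>x. ?L' x k h)" for k h using C_k_on_derivative(2)[OF C open_Ch] by simp
  have cL: "continuous_on Ch (\<lambda>x. ?L x k)" for k using C C_k_on_imp_continuous_on by blast
  have lin: "linear (?L y)" if "y \<in> Ch" for y using linear_compose[OF linear_MC[OF that] \<mu>(1)] by (simp add: comp_def)
  define z where "z x t = e0 + t *\<^sub>R (x - e0)" for x and t :: real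
  have zB: "z x t \<in> ?B" if "x \<in> ?B" "t \<in> {0..1}" for x t
  proof -
    have "norm (t *\<^sub>R (x - e0)) \<le> norm (x - e0)" using that by (simp add: mult_left_le_one_le)
    then show ?thesis using that by (auto simp: z_def dist_norm norm_minus_commute)
  qed
  have zCh: "z x t \<in> Ch" if "x \<in> ?B" "t \<in> {0..1}" for x t using zB[OF that] r by auto
  have cz: "continuous_on S (\<lambda>(x, t). z x t)" for S by (auto simp: z_def case_prod_beta intro!: continuous_intros)
  (* By closedness the integrand has a derivative in x that is a total derivative in t, namely of
     t * \<mu> (MC (z x t) k). *)
  define D where "D x t k = t * ?L' (z x t) k (x - e0) + ?L (z x t) k" for x t k
  have dF: "((\<lambda>x. ?L (z x t) (x - e0)) has_derivative D x t) (at x)" if "x \<in> ?B" "t \<in> {0..1}" for x t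
  proof -
    have dz: "((\<lambda>x. z x t) has_derivative (\<lambda>h. t *\<^sub>R h)) (at x)" unfolding z_def by (auto intro!: derivative_eq_intros)
    have "((\<lambda>x. ?L (z x t) (x - e0)) has_derivative (\<lambda>h. ?L' (z x t) (x - e0) (t *\<^sub>R h) + ?L (z x t) h)) (at x)"
    proof (rule has_derivative_linear_family[where S="(\<lambda>x. z x t) -` Ch" and L="\<lambda>x k. ?L (z x t) k"
          and L'="\<lambda>k h. ?L' (z x t) k (t *\<^sub>R h)" and V="\<lambda>x. x - e0" and V'="\<lambda>h. h"])
      show "open ((\<lambda>x. z x t) -` Ch)" unfolding z_def by (intro open_vimage open_Ch continuous_intros)
      show "((\<lambda>y. ?L (z y t) k) has_derivative (\<lambda>h. ?L' (z x t) k (t *\<^sub>R h))) (at x)" for k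
        by (rule has_derivative_compose[OF dz L'[OF zCh[OF that]]])
      show "((\<lambda>x. x - e0) has_derivative (\<lambda>h. h)) (at x)" by (auto intro!: derivative_eq_intros)
    qed (use zCh[OF that] lin in auto)
    moreover have "?L' (z x t) (x - e0) (t *\<^sub>R h) = t * ?L' (z x t) h (x - e0)" for h
    proof -
      have "linear (?L' (z x t) (x - e0))" using L'[OF zCh[OF that]] has_derivative_linear by blast
      then have "?L' (z x t) (x - e0) (t *\<^sub>R h) = t * ?L' (z x t) (x - e0) h" by (simp add: linear_scale)
      then show ?thesis using closed_of_vanishing_on_brackets[OF \<mu> zCh[OF that]] by simp
    qed
    ultimately show ?thesis unfolding D_def by simp
  qed
  have linD: "bounded_linear (D x t)" if "x \<in> ?B" "t \<in> {0..1}" for x t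
    using dF[OF that] has_derivative_bounded_linear by blast
  have cD: "continuous_on (?B \<times> {0..1}) (\<lambda>(x, t). D x t k)" for k
  proof -
    have "continuous_on (?B \<times> {0..1}) (\<lambda>p. ?L (z (fst p) (snd p)) k)"
      by (rule continuous_on_compose2[OF cL]) (use zCh in \<open>auto simp: z_def intro!: continuous_intros\<close>)
    moreover have "continuous_on (?B \<times> {0..1}) (\<lambda>p. ?L' (z (fst p) (snd p)) k (fst p - e0))"
    proof -
      have "continuous_on (?B \<times> {0..1}) (\<lambda>p. \<Sum>b\<in>Basis. ((fst p - e0) \<bullet> b) *\<^sub>R ?L' (z (fst p) (snd p)) k b)"
      proof (intro continuous_on_sum continuous_on_scaleR)
        fix b :: 'e
        show "continuous_on (?B \<times> {0..1}) (\<lambda>p. ?L' (z (fst p) (snd p)) k b)"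
          by (rule continuous_on_compose2[OF cL'[of k b]]) (use zCh in \<open>auto simp: z_def intro!: continuous_intros\<close>)
      qed (intro continuous_intros)
      moreover have "(\<Sum>b\<in>Basis. ((fst p - e0) \<bullet> b) *\<^sub>R ?L' (z (fst p) (snd p)) k b) = ?L' (z (fst p) (snd p)) k (fst p - e0)"
        if "p \<in> ?B \<times> {0..1}" for p
      proof -
        have "z (fst p) (snd p) \<in> Ch" using that zCh by auto
        then have "linear (?L' (z (fst p) (snd p)) k)" using L' has_derivative_linear by blast
        then show ?thesis by (rule linear_eq_sum_Basis[symmetric])
      qed
      ultimately show ?thesis by (simp cong: continuous_on_cong)
    qed
    ultimately show ?thesis unfolding D_def case_prod_beta by (intro continuous_intros) auto
  qed
  define f where "f x = integral (cbox 0 1) (\<lambda>t. ?L (z x t) (x - e0))" for x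
  have "(f has_derivative ?L x) (at x)" if x: "x \<in> ?B" for x
  proof -
    have "(f has_derivative integral (cbox 0 1) (\<lambda>t. Blinfun (D x t))) (at x within ?B)"
      unfolding f_def
    proof (rule leibniz_rule)
      fix y t assume y: "y \<in> ?B" "t \<in> cbox (0::real) 1"
      then show "((\<lambda>x. ?L (z x t) (x - e0)) has_derivative blinfun_apply (Blinfun (D y t))) (at y within ?B)"
        using dF[of y t] linD[of y t] by (simp add: bounded_linear_Blinfun_apply has_derivative_at_withinI)
    next
      fix y assume y: "y \<in> ?B"
      have "continuous_on {0..1} (\<lambda>t. ?L (z y t) (y - e0))"
        by (rule continuous_on_compose2[OF cL]) (use zCh[OF y] in \<open>auto simp: z_def intro!: continuous_intros\<close>)
      then show "(\<lambda>t. ?L (z y t) (y - e0)) integrable_on cbox 0 1"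
        by (intro integrable_continuous) simp
    next
      show "continuous_on (?B \<times> cbox 0 1) (\<lambda>(x, t). Blinfun (D x t))"
      proof (rule continuous_on_blinfun_componentwise)
        fix k :: 'e
        show "continuous_on (?B \<times> cbox 0 1) (\<lambda>p. blinfun_apply (case p of (x, t) \<Rightarrow> Blinfun (D x t)) k)"
          by (rule continuous_on_eq[OF cD[of k, folded box_real(2)]])
             (auto simp: bounded_linear_Blinfun_apply linD)
      qed
    qed (use x in auto)
    moreover have "blinfun_apply (integral (cbox 0 1) (\<lambda>t. Blinfun (D x t))) = ?L x"
    proof
      fix k
      have int: "(\<lambda>t. Blinfun (D x t)) integrable_on cbox 0 1"
      proof (rule integrable_continuous, rule continuous_on_blinfun_componentwise)
        fix k :: 'e
        have "continuous_on (cbox 0 1) (\<lambda>t. (case (x, t) of (x, t) \<Rightarrow> D x t k))"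
          by (rule continuous_on_compose2[OF cD[of k]]) (use x in \<open>auto intro!: continuous_intros\<close>)
        then show "continuous_on (cbox 0 1) (\<lambda>t. blinfun_apply (Blinfun (D x t)) k)"
          by (rule continuous_on_eq) (use x linD in \<open>auto simp: bounded_linear_Blinfun_apply\<close>)
      qed
      have "blinfun_apply (integral (cbox 0 1) (\<lambda>t. Blinfun (D x t))) k = integral (cbox 0 1) (\<lambda>t. blinfun_apply (Blinfun (D x t)) k)"
        by (rule blinfun_apply_integral[OF int])
      also have "\<dots> = integral (cbox 0 1) (\<lambda>t. D x t k)"
        by (rule integral_cong) (use x linD in \<open>auto simp: bounded_linear_Blinfun_apply\<close>)
      also have "\<dots> = 1 * ?L (z x 1) k - 0 * ?L (z x 0) k"
      proof -
        have "((\<lambda>t. t * ?L (z x t) k) has_vector_derivative D x t k) (at t within {0..1})" if t: "t \<in> {0..1}" for t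
        proof -
          have "((\<lambda>t. ?L (z x t) k) has_vector_derivative ?L' (z x t) k (x - e0)) (at t)"
            unfolding z_def by (rule has_vector_derivative_along_line) (use L'[OF zCh[OF x t]] in \<open>simp add: z_def\<close>)
          then have "((\<lambda>t. ?L (z x t) k) has_vector_derivative ?L' (z x t) k (x - e0)) (at t within {0..1})"
            using has_vector_derivative_at_within by blast
          then show ?thesis unfolding D_def has_real_derivative_iff_has_vector_derivative[symmetric]
            by (auto intro!: derivative_eq_intros)
        qed
        then have "((\<lambda>t. D x t k) has_integral 1 * ?L (z x 1) k - 0 * ?L (z x 0) k) {0..1}"
          by (intro fundamental_theorem_of_calculus) auto
        then show ?thesis by (simp add: integral_unique)
      qed
      finally show "blinfun_apply (integral (cbox 0 1) (\<lambda>t. Blinfun (D x t))) k = ?L x k" by (simp add: z_def)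
    qed
    ultimately show ?thesis using at_within_open[OF x open_ball] by simp
  qed
  then show ?thesis by blast
qed

lemma lmult_ball:
  assumes "open U" "e0 \<in> U"
  obtains r where "r > 0" "ball e0 r \<subseteq> Ch"
    "\<And>x y. x \<in> ball e0 r \<Longrightarrow> y \<in> ball e0 r \<Longrightarrow> (x, y) \<in> lmult_dom \<and> lmult (x, y) \<in> U"
proof -
  have "open (lmult_dom \<inter> lmult -` U)"
    using C_k_on_imp_continuous_on[OF lmult_smooth(2)[of 0]] lmult_smooth(1) assms(1) by (rule continuous_open_preimage)
  moreover have "(e0, e0) \<in> lmult_dom \<inter> lmult -` U" using assms(2) by (simp add: lmult_e0)
  ultimately obtain T1 T2 where "open T1" "open T2" "(e0, e0) \<in> T1 \<times> T2" "T1 \<times> T2 \<subseteq> lmult_dom \<inter> lmult -` U"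
    by (rule open_prod_elim)
  then have T: "open T1" "open T2" "e0 \<in> T1" "e0 \<in> T2" "T1 \<times> T2 \<subseteq> lmult_dom \<inter> lmult -` U" by auto
  have "open (T1 \<inter> T2 \<inter> Ch)" "e0 \<in> T1 \<inter> T2 \<inter> Ch" using T open_Ch by auto
  then have "\<exists>r>0. ball e0 r \<subseteq> T1 \<inter> T2 \<inter> Ch" using open_contains_ball by blast
  then obtain r where r: "r > 0" "ball e0 r \<subseteq> T1 \<inter> T2 \<inter> Ch" by blast
  show thesis
  proof (rule that[OF r(1)])
    fix x y assume "x \<in> ball e0 r" "y \<in> ball e0 r"
    then have "(x, y) \<in> T1 \<times> T2" using r(2) by blast
    then show "(x, y) \<in> lmult_dom \<and> lmult (x, y) \<in> U" using T(5) by blast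
  qed (use r(2) in blast)
qed

text \<open>The primitive of a left-invariant form is additive: for fixed \<open>x\<close> the functions \<open>f (x y)\<close> and \<open>f y\<close> of \<open>y\<close> have the
same derivative, so their difference is constant and can be evaluated at the identity.\<close>

theorem local_homomorphism:
  assumes \<mu>: "linear \<mu>" "\<And>v w. \<mu> (br v w) = (0::real)"
  obtains f r where "r > 0" "ball e0 r \<subseteq> Ch" "continuous_on (ball e0 r) f" "(f has_derivative \<mu>) (at e0)"
    "\<And>x y. x \<in> ball e0 r \<Longrightarrow> y \<in> ball e0 r \<Longrightarrow> (x, y) \<in> lmult_dom \<and> f (lmult (x, y)) = f x + f y"
proof -
  obtain R where R: "R > 0" "ball e0 R \<subseteq> Ch" using open_Ch e0_in open_contains_ball by blast
  obtain g where g: "\<And>x. x \<in> ball e0 R \<Longrightarrow> (g has_derivative (\<lambda>k. \<mu> (MC x k))) (at x)"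
    using local_primitive[OF \<mu> R(2)] by blast
  obtain r where r: "r > 0" "ball e0 r \<subseteq> Ch"
    "\<And>x y. x \<in> ball e0 r \<Longrightarrow> y \<in> ball e0 r \<Longrightarrow> (x, y) \<in> lmult_dom \<and> lmult (x, y) \<in> ball e0 R"
    by (rule lmult_ball[of "ball e0 R"]) (use R(1) in auto)
  have rR: "x \<in> ball e0 R" if "x \<in> ball e0 r" for x
    using r(3)[of x e0] r(1) that r(2) lmult_e0[of x] by auto
  define f where "f x = g x - g e0" for x
  have df: "(f has_derivative (\<lambda>k. \<mu> (MC x k))) (at x)" if "x \<in> ball e0 R" for x
    unfolding f_def using has_derivative_diff[OF g[OF that] has_derivative_const[of "g e0"]] by simp
  have hom: "f (lmult (x, y)) = f x + f y" if x: "x \<in> ball e0 r" and y: "y \<in> ball e0 r" for x y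
  proof -
    have "((\<lambda>y. f (lmult (x, y)) - f y) has_derivative (\<lambda>h. 0)) (at y)" if y: "y \<in> ball e0 r" for y
    proof -
      have xy: "(x, y) \<in> lmult_dom" "lmult (x, y) \<in> ball e0 R" using r(3) x y by auto
      then have z: "lmult (x, y) \<in> Ch" and yC: "y \<in> Ch" using R(2) r(2) y by auto
      have "((\<lambda>y. f (lmult (x, y)) - f y) has_derivative
          (\<lambda>h. \<mu> (MC (lmult (x, y)) (frechet_derivative lmult (at (x, y)) (0, h))) - \<mu> (MC y h))) (at y)"
        by (intro has_derivative_diff df rR[OF y] has_derivative_compose[OF left_mult_has_derivative[OF xy(1)], of f] xy(2))
      moreover have "\<mu> (MC (lmult (x, y)) (frechet_derivative lmult (at (x, y)) (0, h))) - \<mu> (MC y h) = 0" for h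
      proof -
        obtain v where v: "X v y = h" using X_surj[OF yC] by blast
        show ?thesis unfolding v[symmetric] X_left_invariant[OF xy(1)] MC_X[OF z] MC_X[OF yC] by simp
      qed
      ultimately show ?thesis by simp
    qed
    then obtain k where "\<And>y. y \<in> ball e0 r \<Longrightarrow> f (lmult (x, y)) - f y = k"
      using has_derivative_zero_constant[of "ball e0 r" "\<lambda>y. f (lmult (x, y)) - f y"] has_derivative_at_withinI by blast
    from this[of y] this[of e0] show ?thesis using y r(1) x r(2) lmult_e0[of x] by (auto simp: f_def)
  qed
  show thesis
  proof (rule that[OF r(1,2)])
    show "continuous_on (ball e0 r) f"
      using df rR by (meson continuous_at_imp_continuous_on has_derivative_continuous)
    show "(f has_derivative \<mu>) (at e0)" using df[of e0] R(1) by (simp add: MC_e0)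
  qed (use r(3) hom in auto)
qed

end

section \<open>Extension of local homomorphisms\<close>

text \<open>The values that a function \<open>F\<close> given only on \<open>W\<close> assigns to the products of elements of \<open>W\<close>. The extension of
\<open>F\<close> to a homomorphism amounts to the independence of the value from the chosen product.\<close>

inductive word_sum :: "'g monoid \<Rightarrow> 'g set \<Rightarrow> ('g \<Rightarrow> real) \<Rightarrow> 'g \<Rightarrow> real \<Rightarrow> bool" for G W F where
  empty: "word_sum G W F \<one>\<^bsub>G\<^esub> 0"
| snoc: "word_sum G W F g a \<Longrightarrow> u \<in> W \<Longrightarrow> word_sum G W F (g \<otimes>\<^bsub>G\<^esub> u) (a + F u)"

text \<open>A discrete line integral along \<open>\<gamma>\<close> of the left-invariant form with local primitive \<open>F\<close>.\<close>

definition path_sum :: "'g monoid \<Rightarrow> ('g \<Rightarrow> real) \<Rightarrow> (real \<Rightarrow> 'g) \<Rightarrow> nat \<Rightarrow> real" where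
  "path_sum G F \<gamma> n = (\<Sum>i<n. F (inv\<^bsub>G\<^esub> (\<gamma> (real i / real n)) \<otimes>\<^bsub>G\<^esub> \<gamma> (real (Suc i) / real n)))"

lemma sum_lessThan_add: "(\<Sum>i<n + k. h i) = (\<Sum>i<n. h i) + (\<Sum>i<k. h (n + i))" for h :: "nat \<Rightarrow> real"
  by (induction k) (simp_all add: add.assoc)

lemma path_sum_join:
  assumes "pathfinish \<gamma>1 = pathstart \<gamma>2"
  shows "path_sum G F (\<gamma>1 +++ \<gamma>2) (2 * n) = path_sum G F \<gamma>1 n + path_sum G F \<gamma>2 n"
proof (cases "n = 0")
  case True then show ?thesis by (simp add: path_sum_def)
next
  case False
  let ?\<gamma> = "\<gamma>1 +++ \<gamma>2"
  have left: "?\<gamma> (real i / real (2 * n)) = \<gamma>1 (real i / real n)" if "i \<le> n" for i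
  proof -
    have eq: "2 * (real i / real (2 * n)) = real i / real n"
      using False by (simp add: field_simps)
    have "real i / real n \<le> 1" using that False by simp
    with eq have "real i / real (2 * n) \<le> 1 / 2" by linarith
    note this eq
    then show ?thesis unfolding joinpaths_def by simp
  qed
  have right: "?\<gamma> (real (n + i) / real (2 * n)) = \<gamma>2 (real i / real n)" for i
  proof (cases "i = 0")
    case True
    then show ?thesis using left[of n] assms False by (simp add: pathfinish_def pathstart_def)
  next
    case i: False
    have eq: "2 * (real (n + i) / real (2 * n)) - 1 = real i / real n"
      using False by (simp add: field_simps)
    have "real i / real n > 0" using i False by simp
    with eq have "\<not> real (n + i) / real (2 * n) \<le> 1 / 2" by linarith
    note this eq
    then show ?thesis unfolding joinpaths_def by simp
  qed
  let ?f = "\<lambda>i. F (inv\<^bsub>G\<^esub> (?\<gamma> (real i / real (2 * n))) \<otimes>\<^bsub>G\<^esub> ?\<gamma> (real (Suc i) / real (2 * n)))"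
  have "{..<2 * n} = {..<n + n}" by (simp add: mult_2)
  then have "path_sum G F ?\<gamma> (2 * n) = (\<Sum>i<n + n. ?f i)" by (simp only: path_sum_def)
  also have "\<dots> = (\<Sum>i<n. ?f i) + (\<Sum>i<n. ?f (n + i))" by (rule sum_lessThan_add)
  also have "(\<Sum>i<n. ?f i) = path_sum G F \<gamma>1 n"
    unfolding path_sum_def
  proof (rule sum.cong)
    fix i assume "i \<in> {..<n}"
    then show "?f i = F (inv\<^bsub>G\<^esub> \<gamma>1 (real i / real n) \<otimes>\<^bsub>G\<^esub> \<gamma>1 (real (Suc i) / real n))"
      using left[of i] left[of "Suc i"] by (simp only: lessThan_iff less_imp_le Suc_le_eq)
  qed simp
  also have "(\<Sum>i<n. ?f (n + i)) = path_sum G F \<gamma>2 n"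
    unfolding path_sum_def
  proof (rule sum.cong)
    fix i
    show "?f (n + i) = F (inv\<^bsub>G\<^esub> \<gamma>2 (real i / real n) \<otimes>\<^bsub>G\<^esub> \<gamma>2 (real (Suc i) / real n))"
      using right[of i] right[of "Suc i"] by (simp only: add_Suc_right)
  qed simp
  finally show ?thesis .
qed

context lie_chart
begin

lemma cancel_simps: "inv a \<otimes> (a \<otimes> b) = b" "a \<otimes> (inv a \<otimes> b) = b"
  by (simp_all add: m_assoc[symmetric])

text \<open>Uniform continuity with respect to the left translates of a neighbourhood of the identity.\<close>

lemma small_increments:
  fixes h :: "'b::metric_space \<Rightarrow> 'g"
  assumes K: "compact K" and h: "continuous_on K h" and W: "open W" "\<one> \<in> W"
  obtains \<delta> where "\<delta> > 0" "\<And>z z'. z \<in> K \<Longrightarrow> z' \<in> K \<Longrightarrow> dist z z' < \<delta> \<Longrightarrow> inv (h z) \<otimes> h z' \<in> W"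
proof -
  let ?\<Phi> = "\<lambda>p. inv (h (fst p)) \<otimes> h (snd p)"
  let ?C = "K \<times> K \<inter> ?\<Phi> -` (- W)"
  have "continuous_on (K \<times> K) ?\<Phi>"
    by (intro continuous_mult continuous_inv continuous_on_compose2[OF h]) (auto intro!: continuous_intros)
  then have "closedin (top_of_set (K \<times> K)) ?C"
    using W(1) by (intro continuous_closedin_preimage) auto
  then have C: "compact ?C" using closedin_compact[of "K \<times> K"] compact_Times[OF K K] by blast
  show thesis
  proof (cases "?C = {}")
    case True
    then show ?thesis by (intro that[of 1]) auto
  next
    case False
    have "continuous_on ?C (\<lambda>p. dist (fst p) (snd p))" by (intro continuous_intros)
    then obtain p where p: "p \<in> ?C" "\<And>q. q \<in> ?C \<Longrightarrow> dist (fst p) (snd p) \<le> dist (fst q) (snd q)"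
      using continuous_attains_inf[OF C False] by blast
    have "fst p \<noteq> snd p" using p(1) W(2) by (auto simp: l_inv)
    moreover have "inv (h z) \<otimes> h z' \<in> W" if "z \<in> K" "z' \<in> K" "dist z z' < dist (fst p) (snd p)" for z z'
      using p(2)[of "(z, z')"] that by fastforce
    ultimately show ?thesis using that[of "dist (fst p) (snd p)"] by simp
  qed
qed

lemma eventually_close: "\<delta> > 0 \<Longrightarrow> \<forall>\<^sub>F n in sequentially. n > 0 \<and> 1 / real n < \<delta>"
proof -
  assume "\<delta> > 0"
  have "(\<lambda>n. 1 / real n) \<longlonglongrightarrow> 0" by (rule lim_1_over_n)
  from order_tendstoD(2)[OF this \<open>\<delta> > 0\<close>] show ?thesis
    by (intro eventually_conj eventually_gt_at_top)
qed

lemma dist_grid: "dist (real i / real n) (real (Suc i) / real n) = 1 / real n"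
  by (simp add: dist_real_def add_divide_distrib)

end

text \<open>A homomorphism to the additive reals that is defined near the identity: in the chart it is \<open>f\<close>, on the group
\<open>F\<close>, with domain \<open>W\<close>.\<close>

locale local_hom = lie_chart G A c
  for G :: "'g::{t2_space,second_countable_topology} monoid" (structure)
    and A :: "('g, 'e::euclidean_space) chart set" and c :: "('g, 'e) chart" +
  fixes f :: "'e \<Rightarrow> real" and r :: real
  assumes r_pos: "r > 0" and ball_Ch: "ball e0 r \<subseteq> Ch" and f_cont: "continuous_on (ball e0 r) f"
    and f_hom: "\<And>x y. x \<in> ball e0 r \<Longrightarrow> y \<in> ball e0 r \<Longrightarrow> (x, y) \<in> lmult_dom \<and> f (lmult (x, y)) = f x + f y"
begin

definition F :: "'g \<Rightarrow> real" where "F g = f (psi g)"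
definition W :: "'g set" where "W = par ` ball e0 r"

lemma F_hom: "g \<in> W \<Longrightarrow> h \<in> W \<Longrightarrow> F (g \<otimes> h) = F g + F h"
  using f_hom ball_Ch by (auto simp: W_def F_def lmult_def psi_par subset_iff)

lemma W_eq: "W = fst c \<inter> psi -` ball e0 r"
proof (intro subset_antisym subsetI)
  fix g assume "g \<in> fst c \<inter> psi -` ball e0 r"
  then have "g = par (psi g)" "psi g \<in> ball e0 r" by (auto simp: par_psi)
  then show "g \<in> W" unfolding W_def by (rule image_eqI)
next
  fix g assume "g \<in> W"
  then obtain x where "g = par x" "x \<in> ball e0 r" unfolding W_def by (rule imageE)
  then show "g \<in> fst c \<inter> psi -` ball e0 r" using ball_Ch par_in[of x] psi_par[of x] by auto
qed

lemma open_W: "open W"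
  unfolding W_eq by (intro continuous_open_preimage chart_facts[OF c_in] open_ball)

lemma one_W: "\<one> \<in> W" using r_pos by (auto simp: W_def intro!: image_eqI[of _ _ e0])

lemma F_one [simp]: "F \<one> = 0" using F_hom[OF one_W one_W] by simp

text \<open>A homotopy from the loop to a constant loop is cut into a grid so fine that \<open>F\<close> is additive around each square.
Then consecutive rows of the grid have equal sums, and the last row has sum zero.\<close>

lemma loop_path_sum_zero:
  assumes sc: "simply_connected (UNIV :: 'g set)" and \<gamma>: "path \<gamma>" "pathfinish \<gamma> = pathstart \<gamma>"
  shows "\<forall>\<^sub>F n in sequentially. path_sum G F \<gamma> n = 0"
proof -
  have "path (\<lambda>_. \<one>)" by (simp add: path_def)
  then have "homotopic_loops UNIV \<gamma> (\<lambda>_. \<one>)"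
    using sc \<gamma> unfolding simply_connected_def by (auto simp: pathfinish_def pathstart_def)
  then obtain h where h: "continuous_on ({0..1::real} \<times> {0..1}) h" "\<And>x. x \<in> {0..1} \<Longrightarrow> h (0, x) = \<gamma> x"
    "\<And>x. x \<in> {0..1} \<Longrightarrow> h (1, x) = \<one>" "\<And>t. t \<in> {0..1} \<Longrightarrow> h (t, 1) = h (t, 0)"
    unfolding homotopic_loops by (auto simp: pathfinish_def pathstart_def)
  have "compact ({0..1::real} \<times> {0..1::real})" by (intro compact_Times) auto
  then obtain \<delta> where \<delta>: "\<delta> > 0" "\<And>z z'. z \<in> {0..1} \<times> {0..1} \<Longrightarrow> z' \<in> {0..1} \<times> {0..1} \<Longrightarrow> dist z z' < \<delta>
      \<Longrightarrow> inv (h z) \<otimes> h z' \<in> W"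
    using small_increments[OF _ h(1) open_W one_W] by metis
  show ?thesis
    using eventually_close[OF \<delta>(1)]
  proof eventually_elim
    case (elim n)
    define H where "H j i = h (real j / real n, real i / real n)" for j i
    define row where "row j = (\<Sum>i<n. F (inv (H j i) \<otimes> H j (Suc i)))" for j
    define V where "V j i = F (inv (H j i) \<otimes> H (Suc j) i)" for j i
    have unit: "real i / real n \<in> {0..1}" if "i \<le> n" for i using that elim by (auto simp: field_simps)
    have right: "inv (H j i) \<otimes> H j (Suc i) \<in> W" if "j \<le> n" "i < n" for i j
      unfolding H_def using that elim unit
      by (intro \<delta>(2)) (auto simp: dist_Pair_Pair dist_grid simp del: of_nat_Suc)
    have down: "inv (H j i) \<otimes> H (Suc j) i \<in> W" if "j < n" "i \<le> n" for i j
      unfolding H_def using that elim unit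
      by (intro \<delta>(2)) (auto simp: dist_Pair_Pair dist_grid simp del: of_nat_Suc)
    have cancel: "(inv a \<otimes> b) \<otimes> (inv b \<otimes> d) = inv a \<otimes> d" for a b d
      by (simp add: m_assoc cancel_simps)
    (* The two ways around a square of the grid, right-down and down-right. *)
    have square: "F (inv (H j i) \<otimes> H j (Suc i)) + V j (Suc i) = V j i + F (inv (H (Suc j) i) \<otimes> H (Suc j) (Suc i))"
      if "j < n" "i < n" for i j
      unfolding V_def using that F_hom[OF right down, of j i j "Suc i"] F_hom[OF down right, of j i "Suc j" i]
      by (simp add: cancel)
    have "row j = row (Suc j)" if j: "j < n" for j
    proof -
      have "row j - row (Suc j) = (\<Sum>i<n. V j i - V j (Suc i))"
        unfolding row_def sum_subtractf[symmetric] using square[OF j] by (intro sum.cong) (auto simp: algebra_simps)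
      also have "\<dots> = V j 0 - V j n" by (rule sum_lessThan_telescope')
      also have "\<dots> = 0"
        using h(4)[OF unit[of j]] h(4)[OF unit[of "Suc j"]] j elim by (simp add: V_def H_def del: of_nat_Suc)
      finally show ?thesis by simp
    qed
    then have "row 0 = row j" if "j \<le> n" for j using that by (induction j) auto
    then have "row 0 = row n" by simp
    also have "row n = 0" unfolding row_def H_def using elim h(3)[OF unit] by (intro sum.neutral) (simp del: of_nat_Suc)
    also have "row 0 = path_sum G F \<gamma> n" unfolding row_def H_def path_sum_def using elim h(2)[OF unit]
      by (intro sum.cong) (auto simp del: of_nat_Suc)
    finally show ?case .
  qed
qed

text \<open>Along a segment in the chart the sum telescopes, because there \<open>F\<close> is additive on the whole segment.\<close>

lemma segment_path_sum:
  assumes u: "u \<in> W"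
  defines "q \<equiv> \<lambda>t. par (e0 + t *\<^sub>R (psi u - e0))"
  shows "path q" "q 0 = \<one>" "q 1 = u" "\<forall>\<^sub>F n in sequentially. path_sum G F (\<lambda>t. g \<otimes> q t) n = F u"
proof -
  have uC: "u \<in> fst c" "psi u \<in> ball e0 r" using u by (auto simp: W_eq)
  have inb: "e0 + t *\<^sub>R (psi u - e0) \<in> ball e0 r" if "t \<in> {0..1}" for t
  proof -
    have "norm (t *\<^sub>R (psi u - e0)) \<le> norm (psi u - e0)" using that by (simp add: mult_left_le_one_le)
    then show ?thesis using uC(2) by (auto simp: dist_norm norm_minus_commute)
  qed
  have cpar: "continuous_on Ch par" using chart_facts(4)[OF c_in] by (simp add: Ch_def)
  have cq: "continuous_on {0..1} q"
    unfolding q_def by (rule continuous_on_compose2[OF cpar]) (use inb ball_Ch in \<open>auto intro!: continuous_intros\<close>)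
  then show "path q" by (simp add: path_def)
  show q0: "q 0 = \<one>" and q1: "q 1 = u" using uC by (auto simp: q_def par_psi)
  have qW: "q t \<in> W" if "t \<in> {0..1}" for t using inb[OF that] by (auto simp: q_def W_def)
  obtain \<delta> where \<delta>: "\<delta> > 0" "\<And>z z'. z \<in> {0..1} \<Longrightarrow> z' \<in> {0..1} \<Longrightarrow> dist z z' < \<delta> \<Longrightarrow> inv (q z) \<otimes> q z' \<in> W"
    using small_increments[OF compact_Icc cq open_W one_W] by metis
  show "\<forall>\<^sub>F n in sequentially. path_sum G F (\<lambda>t. g \<otimes> q t) n = F u"
    using eventually_close[OF \<delta>(1)]
  proof eventually_elim
    case (elim n)
    have unit: "real i / real n \<in> {0..1}" if "i \<le> n" for i using that elim by (auto simp: field_simps)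
    have "F (inv (g \<otimes> q (real i / real n)) \<otimes> (g \<otimes> q (real (Suc i) / real n)))
        = F (q (real (Suc i) / real n)) - F (q (real i / real n))" if i: "i < n" for i
    proof -
      let ?a = "q (real i / real n)" and ?b = "q (real (Suc i) / real n)"
      have "inv ?a \<otimes> ?b \<in> W"
        using unit[of i] unit[of "Suc i"] i elim by (intro \<delta>(2)) (auto simp: dist_grid simp del: of_nat_Suc)
      moreover have "?a \<in> W" using qW[OF unit] i by simp
      ultimately have "F (?a \<otimes> (inv ?a \<otimes> ?b)) = F ?a + F (inv ?a \<otimes> ?b)" using F_hom by blast
      moreover have "?a \<otimes> (inv ?a \<otimes> ?b) = ?b" by (simp add: m_assoc[symmetric])
      moreover have "inv (g \<otimes> ?a) \<otimes> (g \<otimes> ?b) = inv ?a \<otimes> ?b"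
        by (simp add: inv_mult_group m_assoc cancel_simps)
      ultimately show ?thesis by simp
    qed
    then have "path_sum G F (\<lambda>t. g \<otimes> q t) n = (\<Sum>i<n. F (q (real (Suc i) / real n)) - F (q (real i / real n)))"
      unfolding path_sum_def by (intro sum.cong) auto
    also have "\<dots> = F (q (real n / real n)) - F (q (real 0 / real n))"
      by (rule sum_lessThan_telescope)
    also have "\<dots> = F u" using elim q0 q1 by simp
    finally show ?case .
  qed
qed

text \<open>A word is realised by a path that joins chart segments. The partitions have \<open>2 ^ k\<close> parts because joining two
paths doubles the number of parts.\<close>

lemma word_sum_path:
  assumes "word_sum G W F g a"
  shows "\<exists>\<gamma>. path \<gamma> \<and> pathstart \<gamma> = \<one> \<and> pathfinish \<gamma> = g \<and> (\<forall>\<^sub>F k in sequentially. path_sum G F \<gamma> (2 ^ k) = a)"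
  using assms
proof induction
  case empty
  then show ?case by (intro exI[of _ "\<lambda>_. \<one>"]) (auto simp: path_def pathstart_def pathfinish_def path_sum_def)
next
  case (snoc g a u)
  then obtain \<gamma> where \<gamma>: "path \<gamma>" "pathstart \<gamma> = \<one>" "pathfinish \<gamma> = g" "\<forall>\<^sub>F k in sequentially. path_sum G F \<gamma> (2 ^ k) = a"
    by blast
  define q where "q t = par (e0 + t *\<^sub>R (psi u - e0))" for t
  note q = segment_path_sum[OF snoc.hyps(2), folded q_def]
  let ?p = "\<lambda>t. g \<otimes> q t"
  have p: "path ?p" "pathstart ?p = g" "pathfinish ?p = g \<otimes> u"
    using q(1,2,3) by (auto simp: path_def pathstart_def pathfinish_def intro!: continuous_mult)
  have "filterlim (\<lambda>k. 2 ^ k :: nat) sequentially sequentially"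
    by (rule filterlim_subseq) (simp add: strict_mono_def)
  then have "\<forall>\<^sub>F k in sequentially. path_sum G F ?p (2 ^ k) = F u"
    using q(4)[of g] filterlim_iff by fast
  with \<gamma>(4) have "\<forall>\<^sub>F k in sequentially. path_sum G F (\<gamma> +++ ?p) (2 ^ Suc k) = a + F u"
    by eventually_elim (use path_sum_join[of \<gamma> ?p G F] \<gamma>(3) p(2) in simp)
  then have "\<forall>\<^sub>F k in sequentially. path_sum G F (\<gamma> +++ ?p) (2 ^ k) = a + F u"
    by (subst (asm) eventually_sequentially_Suc)
  then show ?case using \<gamma> p by (intro exI[of _ "\<gamma> +++ ?p"]) auto
qed

lemma word_sum_one:
  assumes sc: "simply_connected (UNIV :: 'g set)" and w: "word_sum G W F \<one> a"
  shows "a = 0"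
proof -
  obtain \<gamma> where \<gamma>: "path \<gamma>" "pathstart \<gamma> = \<one>" "pathfinish \<gamma> = \<one>" "\<forall>\<^sub>F k in sequentially. path_sum G F \<gamma> (2 ^ k) = a"
    using word_sum_path[OF w] by blast
  have "filterlim (\<lambda>k. 2 ^ k :: nat) sequentially sequentially"
    by (rule filterlim_subseq) (simp add: strict_mono_def)
  then have "\<forall>\<^sub>F k in sequentially. path_sum G F \<gamma> (2 ^ k) = 0"
    using loop_path_sum_zero[OF sc \<gamma>(1)] \<gamma>(2,3) filterlim_iff by fastforce
  with \<gamma>(4) have "\<forall>\<^sub>F k in sequentially. a = 0" by eventually_elim simp
  then show ?thesis by simp
qed

text \<open>A path from the identity to \<open>g\<close> is cut into increments that lie in \<open>W\<close>.\<close>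

lemma word_sum_exists:
  assumes sc: "simply_connected (UNIV :: 'g set)"
  shows "\<exists>a. word_sum G W F g a"
proof -
  have "homotopic_loops UNIV (\<lambda>_. \<one>) (\<lambda>_. g)"
    using sc unfolding simply_connected_def by (auto simp: path_def pathfinish_def pathstart_def)
  then obtain h where h: "continuous_on ({0..1::real} \<times> {0..1::real}) h" "\<And>x. x \<in> {0..1} \<Longrightarrow> h (0, x) = \<one>"
    "\<And>x. x \<in> {0..1} \<Longrightarrow> h (1, x) = g"
    unfolding homotopic_loops by auto
  define p where "p t = h (t, 0)" for t
  have p: "continuous_on {0..1} p" "p 0 = \<one>" "p 1 = g"
    using h(2)[of 0] h(3)[of 0] unfolding p_def
    by (auto intro!: continuous_on_compose2[OF h(1)] continuous_intros)
  obtain \<delta> where \<delta>: "\<delta> > 0" "\<And>z z'. z \<in> {0..1} \<Longrightarrow> z' \<in> {0..1} \<Longrightarrow> dist z z' < \<delta> \<Longrightarrow> inv (p z) \<otimes> p z' \<in> W"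
    using small_increments[OF compact_Icc p(1) open_W one_W] by metis
  obtain n where n: "n > 0" "1 / real n < \<delta>"
    using eventually_happens[OF eventually_close[OF \<delta>(1)]] by auto
  have "i \<le> n \<Longrightarrow> \<exists>a. word_sum G W F (p (real i / real n)) a" for i
  proof (induction i)
    case 0
    then show ?case using p(2) word_sum.empty[of G W F] by auto
  next
    case (Suc i)
    let ?a = "p (real i / real n)" and ?b = "p (real (Suc i) / real n)"
    have unit: "real i / real n \<in> {0..1}" if "i \<le> n" for i using that n by (auto simp: field_simps)
    have "inv ?a \<otimes> ?b \<in> W"
      using unit[of i] unit[of "Suc i"] Suc.prems n by (intro \<delta>(2)) (auto simp: dist_grid simp del: of_nat_Suc)
    moreover have "?a \<otimes> (inv ?a \<otimes> ?b) = ?b" by (simp add: m_assoc[symmetric])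
    ultimately show ?case using Suc word_sum.snoc[of G W F ?a _ "inv ?a \<otimes> ?b"] by fastforce
  qed
  from this[of n] show ?thesis using n p(3) by simp
qed

lemma word_sum_mult:
  assumes "word_sum G W F h b" "word_sum G W F g a"
  shows "word_sum G W F (g \<otimes> h) (a + b)"
  using assms
proof (induction arbitrary: rule: word_sum.induct)
  case (snoc h b u)
  then show ?case using word_sum.snoc[of G W F "g \<otimes> h" "a + b" u] by (simp add: m_assoc add.assoc)
qed simp

text \<open>Monodromy: the value of a word depends only on the product, since a word for the identity gives a loop, on which the
path sums vanish.\<close>

theorem global_homomorphism:
  assumes sc: "simply_connected (UNIV :: 'g set)"
  obtains \<pi> where "\<And>g h. \<pi> (g \<otimes> h) = \<pi> g + \<pi> h" "\<And>g. g \<in> W \<Longrightarrow> \<pi> g = f (psi g)" "continuous_on UNIV \<pi>"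
proof -
  have unique: "a = a'" if "word_sum G W F g a" "word_sum G W F g a'" for g a a'
  proof -
    obtain b where b: "word_sum G W F (inv g) b" using word_sum_exists[OF sc] by blast
    have "a + b = 0" "a' + b = 0"
      using word_sum_one[OF sc] word_sum_mult[OF b that(1)] word_sum_mult[OF b that(2)] by auto
    then show ?thesis by simp
  qed
  obtain \<pi> where \<pi>: "\<And>g. word_sum G W F g (\<pi> g)" using word_sum_exists[OF sc] by metis
  have hom: "\<pi> (g \<otimes> h) = \<pi> g + \<pi> h" for g h
    using unique[OF \<pi> word_sum_mult[OF \<pi> \<pi>]] .
  have loc: "\<pi> g = F g" if "g \<in> W" for g
    using unique[OF \<pi>[of g]] word_sum.snoc[OF word_sum.empty[of G W F] that] by simp
  have "isCont \<pi> g" for g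
  proof -
    let ?N = "(\<lambda>h. inv g \<otimes> h) -` W"
    have "continuous_on UNIV (\<lambda>h. inv g \<otimes> h)" by (intro continuous_mult continuous_intros)
    then have N: "open ?N" "g \<in> ?N" using open_vimage[OF open_W] one_W by auto
    have "continuous_on ?N (\<lambda>h. \<pi> g + f (psi (inv g \<otimes> h)))"
    proof (intro continuous_on_add continuous_on_const continuous_on_compose2[OF f_cont])
      show "continuous_on ?N (\<lambda>h. psi (inv g \<otimes> h))"
        by (rule continuous_on_compose2[OF chart_facts(3)[OF c_in]])
           (auto simp: W_eq intro!: continuous_mult continuous_intros)
    qed (auto simp: W_eq)
    moreover have "\<pi> g + f (psi (inv g \<otimes> h)) = \<pi> h" if "h \<in> ?N" for h
    proof -
      have "\<pi> (g \<otimes> (inv g \<otimes> h)) = \<pi> g + \<pi> (inv g \<otimes> h)" by (rule hom)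
      moreover have "g \<otimes> (inv g \<otimes> h) = h" by (simp add: m_assoc[symmetric])
      ultimately show ?thesis using loc that by (simp add: F_def)
    qed
    ultimately have "continuous_on ?N \<pi>" by (rule continuous_on_eq)
    then show ?thesis using N by (simp add: continuous_on_eq_continuous_at)
  qed
  then show thesis using that[of \<pi>] hom loc by (simp add: F_def continuous_at_imp_continuous_on)
qed

end

section \<open>Integral curves\<close>

text \<open>Picard iteration on the space of bounded continuous functions on the line. Clamping the time to \<open>[-T, T]\<close> keeps
the iterates bounded.\<close>

lemma picard_global_lipschitz:
  fixes g :: "'e::euclidean_space \<Rightarrow> 'e"
  assumes K: "K > 0" and lip: "\<And>x y. norm (g x - g y) \<le> K * norm (x - y)"
  obtains u T where "T > 0" "u 0 = a" "\<And>t. \<bar>t\<bar> < T \<Longrightarrow> (u has_vector_derivative g (u t)) (at t)"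
proof -
  (* The two integrals of the difference run over at most 3 T in total, so the contraction constant is
     3 T K = 1/2. *)
  define T where "T = 1 / (6 * K)"
  have T: "T > 0" using K by (simp add: T_def)
  define cl where "cl t = max (- T) (min T t)" for t
  have cl: "cl t \<in> {- T..T}" for t using T by (auto simp: cl_def)
  have cg: "continuous_on UNIV g"
    using lip K by (intro lipschitz_on_continuous_on[of K]) (auto simp: lipschitz_on_def dist_norm)
  define Op where "Op u t = a + integral {- T..cl t} (\<lambda>s. g (apply_bcontfun u s)) - integral {- T..0} (\<lambda>s. g (apply_bcontfun u s))" for u t
  have cu: "continuous_on S (\<lambda>s. g (apply_bcontfun u s))" for u and S :: "real set"
    by (rule continuous_on_compose2[OF cg]) (auto intro: continuous_on_subset[OF continuous_on_apply_bcontfun])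
  have int: "(\<lambda>s. g (apply_bcontfun u s)) integrable_on {x..y}" for u and x y :: real
    by (rule integrable_continuous_interval[OF cu])
  have cI: "continuous_on {- T..T} (\<lambda>t. integral {- T..t} (\<lambda>s. g (apply_bcontfun u s)))" for u
    by (rule indefinite_integral_continuous_1[OF int])
  have Op: "Op u \<in> bcontfun" for u
  proof -
    have ccl: "continuous_on UNIV cl" unfolding cl_def by (intro continuous_intros)
    have "continuous_on UNIV (Op u)" unfolding Op_def
      by (intro continuous_intros continuous_on_compose2[OF cI ccl]) (use cl in auto)
    moreover have "bounded (range (Op u))"
    proof -
      have "compact ((\<lambda>t. integral {- T..t} (\<lambda>s. g (apply_bcontfun u s))) ` {- T..T})"
        by (intro compact_continuous_image cI) simp
      then have "bounded ((\<lambda>t. integral {- T..t} (\<lambda>s. g (apply_bcontfun u s))) ` {- T..T})"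
        by (rule compact_imp_bounded)
      then have "\<exists>M. \<forall>t\<in>{- T..T}. norm (integral {- T..t} (\<lambda>s. g (apply_bcontfun u s))) \<le> M"
        by (simp add: bounded_iff)
      then obtain M where M: "\<And>t. t \<in> {- T..T} \<Longrightarrow> norm (integral {- T..t} (\<lambda>s. g (apply_bcontfun u s))) \<le> M"
        by blast
      have "norm (Op u t) \<le> norm a + M + norm (integral {- T..0} (\<lambda>s. g (apply_bcontfun u s)))" for t
        unfolding Op_def using M[OF cl[of t]]
          norm_triangle_ineq4[of "a + integral {- T..cl t} (\<lambda>s. g (apply_bcontfun u s))" "integral {- T..0} (\<lambda>s. g (apply_bcontfun u s))"]
          norm_triangle_ineq[of a "integral {- T..cl t} (\<lambda>s. g (apply_bcontfun u s))"] by linarith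
      then show ?thesis by (auto simp: bounded_iff)
    qed
    ultimately show ?thesis by (simp add: bcontfun_def)
  qed
  define OP where "OP u = Bcontfun (Op u)" for u
  have OP: "apply_bcontfun (OP u) = Op u" for u unfolding OP_def by (rule Bcontfun_inverse[OF Op])
  have "dist (OP u) (OP v) \<le> 1 / 2 * dist u v" for u v
  proof (rule dist_bound)
    fix t
    let ?d = "\<lambda>s. g (apply_bcontfun u s) - g (apply_bcontfun v s)"
    have d: "norm (?d s) \<le> K * dist u v" for s
    proof -
      have "norm (?d s) \<le> K * norm (apply_bcontfun u s - apply_bcontfun v s)" by (rule lip)
      also have "\<dots> \<le> K * dist u v" using K dist_bounded[of u s v] by (simp add: dist_norm)
      finally show ?thesis .
    qed
    have cd: "continuous_on S ?d" for S by (intro continuous_on_diff cu)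
    have "Op u t - Op v t = integral {- T..cl t} ?d - integral {- T..0} ?d"
      unfolding Op_def by (simp add: integral_diff int)
    then have "norm (Op u t - Op v t) \<le> norm (integral {- T..cl t} ?d) + norm (integral {- T..0} ?d)"
      using norm_triangle_ineq4 by metis
    moreover have "norm (integral {- T..cl t} ?d) \<le> K * dist u v * (cl t - - T)"
      by (rule integral_bound) (use cl[of t] cd d in auto)
    moreover have "norm (integral {- T..0} ?d) \<le> K * dist u v * (0 - - T)"
      by (rule integral_bound) (use T cd d in auto)
    moreover have "K * dist u v * (cl t - - T) \<le> K * dist u v * (2 * T)"
      using cl[of t] K by (intro mult_left_mono) auto
    ultimately have "norm (Op u t - Op v t) \<le> K * dist u v * (3 * T)" by (simp add: algebra_simps)
    also have "\<dots> = 1 / 2 * dist u v" using K by (simp add: T_def field_simps)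
    finally show "dist (apply_bcontfun (OP u) t) (apply_bcontfun (OP v) t) \<le> 1 / 2 * dist u v"
      by (simp add: OP dist_norm)
  qed
  then have "\<exists>!u. OP u = u" by (intro banach_fix_type[of "1 / 2"]) auto
  then obtain u where u: "OP u = u" by blast
  then have "apply_bcontfun u = Op u" using OP by metis
  then have u': "apply_bcontfun u t = a + integral {- T..cl t} (\<lambda>s. g (apply_bcontfun u s)) - integral {- T..0} (\<lambda>s. g (apply_bcontfun u s))" for t
    by (metis Op_def)
  show thesis
  proof (rule that[OF T])
    show "apply_bcontfun u 0 = a" using u'[of 0] T by (simp add: cl_def)
    fix t assume t: "\<bar>t\<bar> < T"
    let ?h = "\<lambda>s. g (apply_bcontfun u s)"
    have "((\<lambda>t. integral {- T..t} ?h) has_vector_derivative ?h t) (at t within {- T..T})"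
      by (rule integral_has_vector_derivative[OF cu]) (use t in auto)
    moreover have "at t within {- T..T} = at t" using t by (intro at_within_interior) auto
    ultimately have "((\<lambda>t. a + integral {- T..t} ?h - integral {- T..0} ?h) has_vector_derivative ?h t) (at t)"
      by (auto intro!: derivative_eq_intros)
    then show "(apply_bcontfun u has_vector_derivative ?h t) (at t)"
    proof (rule has_vector_derivative_transform_within_open[of _ _ _ "{- T<..<T}"])
      show "a + integral {- T..s} ?h - integral {- T..0} ?h = apply_bcontfun u s" if "s \<in> {- T<..<T}" for s
        using u'[of s] that by (simp add: cl_def)
    qed (use t in auto)
  qed
qed

text \<open>The function \<open>exp (- 2 * K * t) * (norm (E t))\<^sup>2\<close> is nonincreasing and starts at zero.\<close>

lemma gronwall_zero_right:
  fixes E :: "real \<Rightarrow> 'e::euclidean_space"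
  assumes E: "\<And>t. 0 \<le> t \<Longrightarrow> t < T \<Longrightarrow> (E has_vector_derivative E' t) (at t)"
    and b: "\<And>t. 0 \<le> t \<Longrightarrow> t < T \<Longrightarrow> norm (E' t) \<le> K * norm (E t)" and E0: "E 0 = 0"
    and t: "0 \<le> t" "t < T"
  shows "E t = 0"
proof -
  let ?w = "\<lambda>s. exp (- 2 * K * s) * (E s \<bullet> E s)"
  have "\<exists>y. DERIV ?w s :> y \<and> y \<le> 0" if s: "0 \<le> s" "s \<le> t" for s
  proof -
    have dE: "(E has_vector_derivative E' s) (at s)" using E s t by simp
    have "((\<lambda>s. E s \<bullet> E s) has_vector_derivative 2 * (E s \<bullet> E' s)) (at s)"
    proof -
      have "((\<lambda>s. E s \<bullet> E s) has_derivative (\<lambda>h. E s \<bullet> (h *\<^sub>R E' s) + (h *\<^sub>R E' s) \<bullet> E s)) (at s)"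
        using dE unfolding has_vector_derivative_def by (intro has_derivative_inner)
      then show ?thesis unfolding has_vector_derivative_def
        by (rule has_derivative_eq_rhs) (auto simp: inner_commute algebra_simps)
    qed
    then have dd: "DERIV (\<lambda>s. E s \<bullet> E s) s :> 2 * (E s \<bullet> E' s)"
      by (simp add: has_real_derivative_iff_has_vector_derivative)
    have "DERIV ?w s :> exp (- 2 * K * s) * (- 2 * K) * (E s \<bullet> E s) + exp (- 2 * K * s) * (2 * (E s \<bullet> E' s))"
      by (auto intro!: derivative_eq_intros dd)
    moreover have "E s \<bullet> E' s \<le> K * (E s \<bullet> E s)"
    proof -
      have "E s \<bullet> E' s \<le> norm (E s) * norm (E' s)" by (rule norm_cauchy_schwarz)
      also have "\<dots> \<le> norm (E s) * (K * norm (E s))" using b[of s] s t by (intro mult_left_mono) auto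
      also have "\<dots> = K * (E s \<bullet> E s)" by (simp add: dot_square_norm power2_eq_square)
      finally show ?thesis .
    qed
    then have "exp (- 2 * K * s) * (2 * (E s \<bullet> E' s)) \<le> exp (- 2 * K * s) * (2 * (K * (E s \<bullet> E s)))"
      by (intro mult_left_mono) auto
    ultimately show ?thesis by (intro exI conjI) (assumption, simp add: algebra_simps)
  qed
  then have "?w t \<le> ?w 0" using DERIV_nonpos_imp_nonincreasing[of 0 t ?w] t by blast
  then have "exp (- 2 * K * t) * (E t \<bullet> E t) \<le> 0" by (simp add: E0)
  then have "E t \<bullet> E t \<le> 0" by (simp add: mult_le_0_iff)
  then show ?thesis by (metis inner_ge_zero inner_eq_zero_iff order_antisym)
qed

lemma gronwall_zero:
  fixes E :: "real \<Rightarrow> 'e::euclidean_space"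
  assumes E: "\<And>t. \<bar>t\<bar> < T \<Longrightarrow> (E has_vector_derivative E' t) (at t)"
    and b: "\<And>t. \<bar>t\<bar> < T \<Longrightarrow> norm (E' t) \<le> K * norm (E t)" and E0: "E 0 = 0" and t: "\<bar>t\<bar> < T"
  shows "E t = 0"
proof (cases "t \<ge> 0")
  case True
  then show ?thesis using gronwall_zero_right[of T E E' K t] E b E0 t by auto
next
  case False
  have "((\<lambda>s. E (- s)) has_vector_derivative - E' (- s)) (at s)" if "0 \<le> s" "s < T" for s
    using has_vector_derivative_affine[of E "E' (- s)" "- 1" s 0] E[of "- s"] that by simp
  moreover have "norm (- E' (- s)) \<le> K * norm (E (- s))" if "0 \<le> s" "s < T" for s
    using b[of "- s"] that by simp
  ultimately have "E (- (- t)) = 0"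
    using gronwall_zero_right[of T "\<lambda>s. E (- s)" "\<lambda>s. - E' (- s)" K "- t"] E0 t False by simp
  then show ?thesis by simp
qed

lemma C1_bounded_on_cball:
  fixes f :: "'e::euclidean_space \<Rightarrow> 'b::real_normed_vector"
  assumes f: "C_k_on (Suc 0) S f" and S: "open S" "cball a \<rho> \<subseteq> S"
  obtains K where "K > 0" "\<And>x h. x \<in> cball a \<rho> \<Longrightarrow> norm (frechet_derivative f (at x) h) \<le> K * norm h"
    "\<And>x y. x \<in> cball a \<rho> \<Longrightarrow> y \<in> cball a \<rho> \<Longrightarrow> norm (f x - f y) \<le> K * norm (x - y)"
proof -
  let ?D = "\<lambda>x. frechet_derivative f (at x)"
  note d = C_k_on_derivative[OF f S(1)]
  have "\<exists>M. \<forall>x\<in>cball a \<rho>. norm (?D x b) \<le> M" for b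
  proof -
    have "continuous_on (cball a \<rho>) (\<lambda>x. ?D x b)" using d(2)[of b] S(2) continuous_on_subset by auto
    then have "bounded ((\<lambda>x. ?D x b) ` cball a \<rho>)" by (intro compact_imp_bounded compact_continuous_image) auto
    then show ?thesis by (auto simp: bounded_iff)
  qed
  then obtain M where M: "\<And>b x. x \<in> cball a \<rho> \<Longrightarrow> norm (?D x b) \<le> M b" by metis
  define K where "K = (\<Sum>b\<in>Basis. \<bar>M b\<bar>) + 1"
  have K: "K > 0" unfolding K_def by (simp add: add_nonneg_pos sum_nonneg)
  have bound: "norm (?D x h) \<le> K * norm h" if x: "x \<in> cball a \<rho>" for x h
  proof -
    have "linear (?D x)" using d(1) x S(2) has_derivative_linear by blast
    then have "norm (?D x h) = norm (\<Sum>b\<in>Basis. (h \<bullet> b) *\<^sub>R ?D x b)" using linear_eq_sum_Basis by metis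
    also have "\<dots> \<le> (\<Sum>b\<in>Basis. norm h * \<bar>M b\<bar>)"
    proof (rule sum_norm_le)
      fix b :: 'e assume "b \<in> Basis"
      then have "\<bar>h \<bullet> b\<bar> \<le> norm h" by (rule Basis_le_norm)
      moreover have "norm (?D x b) \<le> \<bar>M b\<bar>" using M[OF x, of b] by simp
      ultimately show "norm ((h \<bullet> b) *\<^sub>R ?D x b) \<le> norm h * \<bar>M b\<bar>" by (simp add: mult_mono)
    qed
    also have "\<dots> \<le> K * norm h" unfolding K_def by (simp add: sum_distrib_left[symmetric] algebra_simps)
    finally show ?thesis .
  qed
  have "norm (f x - f y) \<le> K * norm (x - y)" if "x \<in> cball a \<rho>" "y \<in> cball a \<rho>" for x y
  proof (rule differentiable_bound[of "cball a \<rho>" f ?D])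
    show "(f has_derivative ?D z) (at z within cball a \<rho>)" if "z \<in> cball a \<rho>" for z
      using d(1) that S(2) has_derivative_at_withinI by blast
    show "onorm (?D z) \<le> K" if "z \<in> cball a \<rho>" for z
      using bound[OF that] by (intro onorm_le) (simp add: mult.commute)
  qed (use that in auto)
  then show thesis using that K bound by blast
qed

text \<open>Composition with the projection to a closed ball makes the field globally Lipschitz; for a short time the solution
stays in the ball, where the field is unchanged.\<close>

lemma local_integral_curve:
  fixes f :: "'e::euclidean_space \<Rightarrow> 'e"
  assumes f: "C_k_on (Suc 0) S f" and S: "open S" and \<rho>: "\<rho> > 0" "cball a \<rho> \<subseteq> S"
  obtains T u where "T > 0" "u 0 = a" "\<And>t. \<bar>t\<bar> < T \<Longrightarrow> u t \<in> ball a \<rho> \<and> (u has_vector_derivative f (u t)) (at t)"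
proof -
  obtain K where K: "K > 0" "\<And>x y. x \<in> cball a \<rho> \<Longrightarrow> y \<in> cball a \<rho> \<Longrightarrow> norm (f x - f y) \<le> K * norm (x - y)"
    by (rule C1_bounded_on_cball[OF f S \<rho>(2)]) blast
  let ?p = "closest_point (cball a \<rho>)"
  have p: "?p x \<in> cball a \<rho>" for x using \<rho>(1) by (intro closest_point_in_set) auto
  have "norm (f (?p x) - f (?p y)) \<le> K * norm (x - y)" for x y
  proof -
    have "norm (?p x - ?p y) \<le> norm (x - y)"
      using closest_point_lipschitz[of "cball a \<rho>" x y] \<rho>(1) by (simp add: dist_norm)
    then show ?thesis using K(2)[OF p p, of x y] K(1) by (meson less_imp_le mult_left_mono order_trans)
  qed
  then obtain u T where u: "T > 0" "u 0 = a" "\<And>t. \<bar>t\<bar> < T \<Longrightarrow> (u has_vector_derivative f (?p (u t))) (at t)"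
    using picard_global_lipschitz[OF K(1), of "\<lambda>x. f (?p x)" a] by blast
  have "isCont u 0" using u(3)[of 0] u(1) has_vector_derivative_continuous by force
  then obtain \<delta> where \<delta>: "\<delta> > 0" "\<And>t. \<bar>t\<bar> < \<delta> \<Longrightarrow> dist (u t) a < \<rho>"
    using \<rho>(1) u(2) unfolding continuous_at_eps_delta by (metis dist_norm diff_zero real_norm_def)
  show thesis
  proof (rule that[of "min T \<delta>" u])
    fix t assume t: "\<bar>t\<bar> < min T \<delta>"
    then have b: "u t \<in> ball a \<rho>" using \<delta>(2)[of t] by (simp add: dist_commute)
    then have "?p (u t) = u t" by (intro closest_point_self) (auto simp: less_imp_le)
    then show "u t \<in> ball a \<rho> \<and> (u has_vector_derivative f (u t)) (at t)" using b u(3)[of t] t by simp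
  qed (use u \<delta> in auto)
qed

section \<open>One-parameter subgroups\<close>

context lie_chart
begin

lemma local_hom_power:
  fixes \<gamma> :: "real \<Rightarrow> 'g"
  assumes hom: "\<And>s t. \<bar>s\<bar> < \<delta> \<Longrightarrow> \<bar>t\<bar> < \<delta> \<Longrightarrow> \<gamma> (s + t) = \<gamma> s \<otimes> \<gamma> t" and \<delta>: "\<delta> > 0"
    and k: "\<bar>real k * s\<bar> < \<delta>"
  shows "\<gamma> (real k * s) = \<gamma> s [^] k"
  using k
proof (induction k)
  case 0
  have "\<gamma> 0 = \<gamma> 0 \<otimes> \<gamma> 0" using hom[of 0 0] \<delta> by simp
  then have "\<gamma> 0 = \<one>" by (metis in_carrier l_cancel_one')
  then show ?case by simp
next
  case (Suc k)
  have "\<bar>real k * s\<bar> \<le> \<bar>real (Suc k) * s\<bar>" "\<bar>s\<bar> \<le> \<bar>real (Suc k) * s\<bar>"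
    unfolding abs_mult by (simp_all add: mult_right_mono algebra_simps)
  then have "\<bar>real k * s\<bar> < \<delta>" "\<bar>s\<bar> < \<delta>" using Suc.prems by linarith+
  then show ?case using Suc.IH hom[of "real k * s" s] by (simp add: algebra_simps)
qed

text \<open>The extension is \<open>\<Gamma> t = \<gamma> (t / n) ^ n\<close> for any large \<open>n\<close>; comparing \<open>n\<close> and \<open>n'\<close> through \<open>n * n'\<close> shows that
the choice does not matter.\<close>

lemma extend_local_one_parameter:
  fixes \<gamma> :: "real \<Rightarrow> 'g"
  assumes hom: "\<And>s t. \<bar>s\<bar> < \<delta> \<Longrightarrow> \<bar>t\<bar> < \<delta> \<Longrightarrow> \<gamma> (s + t) = \<gamma> s \<otimes> \<gamma> t" and \<delta>: "\<delta> > 0"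
  obtains \<Gamma> where "\<And>s t. \<Gamma> (s + t) = \<Gamma> s \<otimes> \<Gamma> t" "\<And>t. \<bar>t\<bar> < \<delta> \<Longrightarrow> \<Gamma> t = \<gamma> t"
    "\<And>t n. n > 0 \<Longrightarrow> \<bar>t / real n\<bar> < \<delta> \<Longrightarrow> \<Gamma> t = \<gamma> (t / real n) [^] n"
proof -
  define ok where "ok t n \<longleftrightarrow> n > 0 \<and> \<bar>t / real n\<bar> < \<delta>" for t and n :: nat
  have split: "\<gamma> (t / real n) [^] n = \<gamma> (t / real (n * m)) [^] (n * m)" if "ok t n" "m > 0" for t n m
  proof -
    have "real m * (t / real (n * m)) = t / real n" using that by (simp add: ok_def field_simps)
    then have "\<gamma> (t / real n) = \<gamma> (t / real (n * m)) [^] m"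
      using local_hom_power[OF hom \<delta>, of m "t / real (n * m)"] that by (simp add: ok_def)
    then show ?thesis by (simp add: nat_pow_pow mult.commute)
  qed
  have indep: "\<gamma> (t / real n) [^] n = \<gamma> (t / real m) [^] m" if "ok t n" "ok t m" for t n m
    using split[of t n m] split[of t m n] that by (simp add: ok_def mult.commute)
  have large: "\<forall>\<^sub>F n in sequentially. ok t n" for t
  proof -
    obtain N :: nat where N: "\<bar>t\<bar> / \<delta> < real N" using reals_Archimedean2 by blast
    have "ok t n" if "n \<ge> Suc N" for n
    proof -
      have "\<bar>t\<bar> / \<delta> < real n" using N that by simp
      then show ?thesis using that \<delta> by (simp add: ok_def abs_divide field_simps)
    qed
    then show ?thesis using eventually_sequentially by blast
  qed
  define \<Gamma> where "\<Gamma> t = (let n = (SOME n. ok t n) in \<gamma> (t / real n) [^] n)" for t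
  have some: "ok t (SOME n. ok t n)" for t
    using eventually_happens[OF large[of t]] by (auto intro: someI)
  have \<Gamma>: "\<Gamma> t = \<gamma> (t / real n) [^] n" if "ok t n" for t n
    unfolding \<Gamma>_def Let_def by (rule indep[OF some that])
  have "\<Gamma> (s + t) = \<Gamma> s \<otimes> \<Gamma> t" for s t
  proof -
    obtain n where n: "ok s n" "ok t n" "ok (s + t) n"
      using eventually_happens[OF eventually_conj[OF large[of s] eventually_conj[OF large[of t] large[of "s + t"]]]] by auto
    let ?a = "\<gamma> (s / real n)" and ?b = "\<gamma> (t / real n)"
    have ab: "\<gamma> ((s + t) / real n) = ?a \<otimes> ?b" "\<gamma> ((s + t) / real n) = ?b \<otimes> ?a"
      using hom[of "s / real n" "t / real n"] hom[of "t / real n" "s / real n"] n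
      by (simp_all add: ok_def add_divide_distrib add.commute)
    then show ?thesis using \<Gamma>[OF n(1)] \<Gamma>[OF n(2)] \<Gamma>[OF n(3)] pow_mult_distrib[of ?a ?b n] by simp
  qed
  moreover have "\<Gamma> t = \<gamma> t" if "\<bar>t\<bar> < \<delta>" for t
    using \<Gamma>[of t 1] that by (simp add: ok_def)
  moreover have "\<Gamma> t = \<gamma> (t / real n) [^] n" if "n > 0" "\<bar>t / real n\<bar> < \<delta>" for t n
    using \<Gamma>[of t n] that unfolding ok_def by blast
  ultimately show thesis by (rule that)
qed

text \<open>Left translates of integral curves of a left-invariant field are integral curves.\<close>

lemma X_curve_derivative:
  assumes "(\<gamma> has_vector_derivative X v (\<gamma> t)) (at t)" "(x, \<gamma> t) \<in> lmult_dom"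
  shows "((\<lambda>t. lmult (x, \<gamma> t)) has_vector_derivative X v (lmult (x, \<gamma> t))) (at t)"
proof -
  have "((\<lambda>t. lmult (x, \<gamma> t)) has_derivative (\<lambda>h. frechet_derivative lmult (at (x, \<gamma> t)) (0, h *\<^sub>R X v (\<gamma> t)))) (at t)"
    by (rule has_derivative_compose[OF assms(1)[unfolded has_vector_derivative_def] left_mult_has_derivative[OF assms(2)]])
  moreover have "frechet_derivative lmult (at (x, \<gamma> t)) (0, h *\<^sub>R X v (\<gamma> t)) = h *\<^sub>R X v (lmult (x, \<gamma> t))" for h
  proof -
    have "linear (frechet_derivative lmult (at (x, \<gamma> t)))"
      using lmult_has_derivative[OF assms(2)] has_derivative_linear by blast
    then have "frechet_derivative lmult (at (x, \<gamma> t)) (h *\<^sub>R (0, X v (\<gamma> t))) = h *\<^sub>R frechet_derivative lmult (at (x, \<gamma> t)) (0, X v (\<gamma> t))"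
      by (rule linear_scale)
    then show ?thesis using X_left_invariant[OF assms(2)] by simp
  qed
  ultimately show ?thesis by (simp add: has_vector_derivative_def)
qed

lemma integral_curves_agree:
  assumes \<rho>: "cball e0 \<rho> \<subseteq> Ch"
    and y1: "\<And>t. \<bar>t\<bar> < T \<Longrightarrow> y1 t \<in> cball e0 \<rho> \<and> (y1 has_vector_derivative X v (y1 t)) (at t)"
    and y2: "\<And>t. \<bar>t\<bar> < T \<Longrightarrow> y2 t \<in> cball e0 \<rho> \<and> (y2 has_vector_derivative X v (y2 t)) (at t)"
    and eq: "y1 0 = y2 0" and t: "\<bar>t\<bar> < T"
  shows "y1 t = y2 t"
proof -
  obtain K where K: "K > 0" "\<And>x y. x \<in> cball e0 \<rho> \<Longrightarrow> y \<in> cball e0 \<rho> \<Longrightarrow> norm (X v x - X v y) \<le> K * norm (x - y)"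
    by (rule C1_bounded_on_cball[OF X_smooth open_Ch \<rho>]) blast
  have "y1 t - y2 t = 0"
    by (rule gronwall_zero[where E="\<lambda>t. y1 t - y2 t" and E'="\<lambda>t. X v (y1 t) - X v (y2 t)" and K=K and T=T])
       (use y1 y2 K eq t in \<open>auto intro!: has_vector_derivative_diff\<close>)
  then show ?thesis by simp
qed

definition flow_line :: "'e \<Rightarrow> real \<Rightarrow> (real \<Rightarrow> 'e) \<Rightarrow> real \<Rightarrow> bool" where
  "flow_line v \<rho> \<gamma> T \<longleftrightarrow> T > 0 \<and> \<gamma> 0 = e0 \<and>
     (\<forall>t. \<bar>t\<bar> < T \<longrightarrow> \<gamma> t \<in> ball e0 \<rho> \<and> (\<gamma> has_vector_derivative X v (\<gamma> t)) (at t))"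

lemma flow_line_exists:
  assumes "\<rho> > 0" "cball e0 \<rho> \<subseteq> Ch"
  shows "\<exists>\<gamma> T. flow_line v \<rho> \<gamma> T"
  using local_integral_curve[OF X_smooth open_Ch assms, of v] unfolding flow_line_def by metis

lemma flow_line_mono: "flow_line v \<rho> \<gamma> T \<Longrightarrow> 0 < T' \<Longrightarrow> T' \<le> T \<Longrightarrow> flow_line v \<rho> \<gamma> T'"
  by (auto simp: flow_line_def)

text \<open>As functions of \<open>t\<close> both sides are integral curves of \<open>X v\<close> that start at \<open>\<gamma> s\<close>.\<close>

lemma flow_line_hom:
  assumes R: "cball e0 R \<subseteq> Ch" and rR: "\<rho> \<le> R"
    and mult: "\<And>x y. x \<in> ball e0 \<rho> \<Longrightarrow> y \<in> ball e0 \<rho> \<Longrightarrow> (x, y) \<in> lmult_dom \<and> lmult (x, y) \<in> ball e0 R"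
    and \<gamma>: "flow_line v \<rho> \<gamma> T" and st: "\<bar>s\<bar> < T / 2" "\<bar>t\<bar> < T / 2"
  shows "lmult (\<gamma> s, \<gamma> t) = \<gamma> (s + t)"
proof -
  have g: "\<gamma> t \<in> ball e0 \<rho>" "(\<gamma> has_vector_derivative X v (\<gamma> t)) (at t)" if "\<bar>t\<bar> < T" for t
    using \<gamma> that by (auto simp: flow_line_def)
  have g0: "\<gamma> 0 = e0" using \<gamma> by (simp add: flow_line_def)
  have s: "\<bar>s\<bar> < T" using st by linarith
  have sC: "\<gamma> s \<in> Ch" using g(1)[OF s] rR R by auto
  show ?thesis
  proof (rule integral_curves_agree[OF R, where T="T / 2" and v=v
        and ?y1.0="\<lambda>t. lmult (\<gamma> s, \<gamma> t)" and ?y2.0="\<lambda>t. \<gamma> (s + t)"])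
    fix t assume t: "\<bar>t\<bar> < T / 2"
    then have t': "\<bar>t\<bar> < T" "\<bar>s + t\<bar> < T" using st by linarith+
    have m: "(\<gamma> s, \<gamma> t) \<in> lmult_dom" "lmult (\<gamma> s, \<gamma> t) \<in> ball e0 R" using mult g(1)[OF s] g(1)[OF t'(1)] by auto
    show "lmult (\<gamma> s, \<gamma> t) \<in> cball e0 R \<and> ((\<lambda>t. lmult (\<gamma> s, \<gamma> t)) has_vector_derivative X v (lmult (\<gamma> s, \<gamma> t))) (at t)"
      using m X_curve_derivative[OF g(2)[OF t'(1)] m(1)] by auto
    have "((\<lambda>t. \<gamma> (s + t)) has_vector_derivative X v (\<gamma> (s + t))) (at t)"
      using has_vector_derivative_shift[of \<gamma> _ t s] g(2)[OF t'(2)] by (simp add: add.commute)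
    then show "\<gamma> (s + t) \<in> cball e0 R \<and> ((\<lambda>t. \<gamma> (s + t)) has_vector_derivative X v (\<gamma> (s + t))) (at t)"
      using g(1)[OF t'(2)] rR by auto
  qed (use st g0 sC in \<open>auto simp: lmult_e0\<close>)
qed

lemma right_mult_has_derivative:
  assumes "(x, y) \<in> lmult_dom"
  shows "((\<lambda>x. lmult (x, y)) has_derivative (\<lambda>h. frechet_derivative lmult (at (x, y)) (h, 0))) (at x)"
proof -
  have "((\<lambda>x. (x, y)) has_derivative (\<lambda>h. (h, 0))) (at x)" by (intro has_derivative_Pair) (auto intro: derivative_intros)
  from has_derivative_compose[OF this, of lmult] lmult_has_derivative[OF assms] show ?thesis by simp
qed

text \<open>Right translation by \<open>\<gamma> s\<close> is the flow of \<open>X v\<close>. Let \<open>E s\<close> be the defect in the claim. Because the fields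
commute, \<open>E\<close> solves the linear equation \<open>E' = DX v E\<close> along the flow line, and \<open>E 0 = 0\<close>.\<close>

lemma right_translation_preserves_field:
  assumes R: "cball e0 R \<subseteq> Ch" and br0: "br v w = 0"
    and \<gamma>: "flow_line v \<rho> \<gamma> T" and x: "x \<in> Ch"
    and m: "\<And>t. \<bar>t\<bar> < T \<Longrightarrow> (x, \<gamma> t) \<in> lmult_dom \<and> lmult (x, \<gamma> t) \<in> cball e0 R" and s: "\<bar>s\<bar> < T"
  shows "frechet_derivative lmult (at (x, \<gamma> s)) (X w x, 0) = X w (lmult (x, \<gamma> s))"
proof -
  let ?D = "\<lambda>z. frechet_derivative lmult (at z)"
  let ?h = "X w x"
  define E where "E s = ?D (x, \<gamma> s) (?h, 0) - X w (lmult (x, \<gamma> s))" for s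
  obtain K where K: "K > 0" "\<And>x h. x \<in> cball e0 R \<Longrightarrow> norm (DX v x h) \<le> K * norm h"
    by (rule C1_bounded_on_cball[OF X_smooth open_Ch R]) (auto simp: DX_def)
  have g: "(\<gamma> has_vector_derivative X v (\<gamma> t)) (at t)" if "\<bar>t\<bar> < T" for t using \<gamma> that by (auto simp: flow_line_def)
  have l2: "C_k_on 2 lmult_dom lmult" "C_k_on (Suc (Suc 0)) lmult_dom lmult" by (rule lmult_smooth(2))+
  note d2 = C_k_on_derivative(2)[OF l2(2) lmult_smooth(1)]
  have dE: "(E has_vector_derivative DX v (lmult (x, \<gamma> s)) (E s)) (at s)" if s: "\<bar>s\<bar> < T" for s
  proof -
    let ?q = "\<gamma> s" and ?m = "lmult (x, \<gamma> s)"
    let ?y = "X v ?q"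
    have dom: "(x, ?q) \<in> lmult_dom" and mC: "?m \<in> Ch" using m[OF s] R by auto
    have qC: "?q \<in> Ch" using dom by (simp add: lmult_dom_def)
    have "((\<lambda>s. (x, \<gamma> s)) has_derivative (\<lambda>r. (0, r *\<^sub>R ?y))) (at s)"
      using g[OF s] by (intro has_derivative_Pair has_derivative_const) (simp add: has_vector_derivative_def)
    from has_derivative_compose[OF this C_k_on_derivative(1)[OF d2[of "(?h, 0)"] lmult_smooth(1) dom]]
    have "((\<lambda>s. ?D (x, \<gamma> s) (?h, 0)) has_derivative (\<lambda>r. frechet_derivative (\<lambda>z. ?D z (?h, 0)) (at (x, ?q)) (0, r *\<^sub>R ?y))) (at s)" .
    moreover have "frechet_derivative (\<lambda>z. ?D z (?h, 0)) (at (x, ?q)) (0, r *\<^sub>R ?y) = r *\<^sub>R DX v ?m (?D (x, ?q) (?h, 0))" for r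
    proof -
      have lin: "linear (frechet_derivative (\<lambda>z. ?D z (?h, 0)) (at (x, ?q)))"
        using C_k_on_derivative(1)[OF d2[of "(?h, 0)"] lmult_smooth(1) dom] has_derivative_linear by blast
      have "frechet_derivative (\<lambda>z. ?D z (?h, 0)) (at (x, ?q)) (r *\<^sub>R (0, ?y)) = r *\<^sub>R frechet_derivative (\<lambda>z. ?D z (?h, 0)) (at (x, ?q)) (0, ?y)"
        by (rule linear_scale[OF lin])
      also have "frechet_derivative (\<lambda>z. ?D z (?h, 0)) (at (x, ?q)) (0, ?y) = frechet_derivative (\<lambda>z. ?D z (0, ?y)) (at (x, ?q)) (?h, 0)"
        by (rule second_derivative_symmetric[OF l2(1) lmult_smooth(1) dom])
      also have "\<dots> = DX v ?m (?D (x, ?q) (?h, 0))"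
      proof -
        have "((\<lambda>x. (x, ?q)) has_derivative (\<lambda>h. (h, 0))) (at x)" by (intro has_derivative_Pair) (auto intro: derivative_intros)
        from has_derivative_compose[OF this C_k_on_derivative(1)[OF d2[of "(0, ?y)"] lmult_smooth(1) dom]]
        have 1: "((\<lambda>x. ?D (x, ?q) (0, ?y)) has_derivative (\<lambda>h. frechet_derivative (\<lambda>z. ?D z (0, ?y)) (at (x, ?q)) (h, 0))) (at x)" .
        have "open ((\<lambda>x. (x, ?q)) -` lmult_dom)"
          by (intro open_vimage lmult_smooth(1) continuous_intros)
        then have 2: "((\<lambda>x. ?D (x, ?q) (0, ?y)) has_derivative (\<lambda>h. DX v ?m (?D (x, ?q) (h, 0)))) (at x)"
        proof (rule has_derivative_transform_within_open[rotated])
          show "((\<lambda>x. X v (lmult (x, ?q))) has_derivative (\<lambda>h. DX v ?m (?D (x, ?q) (h, 0)))) (at x)"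
            by (rule has_derivative_compose[OF right_mult_has_derivative[OF dom] X_deriv[OF mC]])
        qed (use dom X_left_invariant in auto)
        show ?thesis using fun_cong[OF has_derivative_unique[OF 1 2], of ?h] by simp
      qed
      finally show ?thesis by simp
    qed
    ultimately have a: "((\<lambda>s. ?D (x, \<gamma> s) (?h, 0)) has_vector_derivative DX v ?m (?D (x, ?q) (?h, 0))) (at s)"
      by (simp add: has_vector_derivative_def)
    have "((\<lambda>s. X w (lmult (x, \<gamma> s))) has_derivative (\<lambda>r. DX w ?m (r *\<^sub>R X v ?m))) (at s)"
      by (rule has_derivative_compose[OF X_curve_derivative[OF g[OF s] dom, unfolded has_vector_derivative_def] X_deriv[OF mC]])
    then have b: "((\<lambda>s. X w (lmult (x, \<gamma> s))) has_vector_derivative DX w ?m (X v ?m)) (at s)"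
      by (simp add: has_vector_derivative_def linear_scale[OF linear_DX_dir[OF mC]])
    have "DX w ?m (X v ?m) = DX v ?m (X w ?m)"
      using commutator_left_invariant_fields[OF mC, of w v] br0 linear_0[OF linear_X[OF mC]] by simp
    then have "DX v ?m (?D (x, ?q) (?h, 0)) - DX w ?m (X v ?m) = DX v ?m (E s)"
      unfolding E_def using linear_diff[OF linear_DX_dir[OF mC]] by simp
    then show ?thesis using has_vector_derivative_diff[OF a b] unfolding E_def[abs_def] by simp
  qed
  have "E s = 0"
  proof (rule gronwall_zero[OF dE _ _ s])
    show "norm (DX v (lmult (x, \<gamma> t)) (E t)) \<le> K * norm (E t)" if "\<bar>t\<bar> < T" for t using K(2) m[OF that] by blast
    have "?D (x, e0) (?h, 0) = ?h"
    proof -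
      have "((\<lambda>x. lmult (x, e0)) has_derivative (\<lambda>h. h)) (at x)"
        by (rule has_derivative_transform_within_open[OF has_derivative_ident open_Ch x]) (simp add: lmult_e0)
      then show ?thesis using has_derivative_unique[OF right_mult_has_derivative[OF lmult_dom_e0[OF x]]] by metis
    qed
    then show "E 0 = 0" using \<gamma> lmult_e0[OF x] by (simp add: E_def flow_line_def)
  qed
  then show ?thesis by (simp add: E_def)
qed

text \<open>As functions of \<open>t\<close> both sides are integral curves of \<open>X w\<close> from \<open>\<gamma> s\<close>: the first by left invariance, the
second because right translation by \<open>\<gamma> s\<close> preserves \<open>X w\<close>.\<close>

lemma flow_lines_commute:
  assumes R: "cball e0 R \<subseteq> Ch" and rR: "\<rho> \<le> R"
    and mult: "\<And>x y. x \<in> ball e0 \<rho> \<Longrightarrow> y \<in> ball e0 \<rho> \<Longrightarrow> (x, y) \<in> lmult_dom \<and> lmult (x, y) \<in> ball e0 R"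
    and br0: "br v w = 0" and \<gamma>: "flow_line v \<rho> \<gamma> T" and \<kappa>: "flow_line w \<rho> \<kappa> T"
    and st: "\<bar>s\<bar> < T" "\<bar>t\<bar> < T"
  shows "lmult (\<gamma> s, \<kappa> t) = lmult (\<kappa> t, \<gamma> s)"
proof (rule integral_curves_agree[OF R, where T=T and v=w
      and ?y1.0="\<lambda>t. lmult (\<gamma> s, \<kappa> t)" and ?y2.0="\<lambda>t. lmult (\<kappa> t, \<gamma> s)"])
  have g: "\<gamma> t \<in> ball e0 \<rho>" if "\<bar>t\<bar> < T" for t using \<gamma> that by (auto simp: flow_line_def)
  have k: "\<kappa> t \<in> ball e0 \<rho>" "(\<kappa> has_vector_derivative X w (\<kappa> t)) (at t)" if "\<bar>t\<bar> < T" for t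
    using \<kappa> that by (auto simp: flow_line_def)
  fix t assume t: "\<bar>t\<bar> < T"
  have m: "(\<gamma> s, \<kappa> t) \<in> lmult_dom" "lmult (\<gamma> s, \<kappa> t) \<in> ball e0 R"
    "(\<kappa> t, \<gamma> s) \<in> lmult_dom" "lmult (\<kappa> t, \<gamma> s) \<in> ball e0 R" using mult g[OF st(1)] k(1)[OF t] by auto
  show "lmult (\<gamma> s, \<kappa> t) \<in> cball e0 R \<and> ((\<lambda>t. lmult (\<gamma> s, \<kappa> t)) has_vector_derivative X w (lmult (\<gamma> s, \<kappa> t))) (at t)"
    using m X_curve_derivative[OF k(2)[OF t] m(1)] by auto
  have kC: "\<kappa> t \<in> Ch" using m(3) by (simp add: lmult_dom_def)
  have "frechet_derivative lmult (at (\<kappa> t, \<gamma> s)) (X w (\<kappa> t), 0) = X w (lmult (\<kappa> t, \<gamma> s))"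
  proof (rule right_translation_preserves_field[OF R br0 \<gamma> kC _ st(1)])
    fix s' assume "\<bar>s'\<bar> < T"
    then show "(\<kappa> t, \<gamma> s') \<in> lmult_dom \<and> lmult (\<kappa> t, \<gamma> s') \<in> cball e0 R"
      using mult[OF k(1)[OF t] g, of s'] by auto
  qed
  moreover have lin: "linear (\<lambda>h. frechet_derivative lmult (at (\<kappa> t, \<gamma> s)) (h, 0))"
    using right_mult_has_derivative[OF m(3)] has_derivative_linear by blast
  ultimately have "frechet_derivative lmult (at (\<kappa> t, \<gamma> s)) (r *\<^sub>R X w (\<kappa> t), 0) = r *\<^sub>R X w (lmult (\<kappa> t, \<gamma> s))" for r
    using linear_scale[OF lin, of r "X w (\<kappa> t)"] by metis
  then have "((\<lambda>t. lmult (\<kappa> t, \<gamma> s)) has_vector_derivative X w (lmult (\<kappa> t, \<gamma> s))) (at t)"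
    using has_derivative_compose[OF k(2)[OF t, unfolded has_vector_derivative_def] right_mult_has_derivative[OF m(3)]]
    by (simp add: has_vector_derivative_def)
  then show "lmult (\<kappa> t, \<gamma> s) \<in> cball e0 R \<and> ((\<lambda>t. lmult (\<kappa> t, \<gamma> s)) has_vector_derivative X w (lmult (\<kappa> t, \<gamma> s))) (at t)"
    using m by auto
next
  have "\<gamma> s \<in> cball e0 R" using \<gamma> st(1) rR by (auto simp: flow_line_def)
  then have "\<gamma> s \<in> Ch" using R by blast
  then show "lmult (\<gamma> s, \<kappa> 0) = lmult (\<kappa> 0, \<gamma> s)" using \<kappa> by (simp add: flow_line_def lmult_e0 e0_lmult)
qed (rule st)

text \<open>The last clause ties \<open>psi \<circ> \<Gamma>\<close> to the group near time \<open>0\<close>: outside of the chart domain the values of \<open>psi\<close> mean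
nothing.\<close>

definition one_parameter :: "'e \<Rightarrow> (real \<Rightarrow> 'g) \<Rightarrow> bool" where
  "one_parameter v \<Gamma> \<longleftrightarrow> (\<forall>s t. \<Gamma> (s + t) = \<Gamma> s \<otimes> \<Gamma> t) \<and> ((\<lambda>t. psi (\<Gamma> t)) has_vector_derivative v) (at 0)
     \<and> (\<exists>\<delta>>0. \<forall>t. \<bar>t\<bar> < \<delta> \<longrightarrow> \<Gamma> t \<in> fst c)"

text \<open>The flow lines commute near the identity, and each one-parameter subgroup consists of powers of its elements near the
identity.\<close>

theorem commuting_one_parameter_subgroups:
  fixes v :: "nat \<Rightarrow> 'e"
  assumes br0: "\<And>i j. i < m \<Longrightarrow> j < m \<Longrightarrow> br (v i) (v j) = 0"
  shows "\<exists>\<Gamma>. (\<forall>i<m. one_parameter (v i) (\<Gamma> i)) \<and>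
    (\<forall>i<m. \<forall>j<m. \<forall>s t. \<Gamma> i s \<otimes> \<Gamma> j t = \<Gamma> j t \<otimes> \<Gamma> i s)"
proof -
  obtain R where R: "R > 0" "cball e0 R \<subseteq> Ch" using open_Ch e0_in open_contains_cball by blast
  obtain \<rho>0 where \<rho>0: "\<rho>0 > 0"
    "\<And>x y. x \<in> ball e0 \<rho>0 \<Longrightarrow> y \<in> ball e0 \<rho>0 \<Longrightarrow> (x, y) \<in> lmult_dom \<and> lmult (x, y) \<in> ball e0 R"
    by (rule lmult_ball[of "ball e0 R"]) (use R(1) in auto)
  define \<rho> where "\<rho> = min \<rho>0 R"
  have \<rho>: "\<rho> > 0" "\<rho> \<le> R" "cball e0 \<rho> \<subseteq> Ch" using \<rho>0 R by (auto simp: \<rho>_def)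
  have mult: "(x, y) \<in> lmult_dom \<and> lmult (x, y) \<in> ball e0 R" if "x \<in> ball e0 \<rho>" "y \<in> ball e0 \<rho>" for x y
    using \<rho>0(2) that by (auto simp: \<rho>_def)
  have "\<exists>\<gamma> T. flow_line (v i) \<rho> \<gamma> T" for i by (rule flow_line_exists[OF \<rho>(1,3)])
  then obtain \<gamma> T0 where \<gamma>0: "\<And>i. flow_line (v i) \<rho> (\<gamma> i) (T0 i)" by metis
  define T where "T = Min (insert 1 (T0 ` {..<m}))"
  have "T > 0" using \<gamma>0 by (auto simp: T_def flow_line_def)
  moreover have "T \<le> T0 i" if "i < m" for i using that by (simp add: T_def)
  ultimately have \<gamma>: "flow_line (v i) \<rho> (\<gamma> i) T" if "i < m" for i using flow_line_mono[OF \<gamma>0] that by blast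
  define \<delta> where "\<delta> = T / 2"
  have \<delta>: "\<delta> > 0" "\<delta> < T" using \<open>T > 0\<close> by (auto simp: \<delta>_def)
  have gb: "\<gamma> i t \<in> ball e0 \<rho>" "\<gamma> i t \<in> Ch" if "i < m" "\<bar>t\<bar> < \<delta>" for i t
  proof -
    show "\<gamma> i t \<in> ball e0 \<rho>" using \<gamma>[OF that(1)] that(2) \<delta> by (auto simp: flow_line_def)
    then show "\<gamma> i t \<in> Ch" using subsetD[OF \<rho>(3), of "\<gamma> i t"] by simp
  qed
  have pm: "par (lmult (x, y)) = par x \<otimes> par y" if "x \<in> ball e0 \<rho>" "y \<in> ball e0 \<rho>" for x y
    using mult[OF that] by (auto simp: lmult_dom_def lmult_def par_psi)
  have hom: "par (\<gamma> i (s + t)) = par (\<gamma> i s) \<otimes> par (\<gamma> i t)" if i: "i < m" and "\<bar>s\<bar> < \<delta>" "\<bar>t\<bar> < \<delta>" for i s t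
    using flow_line_hom[OF R(2) \<rho>(2) mult \<gamma>[OF i]] pm[OF gb(1)[OF i] gb(1)[OF i]] that by (simp add: \<delta>_def)
  have "\<exists>\<Gamma>. (\<forall>s t. \<Gamma> (s + t) = \<Gamma> s \<otimes> \<Gamma> t) \<and> (\<forall>t. \<bar>t\<bar> < \<delta> \<longrightarrow> \<Gamma> t = par (\<gamma> i t)) \<and>
      (\<forall>t n. n > 0 \<longrightarrow> \<bar>t / real n\<bar> < \<delta> \<longrightarrow> \<Gamma> t = par (\<gamma> i (t / real n)) [^] n)" if i: "i < m" for i
    using extend_local_one_parameter[of \<delta> "\<lambda>t. par (\<gamma> i t)", OF hom[OF i] \<delta>(1)] by metis
  then obtain \<Gamma> where \<Gamma>: "\<And>i s t. i < m \<Longrightarrow> \<Gamma> i (s + t) = \<Gamma> i s \<otimes> \<Gamma> i t"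
    "\<And>i t. i < m \<Longrightarrow> \<bar>t\<bar> < \<delta> \<Longrightarrow> \<Gamma> i t = par (\<gamma> i t)"
    "\<And>i t n. i < m \<Longrightarrow> n > 0 \<Longrightarrow> \<bar>t / real n\<bar> < \<delta> \<Longrightarrow> \<Gamma> i t = par (\<gamma> i (t / real n)) [^] n" by metis
  show ?thesis
  proof (intro exI[of _ \<Gamma>] conjI allI impI)
    fix i assume i: "i < m"
    have g0: "\<gamma> i 0 = e0" using \<gamma>[OF i] by (simp add: flow_line_def)
    have "(\<gamma> i has_vector_derivative X (v i) (\<gamma> i t)) (at t)" if "\<bar>t\<bar> < T" for t
      using \<gamma>[OF i] that by (auto simp: flow_line_def)
    from this[of 0] have "(\<gamma> i has_vector_derivative v i) (at 0)" using \<open>T > 0\<close> by (simp add: g0)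
    then have "((\<lambda>t. psi (\<Gamma> i t)) has_vector_derivative v i) (at 0)"
    proof (rule has_vector_derivative_transform_within_open[of _ _ _ "{- \<delta><..<\<delta>}"])
      fix t assume "t \<in> {- \<delta><..<\<delta>}"
      then have "\<bar>t\<bar> < \<delta>" by auto
      then show "\<gamma> i t = psi (\<Gamma> i t)" using \<Gamma>(2)[OF i] psi_par[OF gb(2)[OF i]] by simp
    qed (use \<delta> in auto)
    moreover have "\<Gamma> i t \<in> fst c" if "\<bar>t\<bar> < \<delta>" for t using \<Gamma>(2)[OF i that] gb(2)[OF i that] par_in by simp
    ultimately show "one_parameter (v i) (\<Gamma> i)" unfolding one_parameter_def using \<Gamma>(1)[OF i] \<delta>(1) by blast
  next
    fix i j s t assume ij: "i < m" "j < m"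
    obtain n :: nat where n: "(\<bar>s\<bar> + \<bar>t\<bar>) / \<delta> < real n" using reals_Archimedean2 by blast
    have "0 \<le> (\<bar>s\<bar> + \<bar>t\<bar>) / \<delta>" using \<delta>(1) by simp
    then have n0: "n > 0" using n by (cases n) auto
    then have st: "\<bar>s / real n\<bar> < \<delta>" "\<bar>t / real n\<bar> < \<delta>"
      using n \<delta>(1) by (auto simp: abs_divide field_simps)
    let ?a = "par (\<gamma> i (s / real n))" and ?b = "par (\<gamma> j (t / real n))"
    have "lmult (\<gamma> i (s / real n), \<gamma> j (t / real n)) = lmult (\<gamma> j (t / real n), \<gamma> i (s / real n))"
      using flow_lines_commute[OF R(2) \<rho>(2) mult br0[OF ij] \<gamma>[OF ij(1)] \<gamma>[OF ij(2)]] st \<delta> by simp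
    then have "?a \<otimes> ?b = ?b \<otimes> ?a"
      using pm[OF gb(1)[OF ij(1) st(1)] gb(1)[OF ij(2) st(2)]] pm[OF gb(1)[OF ij(2) st(2)] gb(1)[OF ij(1) st(1)]] by metis
    then have "?a [^] n \<otimes> ?b [^] n = ?b [^] n \<otimes> ?a [^] n"
      by (metis in_carrier pow_mult_distrib)
    then show "\<Gamma> i s \<otimes> \<Gamma> j t = \<Gamma> j t \<otimes> \<Gamma> i s"
      using \<Gamma>(3)[OF ij(1) n0 st(1)] \<Gamma>(3)[OF ij(2) n0 st(2)] by simp
  qed
qed

end

section \<open>Curves of finite length\<close>

lemma C1_differentiable_on_local:
  fixes f :: "real \<Rightarrow> 'a::real_normed_vector"
  assumes "\<And>x. x \<in> S \<Longrightarrow> \<exists>N. open N \<and> x \<in> N \<and> f C1_differentiable_on (S \<inter> N)"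
  shows "f C1_differentiable_on S"
  unfolding C1_differentiable_on_eq
proof (intro conjI ballI)
  fix x assume x: "x \<in> S"
  obtain N where "open N" "x \<in> N" "f C1_differentiable_on (S \<inter> N)" using assms[OF x] by blast
  then show "f differentiable at x" using x by (auto simp: C1_differentiable_on_eq)
next
  show "continuous_on S (\<lambda>x. vector_derivative f (at x))"
    unfolding continuous_on_eq_continuous_within
  proof
    fix x assume x: "x \<in> S"
    obtain N where N: "open N" "x \<in> N" "f C1_differentiable_on (S \<inter> N)" using assms[OF x] by blast
    then have "continuous (at x within S \<inter> N) (\<lambda>x. vector_derivative f (at x))"
      using x by (auto simp: C1_differentiable_on_eq continuous_on_eq_continuous_within)
    moreover have "at x within S \<inter> N = at x within S"
      by (rule at_within_nhd[OF N(2,1)]) auto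
    ultimately show "continuous (at x within S) (\<lambda>x. vector_derivative f (at x))" by simp
  qed
qed

lemma C1_differentiable_on_reparam:
  fixes f :: "real \<Rightarrow> 'a::real_normed_vector"
  assumes f: "f C1_differentiable_on S1" and N: "open N"
    and eq: "\<And>t. t \<in> N \<Longrightarrow> f2 t = f (a * t + b)" and im: "\<And>t. t \<in> S \<Longrightarrow> t \<in> N \<Longrightarrow> a * t + b \<in> S1"
  shows "f2 C1_differentiable_on (S \<inter> N)"
proof -
  obtain D where D: "\<And>x. x \<in> S1 \<Longrightarrow> (f has_vector_derivative D x) (at x)" "continuous_on S1 D"
    using f by (auto simp: C1_differentiable_on_def)
  have "(f2 has_vector_derivative a *\<^sub>R D (a * t + b)) (at t)" if t: "t \<in> S \<inter> N" for t
  proof (rule has_vector_derivative_transform_within_open[OF _ N])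
    show "((\<lambda>t. f (a * t + b)) has_vector_derivative a *\<^sub>R D (a * t + b)) (at t)"
      using t by (intro has_vector_derivative_affine D(1) im) auto
  qed (use t eq in auto)
  moreover have "continuous_on (S \<inter> N) (\<lambda>t. a *\<^sub>R D (a * t + b))"
    by (intro continuous_on_scaleR continuous_on_const continuous_on_compose2[OF D(2)])
       (use im in \<open>auto intro!: continuous_intros\<close>)
  ultimately show ?thesis
    unfolding C1_differentiable_on_def by (intro exI[of _ "\<lambda>t. a *\<^sub>R D (a * t + b)"]) auto
qed

context lie_chart
begin

text \<open>Piecewise \<open>C\<^sup>1\<close> curves with bounded left velocity. In contrast to the curves over which the distance is an
infimum, which are unrestricted at the exceptional times, they have finite length.\<close>

definition tame :: "(real \<Rightarrow> 'g) \<Rightarrow> bool" where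
  "tame \<gamma> \<longleftrightarrow> path \<gamma> \<and> (\<exists>T. finite T \<and>
     (\<forall>c'\<in>A. (snd c' \<circ> \<gamma>) C1_differentiable_on ({t\<in>{0..1}. \<gamma> t \<in> fst c'} - T)) \<and>
     (\<exists>M. \<forall>t\<in>{0..1} - T. \<exists>w. norm w \<le> M \<and> ((\<lambda>s. psi (inv (\<gamma> t) \<otimes> \<gamma> s)) has_vector_derivative w) (at t)))"

lemma tame_join:
  assumes t1: "tame \<gamma>1" and t2: "tame \<gamma>2" and m: "pathfinish \<gamma>1 = pathstart \<gamma>2"
  shows "tame (\<gamma>1 +++ \<gamma>2)"
proof -
  obtain T1 M1 where T1: "finite T1" "\<And>c'. c' \<in> A \<Longrightarrow> (snd c' \<circ> \<gamma>1) C1_differentiable_on ({t\<in>{0..1}. \<gamma>1 t \<in> fst c'} - T1)"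
    "\<And>t. t \<in> {0..1} - T1 \<Longrightarrow> \<exists>w. norm w \<le> M1 \<and> ((\<lambda>s. psi (inv (\<gamma>1 t) \<otimes> \<gamma>1 s)) has_vector_derivative w) (at t)"
    using t1 unfolding tame_def by blast
  obtain T2 M2 where T2: "finite T2" "\<And>c'. c' \<in> A \<Longrightarrow> (snd c' \<circ> \<gamma>2) C1_differentiable_on ({t\<in>{0..1}. \<gamma>2 t \<in> fst c'} - T2)"
    "\<And>t. t \<in> {0..1} - T2 \<Longrightarrow> \<exists>w. norm w \<le> M2 \<and> ((\<lambda>s. psi (inv (\<gamma>2 t) \<otimes> \<gamma>2 s)) has_vector_derivative w) (at t)"
    using t2 unfolding tame_def by blast
  let ?\<gamma> = "\<gamma>1 +++ \<gamma>2"
  define T where "T = insert (1/2) ((\<lambda>t. t / 2) ` T1 \<union> (\<lambda>t. (t + 1) / 2) ` T2)"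
  have left: "?\<gamma> t = \<gamma>1 (2 * t + 0)" if "t \<in> {..<1/2}" for t using that by (simp add: joinpaths_def)
  have right: "?\<gamma> t = \<gamma>2 (2 * t + (-1))" if "t \<in> {1/2<..}" for t using that by (simp add: joinpaths_def)
  have l: "2 * t \<in> {0..1} - T1" if "t \<in> {0..1} - T" "t < 1/2" for t
  proof -
    have "2 * t \<notin> T1"
    proof
      assume "2 * t \<in> T1"
      then have "t \<in> (\<lambda>t. t / 2) ` T1" by (intro image_eqI[of _ _ "2 * t"]) auto
      then show False using that by (auto simp: T_def)
    qed
    then show ?thesis using that by auto
  qed
  have r: "2 * t + (-1) \<in> {0..1} - T2" if "t \<in> {0..1} - T" "t > 1/2" for t
  proof -
    have "2 * t - 1 \<notin> T2"
    proof
      assume "2 * t - 1 \<in> T2"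
      then have "t \<in> (\<lambda>t. (t + 1) / 2) ` T2" by (intro image_eqI[of _ _ "2 * t - 1"]) auto
      then show False using that by (auto simp: T_def)
    qed
    then show ?thesis using that by auto
  qed
  have half: "t < 1/2 \<or> t > 1/2" if "t \<in> {0..1} - T" for t using that by (auto simp: T_def)
  have "path ?\<gamma>" using t1 t2 m by (simp add: tame_def)
  moreover have "finite T" using T1 T2 by (simp add: T_def)
  moreover have "(snd c' \<circ> ?\<gamma>) C1_differentiable_on ({t\<in>{0..1}. ?\<gamma> t \<in> fst c'} - T)" if c': "c' \<in> A" for c'
  proof (rule C1_differentiable_on_local)
    let ?S = "{t\<in>{0..1}. ?\<gamma> t \<in> fst c'} - T"
    fix t assume t: "t \<in> ?S"
    have "(snd c' \<circ> ?\<gamma>) C1_differentiable_on (?S \<inter> {..<1/2})"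
      by (rule C1_differentiable_on_reparam[OF T1(2)[OF c'], where a=2 and b=0]) (use left l in auto)
    moreover have "(snd c' \<circ> ?\<gamma>) C1_differentiable_on (?S \<inter> {1/2<..})"
      by (rule C1_differentiable_on_reparam[OF T2(2)[OF c'], where a=2 and b="-1"]) (use right r in auto)
    ultimately show "\<exists>N. open N \<and> t \<in> N \<and> (snd c' \<circ> ?\<gamma>) C1_differentiable_on (?S \<inter> N)"
      using half[of t] t by (metis (no_types, lifting) DiffD1 DiffD2 DiffI greaterThan_iff lessThan_iff mem_Collect_eq open_greaterThan open_lessThan)
  qed
  moreover have "\<exists>w. norm w \<le> max (2 * M1) (2 * M2) \<and> ((\<lambda>s. psi (inv (?\<gamma> t) \<otimes> ?\<gamma> s)) has_vector_derivative w) (at t)"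
    if t: "t \<in> {0..1} - T" for t
  proof -
    have scale: "\<exists>w. norm w \<le> 2 * M \<and> ((\<lambda>s. psi (inv (?\<gamma> t) \<otimes> ?\<gamma> s)) has_vector_derivative w) (at t)"
      if w: "norm w \<le> M" "((\<lambda>s. psi (inv (\<kappa> (2 * t + b)) \<otimes> \<kappa> s)) has_vector_derivative w) (at (2 * t + b))"
      and N: "open N" "t \<in> N" and eq: "\<And>s. s \<in> N \<Longrightarrow> ?\<gamma> s = \<kappa> (2 * s + b)" for M N \<kappa> b and w :: 'e
    proof -
      have "((\<lambda>s. psi (inv (\<kappa> (2 * t + b)) \<otimes> \<kappa> (2 * s + b))) has_vector_derivative 2 *\<^sub>R w) (at t)"
        by (rule has_vector_derivative_affine[OF w(2)])
      then have "((\<lambda>s. psi (inv (?\<gamma> t) \<otimes> ?\<gamma> s)) has_vector_derivative 2 *\<^sub>R w) (at t)"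
        by (rule has_vector_derivative_transform_within_open[OF _ N]) (use eq N in auto)
      then show ?thesis using w(1) by (intro exI[of _ "2 *\<^sub>R w"]) auto
    qed
    show ?thesis
    proof (cases "t < 1/2")
      case True
      then obtain w where "norm w \<le> M1" "((\<lambda>s. psi (inv (\<gamma>1 (2 * t + 0)) \<otimes> \<gamma>1 s)) has_vector_derivative w) (at (2 * t + 0))"
        using T1(3)[OF l[OF t]] by auto
      from scale[OF this, of "{..<1/2}"] show ?thesis using True left by (metis lessThan_iff max.coboundedI1 open_lessThan)
    next
      case False
      then have h: "t > 1/2" using half[OF t] by simp
      then obtain w where "norm w \<le> M2" "((\<lambda>s. psi (inv (\<gamma>2 (2 * t + (-1))) \<otimes> \<gamma>2 s)) has_vector_derivative w) (at (2 * t + (-1)))"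
        using T2(3)[OF r[OF t]] by auto
      from scale[OF this, of "{1/2<..}"] show ?thesis using h right by (metis greaterThan_iff max.coboundedI2 open_greaterThan)
    qed
  qed
  ultimately show ?thesis unfolding tame_def by blast
qed

lemma left_translate_smooth:
  assumes "c' \<in> A"
  shows "open {y \<in> Ch. h \<otimes> par y \<in> fst c'}" "C_k_on k {y \<in> Ch. h \<otimes> par y \<in> fst c'} (\<lambda>y. snd c' (h \<otimes> par y))"
  using Ck_map_on_chart[OF Ck_map_mult[OF Ck_map_const[OF open_Ch] Ck_map_par] assms] by auto

lemma continuous_par: "continuous_on Ch par"
  using chart_facts(4)[OF c_in] by (simp add: Ch_def)

text \<open>A chart segment is smooth, and left translation by \<open>g\<close> does not change the left velocity.\<close>

lemma tame_segment:
  assumes r: "ball e0 r \<subseteq> Ch" and u: "psi u \<in> ball e0 r" "u \<in> fst c"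
  defines "q \<equiv> \<lambda>t. par (e0 + t *\<^sub>R (psi u - e0))"
  shows "tame (\<lambda>t. g \<otimes> q t)"
proof -
  let ?v = "psi u - e0"
  define z where "z t = e0 + t *\<^sub>R ?v" for t
  have inb: "z t \<in> Ch" if "t \<in> {0..1}" for t
  proof -
    have "norm (t *\<^sub>R ?v) \<le> norm ?v" using that by (simp add: mult_left_le_one_le)
    then have "z t \<in> ball e0 r" using u(1) by (auto simp: z_def dist_norm norm_minus_commute)
    then show ?thesis using r by blast
  qed
  have cz: "continuous_on S z" for S unfolding z_def by (intro continuous_intros)
  have q: "q = (\<lambda>t. par (z t))" unfolding q_def z_def ..
  have "continuous_on {0..1} (\<lambda>t. g \<otimes> q t)"
    unfolding q by (intro continuous_mult continuous_intros continuous_on_compose2[OF continuous_par cz]) (use inb in auto)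
  then have "path (\<lambda>t. g \<otimes> q t)" by (simp add: path_def)
  moreover have "(snd c' \<circ> (\<lambda>t. g \<otimes> q t)) C1_differentiable_on ({t\<in>{0..1}. g \<otimes> q t \<in> fst c'} - {})" if c': "c' \<in> A" for c'
  proof -
    let ?f = "\<lambda>y. snd c' (g \<otimes> par y)" and ?O = "{y \<in> Ch. g \<otimes> par y \<in> fst c'}"
    note ls = left_translate_smooth[OF c', where h=g]
    note d = C_k_on_derivative[OF ls(2)[of "Suc 0"] ls(1)]
    have "((snd c' \<circ> (\<lambda>t. g \<otimes> q t)) has_vector_derivative frechet_derivative ?f (at (z t)) ?v) (at t)"
      if "t \<in> {t\<in>{0..1}. g \<otimes> q t \<in> fst c'}" for t
    proof -
      have "z t \<in> ?O" using that inb by (auto simp: q)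
      from has_vector_derivative_along_line[of ?f _ e0 t ?v, OF d(1)[OF this, unfolded z_def]]
      show ?thesis unfolding q z_def comp_def .
    qed
    moreover have "continuous_on {t\<in>{0..1}. g \<otimes> q t \<in> fst c'} (\<lambda>t. frechet_derivative ?f (at (z t)) ?v)"
      by (rule continuous_on_compose2[OF _ cz, of ?O]) (use d(2) inb in \<open>auto simp: q\<close>)
    ultimately show ?thesis unfolding C1_differentiable_on_def
      by (intro exI[of _ "\<lambda>t. frechet_derivative ?f (at (z t)) ?v"]) auto
  qed
  moreover have "\<exists>M. \<forall>t\<in>{0..1} - {}. \<exists>w. norm w \<le> M \<and> ((\<lambda>s. psi (inv (g \<otimes> q t) \<otimes> (g \<otimes> q s))) has_vector_derivative w) (at t)"
  proof -
    have "continuous_on {0..1} (\<lambda>t. MC (z t) ?v)"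
      by (rule continuous_on_compose2[OF C_k_on_imp_continuous_on[OF MC_smooth[of 0]] cz]) (use inb in auto)
    then have "bounded ((\<lambda>t. MC (z t) ?v) ` {0..1})" by (intro compact_imp_bounded compact_continuous_image) auto
    then have "\<exists>M. \<forall>t\<in>{0..1}. norm (MC (z t) ?v) \<le> M" by (simp add: bounded_iff)
    then obtain M where M: "\<And>t. t \<in> {0..1} \<Longrightarrow> norm (MC (z t) ?v) \<le> M" by blast
    have "((\<lambda>s. psi (inv (g \<otimes> q t) \<otimes> (g \<otimes> q s))) has_vector_derivative MC (z t) ?v) (at t)" if t: "t \<in> {0..1}" for t
    proof -
      have "((\<lambda>s. ldiff (z t, e0 + s *\<^sub>R ?v)) has_vector_derivative MC (z t) ?v) (at t)"
        by (rule has_vector_derivative_along_line) (use MC_has_derivative[OF inb[OF t]] in \<open>simp add: z_def\<close>)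
      moreover have "ldiff (z t, e0 + s *\<^sub>R ?v) = psi (inv (g \<otimes> q t) \<otimes> (g \<otimes> q s))" for s
        by (simp add: ldiff_def q z_def inv_mult_group m_assoc cancel_simps)
      ultimately show ?thesis by simp
    qed
    then show ?thesis using M by blast
  qed
  ultimately show ?thesis unfolding tame_def by (intro conjI exI[of _ "{}"]) auto
qed

lemma tame_const: "tame (\<lambda>_. g)"
proof -
  have "(snd c' \<circ> (\<lambda>_::real. g)) C1_differentiable_on S" for c' :: "('g, 'e) chart" and S
    by (auto simp: C1_differentiable_on_def comp_def intro!: exI[of _ "\<lambda>_. 0"])
  moreover have "\<exists>w. norm w \<le> 0 \<and> ((\<lambda>s. psi (inv g \<otimes> g)) has_vector_derivative w) (at t)" for t :: real
    by (intro exI[of _ 0]) auto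
  then have "\<exists>M. \<forall>t\<in>{0..1::real} - {}. \<exists>w. norm w \<le> M \<and> ((\<lambda>s. psi (inv g \<otimes> g)) has_vector_derivative w) (at t)"
    by blast
  ultimately show ?thesis unfolding tame_def by (intro conjI exI[of _ "{}"]) (auto simp: path_def)
qed

text \<open>The group is generated by a chart ball, so any two points are joined by a chain of translated chart segments.\<close>

lemma tame_connected:
  assumes sc: "simply_connected (UNIV :: 'g set)"
  obtains \<gamma> where "tame \<gamma>" "pathstart \<gamma> = x" "pathfinish \<gamma> = y"
proof -
  obtain r where r: "r > 0" "ball e0 r \<subseteq> Ch"
    "\<And>x y. x \<in> ball e0 r \<Longrightarrow> y \<in> ball e0 r \<Longrightarrow> (x, y) \<in> lmult_dom \<and> lmult (x, y) \<in> UNIV"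
    using lmult_ball[of UNIV] by auto
  (* The zero homomorphism, so that word_sum only records a factorization into elements of the ball. *)
  interpret local_hom G A c "\<lambda>_. 0" r
    by unfold_locales (use r in auto)
  have "\<exists>\<gamma>. tame \<gamma> \<and> pathstart \<gamma> = x \<and> pathfinish \<gamma> = x \<otimes> g" if "word_sum G W F g a" for g a
    using that
  proof induction
    case empty
    show ?case by (intro exI[of _ "\<lambda>_. x"]) (simp add: tame_const pathstart_def pathfinish_def)
  next
    case (snoc g a u)
    then obtain \<gamma> where \<gamma>: "tame \<gamma>" "pathstart \<gamma> = x" "pathfinish \<gamma> = x \<otimes> g" by blast
    define q where "q t = par (e0 + t *\<^sub>R (psi u - e0))" for t
    have u: "psi u \<in> ball e0 r" "u \<in> fst c" using snoc.hyps(2) by (auto simp: W_eq)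
    have "tame (\<lambda>t. (x \<otimes> g) \<otimes> q t)" unfolding q_def by (rule tame_segment[OF r(2) u])
    moreover have "q 0 = \<one>" "q 1 = u" using u by (auto simp: q_def par_psi)
    ultimately show ?case using \<gamma> tame_join[of \<gamma> "\<lambda>t. (x \<otimes> g) \<otimes> q t"]
      by (intro exI[of _ "\<gamma> +++ (\<lambda>t. (x \<otimes> g) \<otimes> q t)"]) (auto simp: pathstart_def pathfinish_def joinpaths_def m_assoc)
  qed
  moreover obtain a where "word_sum G W F (inv x \<otimes> y) a" using word_sum_exists[OF sc] by blast
  ultimately have "\<exists>\<gamma>. tame \<gamma> \<and> pathstart \<gamma> = x \<and> pathfinish \<gamma> = y" using cancel_simps(2) by metis
  then show thesis using that by blast
qed

end

section \<open>Homomorphisms and the Riemannian distance\<close>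

lemma inner_product_form_bounds:
  fixes B :: "'e::euclidean_space \<Rightarrow> 'e \<Rightarrow> real"
  assumes B: "inner_product_form B"
  obtains k K where "k > 0" "K > 0" "\<And>v. k * norm v \<le> sqrt (B v v)" "\<And>v. sqrt (B v v) \<le> K * norm v"
proof -
  have bil: "bilinear B" and pos: "\<And>v. v \<noteq> 0 \<Longrightarrow> B v v > 0" using B by (auto simp: inner_product_form_def)
  have scale: "B (a *\<^sub>R v) (a *\<^sub>R v) = a\<^sup>2 * B v v" for a v
    by (simp add: bilinear_lmul[OF bil] bilinear_rmul[OF bil] power2_eq_square)
  have bb: "bounded_bilinear B" using bil by (simp add: bilinear_conv_bounded_bilinear)
  have cont: "continuous_on (sphere 0 1) (\<lambda>v. B v v)"
    by (intro bounded_bilinear.continuous_on[OF bb] continuous_intros)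
  have ne: "sphere (0::'e) 1 \<noteq> {}" by simp
  obtain a where a: "a \<in> sphere 0 1" "\<And>v. v \<in> sphere 0 1 \<Longrightarrow> B a a \<le> B v v"
    using continuous_attains_inf[OF compact_sphere ne cont] by blast
  obtain b where b: "b \<in> sphere 0 1" "\<And>v. v \<in> sphere 0 1 \<Longrightarrow> B v v \<le> B b b"
    using continuous_attains_sup[OF compact_sphere ne cont] by blast
  have "a \<noteq> 0" "b \<noteq> 0" using a(1) b(1) by auto
  then have Ba: "B a a > 0" "B b b > 0" using pos by auto
  have eq: "sqrt (B v v) = norm v * sqrt (B (v /\<^sub>R norm v) (v /\<^sub>R norm v))" if "v \<noteq> 0" for v
  proof -
    have "norm v *\<^sub>R (v /\<^sub>R norm v) = v" using that by simp
    with scale[of "norm v" "v /\<^sub>R norm v"] have "B v v = (norm v)\<^sup>2 * B (v /\<^sub>R norm v) (v /\<^sub>R norm v)" by (simp only:)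
    then show ?thesis by (simp add: real_sqrt_mult)
  qed
  have sph: "v /\<^sub>R norm v \<in> sphere 0 1" if "v \<noteq> 0" for v :: 'e using that by simp
  show thesis
  proof (rule that[of "sqrt (B a a)" "sqrt (B b b)"])
    fix v :: 'e
    have B0: "B 0 0 = 0" using scale[of 0 0] by simp
    show "sqrt (B a a) * norm v \<le> sqrt (B v v)"
    proof (cases "v = 0")
      case False
      have "sqrt (B a a) \<le> sqrt (B (v /\<^sub>R norm v) (v /\<^sub>R norm v))" using a(2)[OF sph[OF False]] by simp
      then have "norm v * sqrt (B a a) \<le> norm v * sqrt (B (v /\<^sub>R norm v) (v /\<^sub>R norm v))" by (intro mult_left_mono) auto
      then show ?thesis unfolding eq[OF False] by (simp only: mult.commute)
    qed (simp add: B0)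
    show "sqrt (B v v) \<le> sqrt (B b b) * norm v"
    proof (cases "v = 0")
      case False
      have "sqrt (B (v /\<^sub>R norm v) (v /\<^sub>R norm v)) \<le> sqrt (B b b)" using b(2)[OF sph[OF False]] by simp
      then have "norm v * sqrt (B (v /\<^sub>R norm v) (v /\<^sub>R norm v)) \<le> norm v * sqrt (B b b)" by (intro mult_left_mono) auto
      then show ?thesis unfolding eq[OF False] by (simp only: mult.commute)
    qed (simp add: B0)
  qed (use Ba in auto)
qed

text \<open>The derivative is measurable as a limit of difference quotients. If its absolute value has infinite integral there is
nothing to prove; otherwise its Lebesgue integral exists and agrees with the gauge integral, to which the fundamental
theorem of calculus applies.\<close>

lemma increment_le_nn_integral_derivative:
  fixes F :: "real \<Rightarrow> real"
  assumes T: "finite T" and cont: "continuous_on {0..1} F"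
    and d: "\<And>t. t \<in> {0<..<1} - T \<Longrightarrow> (F has_vector_derivative F' t) (at t)"
  shows "ennreal \<bar>F 1 - F 0\<bar> \<le> (\<integral>\<^sup>+t. ennreal \<bar>F' t\<bar> * indicator {0..1} t \<partial>lborel)"
proof -
  define D where "D t = (if t \<in> {0<..<1} - T then F' t else 0)" for t
  define N where "N = T \<union> {0, 1}"
  have N: "finite N" using T by (simp add: N_def)
  have hi: "(D has_integral F 1 - F 0) {0..1}"
    by (rule fundamental_theorem_of_calculus_interior_strong[OF T]) (use d cont in \<open>auto simp: D_def\<close>)
  have Dmeas: "D \<in> borel_measurable lborel"
  proof -
    define Fc where "Fc t = F (max 0 (min 1 t))" for t
    have "continuous_on UNIV Fc" unfolding Fc_def
      by (rule continuous_on_compose2[OF cont]) (auto intro!: continuous_intros)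
    then have [measurable]: "Fc \<in> borel_measurable borel" by (rule borel_measurable_continuous_onI)
    define Q where "Q n t = indicator ({0<..<1} - T) t * (real (Suc n) * (Fc (t + 1 / real (Suc n)) - Fc t))" for n t
    have "Q n \<in> borel_measurable lborel" for n
    proof -
      have [measurable]: "{0<..<1} - T \<in> sets borel" using T by (intro sets.Diff) (auto intro: finite_imp_closed borel_closed)
      show ?thesis unfolding Q_def by measurable
    qed
    moreover have "(\<lambda>n. Q n t) \<longlonglongrightarrow> D t" for t
    proof (cases "t \<in> {0<..<1} - T")
      case False then show ?thesis by (auto simp: Q_def D_def)
    next
      case True
      have "(F has_real_derivative F' t) (at t)" using d[OF True] by (simp add: has_real_derivative_iff_has_vector_derivative)
      then have "((\<lambda>h. (F (t + h) - F t) / h) \<longlongrightarrow> F' t) (at 0)" by (simp add: DERIV_def)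
      moreover have "filterlim (\<lambda>n. 1 / real (Suc n)) (at 0) sequentially"
        by (rule filterlim_atI) (use LIMSEQ_inverse_real_of_nat in \<open>auto simp: inverse_eq_divide\<close>)
      ultimately have "(\<lambda>n. (F (t + 1 / real (Suc n)) - F t) / (1 / real (Suc n))) \<longlonglongrightarrow> F' t"
        by (rule filterlim_compose)
      moreover have "\<forall>\<^sub>F n in sequentially. Q n t = (F (t + 1 / real (Suc n)) - F t) / (1 / real (Suc n))"
      proof -
        have "(\<lambda>n. 1 / real (Suc n)) \<longlonglongrightarrow> 0" using LIMSEQ_inverse_real_of_nat by (simp add: inverse_eq_divide)
        then have "\<forall>\<^sub>F n in sequentially. 1 / real (Suc n) < 1 - t" using order_tendstoD(2) True by fastforce
        then show ?thesis
        proof eventually_elim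
          case (elim n)
          have "0 < 1 / real (Suc n)" by simp
          then have "Fc (t + 1 / real (Suc n)) = F (t + 1 / real (Suc n))" "Fc t = F t"
            using elim True by (auto simp: Fc_def max_def min_def)
          then show ?case using True by (simp add: Q_def)
        qed
      qed
      ultimately have "(\<lambda>n. Q n t) \<longlonglongrightarrow> F' t" by (simp add: filterlim_cong)
      then show ?thesis using True by (simp add: D_def)
    qed
    ultimately show ?thesis by (rule borel_measurable_LIMSEQ_real[rotated])
  qed
  have "(\<integral>\<^sup>+t. ennreal \<bar>D t * indicator {0..1} t\<bar> \<partial>lborel) \<le> (\<integral>\<^sup>+t. ennreal \<bar>F' t\<bar> * indicator {0..1} t \<partial>lborel)"
    by (intro nn_integral_mono) (auto simp: D_def indicator_def)
  moreover have "ennreal \<bar>F 1 - F 0\<bar> \<le> (\<integral>\<^sup>+t. ennreal \<bar>D t * indicator {0..1} t\<bar> \<partial>lborel)"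
  proof (cases "(\<integral>\<^sup>+t. ennreal \<bar>D t * indicator {0..1} t\<bar> \<partial>lborel) = \<infinity>")
    case False
    have [measurable]: "(\<lambda>t. D t * indicator {0..1} t) \<in> borel_measurable lborel" using Dmeas by measurable
    have int: "integrable lborel (\<lambda>t. D t * indicator {0..1} t)"
      using False by (intro integrableI_bounded) (auto simp: less_top)
    have "((\<lambda>t. D t * indicator {0..1} t) has_integral integral\<^sup>L lborel (\<lambda>t. D t * indicator {0..1} t)) UNIV"
      by (rule has_integral_integral_lborel[OF int])
    moreover have "((\<lambda>t. D t * indicator {0..1} t) has_integral F 1 - F 0) UNIV"
    proof -
      have "((\<lambda>t. if t \<in> {0..1} then D t else 0) has_integral F 1 - F 0) UNIV"
        using hi unfolding has_integral_restrict_UNIV .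
      then show ?thesis by (rule has_integral_eq[rotated]) (auto simp: indicator_def)
    qed
    ultimately have "F 1 - F 0 = integral\<^sup>L lborel (\<lambda>t. D t * indicator {0..1} t)" using has_integral_unique by blast
    then have "\<bar>F 1 - F 0\<bar> \<le> integral\<^sup>L lborel (\<lambda>t. \<bar>D t * indicator {0..1} t\<bar>)"
      using integral_norm_bound[of lborel "\<lambda>t. D t * indicator {0..1} t"] by simp
    then have "ennreal \<bar>F 1 - F 0\<bar> \<le> ennreal (integral\<^sup>L lborel (\<lambda>t. \<bar>D t * indicator {0..1} t\<bar>))" by (rule ennreal_leI)
    also have "\<dots> = (\<integral>\<^sup>+t. ennreal \<bar>D t * indicator {0..1} t\<bar> \<partial>lborel)"
      by (rule nn_integral_eq_integral[symmetric]) (use int in auto)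
    finally show ?thesis .
  qed simp
  ultimately show ?thesis by (rule order_trans[rotated])
qed

context lie_chart
begin

abbreviation rdist :: "('e \<Rightarrow> 'e \<Rightarrow> real) \<Rightarrow> 'g \<Rightarrow> 'g \<Rightarrow> real" where
  "rdist B \<equiv> riemannian_dist G A c B"

lemma rdist_nonneg: "rdist B x y \<ge> 0" by (simp add: riemannian_dist_def)

lemma tame_imp_piecewise_C1: "tame \<gamma> \<Longrightarrow> piecewise_C1_curve A \<gamma>"
  unfolding tame_def piecewise_C1_curve_def by blast

lemma tame_finite_length:
  assumes B: "inner_product_form B" and \<gamma>: "tame \<gamma>"
  shows "riemannian_length G c B \<gamma> < \<infinity>"
proof -
  obtain k K where K: "k > 0" "K > 0" "\<And>v. k * norm v \<le> sqrt (B v v)" "\<And>v. sqrt (B v v) \<le> K * norm v"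
    using inner_product_form_bounds[OF B] by metis
  obtain T M where T: "finite T"
    "\<And>t. t \<in> {0..1} - T \<Longrightarrow> \<exists>w. norm w \<le> M \<and> ((\<lambda>s. psi (inv (\<gamma> t) \<otimes> \<gamma> s)) has_vector_derivative w) (at t)"
    using \<gamma> unfolding tame_def by blast
  have lv: "norm (left_velocity G c \<gamma> t) \<le> M" if t: "t \<in> {0..1} - T" for t
    using T(2)[OF t] unfolding left_velocity_def by (auto simp: vector_derivative_at)
  let ?f = "\<lambda>t. ennreal (sqrt (B (left_velocity G c \<gamma> t) (left_velocity G c \<gamma> t))) * indicator {0..1} t"
  have "AE t in lborel. ?f t \<le> ennreal (K * \<bar>M\<bar>) * indicator {0..1} t"
  proof -
    have "AE t in lborel. t \<notin> T"
      using T(1) by (intro AE_not_in) (auto simp: null_sets_def finite_imp_closed emeasure_lborel_countable[OF countable_finite])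
    then show ?thesis
    proof eventually_elim
      case (elim t)
      show ?case
      proof (cases "t \<in> {0..1}")
        case True
        then have "norm (left_velocity G c \<gamma> t) \<le> \<bar>M\<bar>" using lv[of t] elim by auto
        then have "sqrt (B (left_velocity G c \<gamma> t) (left_velocity G c \<gamma> t)) \<le> K * \<bar>M\<bar>"
          using K(4) K(2) by (meson less_imp_le mult_left_mono order_trans)
        then show ?thesis using True by (simp add: ennreal_leI)
      qed simp
    qed
  qed
  from nn_integral_mono_AE[OF this]
  have "riemannian_length G c B \<gamma> \<le> (\<integral>\<^sup>+t. ennreal (K * \<bar>M\<bar>) * indicator {0..1} t \<partial>(lborel :: real measure))"
    unfolding riemannian_length_def .
  also have "\<dots> = ennreal (K * \<bar>M\<bar>)" by (simp add: nn_integral_cmult_indicator)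
  finally show ?thesis by (simp add: le_less_trans)
qed

lemma rdist_le_length:
  assumes "piecewise_C1_curve A \<gamma>" "pathstart \<gamma> = x" "pathfinish \<gamma> = y"
    "riemannian_length G c B \<gamma> \<le> ennreal l" "l \<ge> 0"
  shows "rdist B x y \<le> l"
proof -
  have "(INF \<gamma>\<in>{\<gamma>. piecewise_C1_curve A \<gamma> \<and> pathstart \<gamma> = x \<and> pathfinish \<gamma> = y}. riemannian_length G c B \<gamma>) \<le> ennreal l"
    using assms by (intro INF_lower2[of \<gamma>]) auto
  then show ?thesis unfolding riemannian_dist_def using assms(5) by (simp add: enn2real_leI)
qed

text \<open>Near time \<open>t\<close> one has \<open>\<pi> (\<gamma> s) = \<pi> (\<gamma> t) + \<pi> (inv (\<gamma> t) \<otimes> \<gamma> s)\<close>, so only the derivative of \<open>\<pi>\<close> at the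
identity enters.\<close>

lemma homomorphism_along_curve:
  fixes \<pi> :: "'g \<Rightarrow> real"
  assumes hom: "\<And>g h. \<pi> (g \<otimes> h) = \<pi> g + \<pi> h" and d: "((\<lambda>x. \<pi> (par x)) has_derivative \<mu>) (at e0)"
    and c': "c' \<in> A" and N: "open N" "t \<in> N" "\<And>s. s \<in> N \<Longrightarrow> \<gamma> s \<in> fst c'" and cont: "continuous_on N \<gamma>"
    and diff: "(snd c' \<circ> \<gamma>) differentiable (at t)"
  shows "((\<lambda>s. \<pi> (\<gamma> s)) has_vector_derivative \<mu> (left_velocity G c \<gamma> t)) (at t)"
proof -
  let ?g = "inv (\<gamma> t)"
  let ?O = "{y \<in> snd c' ` fst c'. ?g \<otimes> chart_param c' y \<in> fst c}"
  have sm: "open ?O" "C_k_on (Suc 0) ?O (\<lambda>y. psi (?g \<otimes> chart_param c' y))"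
    using Ck_map_on_chart[OF Ck_map_mult[OF Ck_map_const[OF chart_facts(2)[OF c']] Ck_map_param[OF c']] c_in] by auto
  have tO: "snd c' (\<gamma> t) \<in> ?O" using N c' one_in by (auto simp: chart_facts(5) l_inv)
  obtain w where w: "((snd c' \<circ> \<gamma>) has_vector_derivative w) (at t)"
    using diff vector_derivative_works by blast
  have "((\<lambda>s. psi (?g \<otimes> chart_param c' ((snd c' \<circ> \<gamma>) s))) has_derivative
      (\<lambda>h. frechet_derivative (\<lambda>y. psi (?g \<otimes> chart_param c' y)) (at ((snd c' \<circ> \<gamma>) t)) (h *\<^sub>R w))) (at t)"
    by (rule has_derivative_compose[OF w[unfolded has_vector_derivative_def] C_k_on_derivative(1)[OF sm(2,1)]]) (use tO in simp)
  then have "((\<lambda>s. psi (?g \<otimes> \<gamma> s)) has_derivative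
      (\<lambda>h. frechet_derivative (\<lambda>y. psi (?g \<otimes> chart_param c' y)) (at ((snd c' \<circ> \<gamma>) t)) (h *\<^sub>R w))) (at t)"
    by (rule has_derivative_transform_within_open[OF _ N(1,2)]) (use N(3) chart_facts(5)[OF c'] in auto)
  then have "(\<lambda>s. psi (?g \<otimes> \<gamma> s)) differentiable (at t)" unfolding differentiable_def by blast
  then have lv: "((\<lambda>s. psi (?g \<otimes> \<gamma> s)) has_vector_derivative left_velocity G c \<gamma> t) (at t)"
    unfolding left_velocity_def using vector_derivative_works by blast
  have at0: "psi (?g \<otimes> \<gamma> t) = e0" by (simp add: l_inv)
  have "((\<lambda>s. \<pi> (par (psi (?g \<otimes> \<gamma> s)))) has_derivative (\<lambda>h. \<mu> (h *\<^sub>R left_velocity G c \<gamma> t))) (at t)"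
    using has_derivative_compose[OF lv[unfolded has_vector_derivative_def], of "\<lambda>x. \<pi> (par x)" \<mu>] d at0 by simp
  then have 1: "((\<lambda>s. \<pi> (\<gamma> t) + \<pi> (par (psi (?g \<otimes> \<gamma> s)))) has_derivative (\<lambda>h. \<mu> (h *\<^sub>R left_velocity G c \<gamma> t))) (at t)"
    using has_derivative_add[OF has_derivative_const[of "\<pi> (\<gamma> t)"]] by fastforce
  let ?N = "N \<inter> (\<lambda>s. ?g \<otimes> \<gamma> s) -` fst c"
  have "continuous_on N (\<lambda>s. ?g \<otimes> \<gamma> s)" by (intro continuous_mult continuous_on_const cont)
  then have N': "open ?N" "t \<in> ?N"
    using continuous_open_preimage[OF _ N(1) chart_facts(1)[OF c_in]] N(2) one_in by (auto simp: l_inv)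
  have "((\<lambda>s. \<pi> (\<gamma> s)) has_derivative (\<lambda>h. \<mu> (h *\<^sub>R left_velocity G c \<gamma> t))) (at t)"
  proof (rule has_derivative_transform_within_open[OF 1 N'])
    fix s assume "s \<in> ?N"
    then have "\<pi> (\<gamma> t) + \<pi> (par (psi (?g \<otimes> \<gamma> s))) = \<pi> (\<gamma> t \<otimes> (?g \<otimes> \<gamma> s))" by (simp add: hom par_psi)
    then show "\<pi> (\<gamma> t) + \<pi> (par (psi (?g \<otimes> \<gamma> s))) = \<pi> (\<gamma> s)" by (simp add: cancel_simps)
  qed
  moreover have "linear \<mu>" using d has_derivative_linear by blast
  ultimately show ?thesis by (simp add: has_vector_derivative_def linear_scale)
qed

text \<open>The derivative of \<open>\<pi>\<close> along a curve is at most \<open>K\<close> times its speed, so \<open>\<pi>\<close> changes by at most \<open>K\<close> times the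
length. The bound passes to the distance because some curve between the points has finite length; if the infimum of
the lengths were infinite, the distance would be \<open>0\<close> by the convention for \<open>enn2real\<close>.\<close>

theorem homomorphism_lipschitz:
  fixes \<pi> :: "'g \<Rightarrow> real"
  assumes sc: "simply_connected (UNIV :: 'g set)" and B: "inner_product_form B"
    and hom: "\<And>g h. \<pi> (g \<otimes> h) = \<pi> g + \<pi> h" and cont: "continuous_on UNIV \<pi>"
    and d: "((\<lambda>x. \<pi> (par x)) has_derivative \<mu>) (at e0)"
  obtains K where "K > 0" "\<And>x y. \<bar>\<pi> x - \<pi> y\<bar> \<le> K * rdist B x y"
proof -
  obtain k K0 where k: "k > 0" "\<And>v. k * norm v \<le> sqrt (B v v)"
    using inner_product_form_bounds[OF B] by metis
  have bl: "bounded_linear \<mu>" using d has_derivative_bounded_linear by blast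
  obtain M where M: "M > 0" "\<And>v. norm (\<mu> v) \<le> norm v * M" using bounded_linear.pos_bounded[OF bl] by blast
  define K where "K = M / k"
  have K: "K > 0" using M k by (simp add: K_def)
  have \<mu>K: "\<bar>\<mu> v\<bar> \<le> K * sqrt (B v v)" for v
  proof -
    have "\<bar>\<mu> v\<bar> \<le> M * norm v" using M(2)[of v] by (simp add: mult.commute)
    also have "\<dots> = K * (k * norm v)" using k by (simp add: K_def)
    also have "\<dots> \<le> K * sqrt (B v v)" using K k(2) by (intro mult_left_mono) auto
    finally show ?thesis .
  qed
  have len: "ennreal (\<bar>\<pi> x - \<pi> y\<bar> / K) \<le> riemannian_length G c B \<gamma>"
    if \<gamma>: "piecewise_C1_curve A \<gamma>" "pathstart \<gamma> = x" "pathfinish \<gamma> = y" for \<gamma> x y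
  proof -
    obtain T where T: "finite T" "\<And>c'. c' \<in> A \<Longrightarrow> (snd c' \<circ> \<gamma>) C1_differentiable_on ({t\<in>{0..1}. \<gamma> t \<in> fst c'} - T)"
      using \<gamma> unfolding piecewise_C1_curve_def by blast
    have c\<gamma>: "continuous_on {0..1} \<gamma>" using \<gamma>(1) by (simp add: piecewise_C1_curve_def path_def)
    have "((\<lambda>s. \<pi> (\<gamma> s)) has_vector_derivative \<mu> (left_velocity G c \<gamma> t)) (at t)" if t: "t \<in> {0<..<1} - T" for t
    proof -
      obtain c' where c': "c' \<in> A" "\<gamma> t \<in> fst c'" using chart_at by blast
      have c2: "continuous_on {0<..<1} \<gamma>" by (rule continuous_on_subset[OF c\<gamma>]) auto
      let ?N = "{0<..<1} \<inter> \<gamma> -` fst c'"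
      have "open ?N" by (rule continuous_open_preimage[OF c2 _ chart_facts(1)[OF c'(1)]]) simp
      moreover have "(snd c' \<circ> \<gamma>) differentiable (at t)"
        using T(2)[OF c'(1)] t c'(2) by (auto simp: C1_differentiable_on_eq)
      ultimately show ?thesis
        using continuous_on_subset[OF c2, of ?N] t c'
        by (intro homomorphism_along_curve[OF hom d c'(1), of ?N]) auto
    qed
    then have "((\<lambda>s. \<pi> (\<gamma> s) / K) has_vector_derivative \<mu> (left_velocity G c \<gamma> t) / K) (at t)" if "t \<in> {0<..<1} - T" for t
      using has_vector_derivative_divide that by blast
    moreover have "continuous_on {0..1} (\<lambda>s. \<pi> (\<gamma> s) / K)"
      using K by (intro continuous_on_divide continuous_on_const continuous_on_compose2[OF cont c\<gamma>]) auto
    ultimately have "ennreal \<bar>\<pi> (\<gamma> 1) / K - \<pi> (\<gamma> 0) / K\<bar>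
        \<le> (\<integral>\<^sup>+t. ennreal \<bar>\<mu> (left_velocity G c \<gamma> t) / K\<bar> * indicator {0..1} t \<partial>lborel)"
      by (intro increment_le_nn_integral_derivative[OF T(1)])
    also have "\<dots> \<le> riemannian_length G c B \<gamma>"
      unfolding riemannian_length_def
      using K \<mu>K by (intro nn_integral_mono mult_right_mono ennreal_leI) (auto simp: field_simps)
    finally have "ennreal \<bar>\<pi> y / K - \<pi> x / K\<bar> \<le> riemannian_length G c B \<gamma>"
      using \<gamma> by (simp add: pathstart_def pathfinish_def)
    moreover have "\<bar>\<pi> y / K - \<pi> x / K\<bar> = \<bar>\<pi> x - \<pi> y\<bar> / K"
      using K by (simp add: diff_divide_distrib[symmetric] abs_divide abs_minus_commute)
    ultimately show ?thesis by simp
  qed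
  have "\<bar>\<pi> x - \<pi> y\<bar> \<le> K * rdist B x y" for x y
  proof -
    let ?S = "{\<gamma>. piecewise_C1_curve A \<gamma> \<and> pathstart \<gamma> = x \<and> pathfinish \<gamma> = y}"
    let ?I = "INF \<gamma>\<in>?S. riemannian_length G c B \<gamma>"
    obtain \<gamma> where \<gamma>: "tame \<gamma>" "pathstart \<gamma> = x" "pathfinish \<gamma> = y" by (rule tame_connected[OF sc])
    then have "?I \<le> riemannian_length G c B \<gamma>" by (intro INF_lower) (auto simp: tame_imp_piecewise_C1)
    then have fin: "?I < \<infinity>" using tame_finite_length[OF B \<gamma>(1)] by (rule le_less_trans)
    have "ennreal (\<bar>\<pi> x - \<pi> y\<bar> / K) \<le> ?I"
      by (rule INF_greatest) (use len in blast)
    also have "?I = ennreal (rdist B x y)" using fin by (simp add: riemannian_dist_def less_top)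
    finally have "\<bar>\<pi> x - \<pi> y\<bar> / K \<le> rdist B x y" by (simp add: rdist_nonneg)
    then show ?thesis using K by (simp add: field_simps)
  qed
  then show thesis using that K by blast
qed

end

section \<open>Flats in a group\<close>

lemma additive_derivative_linear:
  fixes a :: "real \<Rightarrow> real"
  assumes add: "\<And>s t. a (s + t) = a s + a t" and d: "(a has_vector_derivative k) (at 0)"
  shows "a t = t * k"
proof -
  have "((\<lambda>t. a t - t * k) has_derivative (\<lambda>h. 0)) (at t)" for t
  proof -
    have "((\<lambda>s. a (s - t)) has_vector_derivative k) (at t)"
      using has_vector_derivative_shift[of a k t "- t"] d by simp
    then have "((\<lambda>s. a t + a (s - t)) has_vector_derivative k) (at t)" by (auto intro!: derivative_eq_intros)
    moreover have "a t + a (s - t) = a s" for s using add[of t "s - t"] by simp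
    ultimately have "(a has_vector_derivative k) (at t)" by simp
    moreover have "((\<lambda>s. s * k) has_vector_derivative k) (at t)"
      unfolding has_real_derivative_iff_has_vector_derivative[symmetric] by (auto intro!: derivative_eq_intros)
    ultimately have "((\<lambda>t. a t - t * k) has_vector_derivative k - k) (at t)" by (rule has_vector_derivative_diff)
    then show ?thesis by (simp add: has_vector_derivative_def)
  qed
  then obtain c where c: "\<And>t. a t - t * k = c"
    using has_derivative_zero_constant[of UNIV "\<lambda>t. a t - t * k"] by auto
  have "a 0 = 0" using add[of 0 0] by simp
  then have "c = 0" using c[of 0] by simp
  then show ?thesis using c[of t] by simp
qed

context lie_chart
begin

lemma one_parameter_zero: "one_parameter v \<Gamma> \<Longrightarrow> \<Gamma> 0 = \<one>"
proof -
  assume "one_parameter v \<Gamma>"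
  then have "\<Gamma> (0 + 0) = \<Gamma> 0 \<otimes> \<Gamma> 0" unfolding one_parameter_def by blast
  then have "\<Gamma> 0 = \<Gamma> 0 \<otimes> \<Gamma> 0" by simp
  then show "\<Gamma> 0 = \<one>" by (metis in_carrier l_cancel_one')
qed

lemma one_parameter_continuous:
  assumes \<Gamma>: "one_parameter v \<Gamma>"
  shows "continuous_on UNIV \<Gamma>"
proof -
  obtain \<delta> where \<delta>: "\<delta> > 0" "\<And>t. \<bar>t\<bar> < \<delta> \<Longrightarrow> \<Gamma> t \<in> fst c" using \<Gamma> unfolding one_parameter_def by blast
  have G: "\<Gamma> (s + t) = \<Gamma> s \<otimes> \<Gamma> t" for s t using \<Gamma> by (simp add: one_parameter_def)
  have "isCont (\<lambda>t. psi (\<Gamma> t)) 0"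
    using \<Gamma> has_vector_derivative_continuous unfolding one_parameter_def by blast
  moreover have "isCont par (psi (\<Gamma> 0))"
    using continuous_par open_Ch by (simp add: continuous_on_eq_continuous_at one_parameter_zero[OF \<Gamma>])
  ultimately have "isCont (\<lambda>t. par (psi (\<Gamma> t))) 0" by (rule isCont_o2)
  moreover have "\<forall>\<^sub>F t in nhds 0. par (psi (\<Gamma> t)) = \<Gamma> t"
    unfolding eventually_nhds
    by (intro exI[of _ "{- \<delta><..<\<delta>}"]) (use \<delta> par_psi in \<open>auto simp: abs_less_iff\<close>)
  ultimately have c0: "isCont \<Gamma> 0" by (simp add: isCont_cong)
  have "isCont \<Gamma> t" for t
  proof -
    have "isCont (\<lambda>s. s - t) t" by (intro continuous_intros)
    then have "isCont (\<lambda>s. \<Gamma> (s - t)) t" using isCont_o2[of t "\<lambda>s. s - t" \<Gamma>] c0 by simp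
    moreover have "isCont (\<lambda>y. \<Gamma> t \<otimes> y) (\<Gamma> (t - t))"
      using continuous_mult[OF continuous_on_const continuous_on_id, of UNIV "\<Gamma> t"]
      by (simp add: continuous_on_eq_continuous_at)
    ultimately have "isCont (\<lambda>s. \<Gamma> t \<otimes> \<Gamma> (s - t)) t" by (rule isCont_o2)
    moreover have "\<Gamma> t \<otimes> \<Gamma> (s - t) = \<Gamma> s" for s using G[of t "s - t"] by simp
    ultimately show ?thesis by simp
  qed
  then show ?thesis by (simp add: continuous_at_imp_continuous_on)
qed

lemma continuous_near_one:
  assumes "continuous_on UNIV (\<Gamma> :: real \<Rightarrow> 'g)" "\<Gamma> 0 = \<one>"
  obtains \<delta> where "\<delta> > 0" "\<And>t. \<bar>t\<bar> < \<delta> \<Longrightarrow> \<Gamma> t \<in> fst c"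
proof -
  have "open (\<Gamma> -` fst c)" using open_vimage[OF chart_facts(1)[OF c_in] assms(1)] .
  then have "\<forall>x\<in>\<Gamma> -` fst c. \<exists>\<delta>>0. ball x \<delta> \<subseteq> \<Gamma> -` fst c" by (simp only: open_contains_ball)
  moreover have "0 \<in> \<Gamma> -` fst c" using assms(2) one_in by simp
  ultimately obtain \<delta> where "\<delta> > 0" "ball 0 \<delta> \<subseteq> \<Gamma> -` fst c" by blast
  then show thesis by (intro that[of \<delta>]) (auto simp: subset_iff)
qed

lemma one_parameter_trivial: "one_parameter 0 (\<lambda>_. \<one>)"
  unfolding one_parameter_def using one_in by (auto intro!: exI[of _ 1])

lemma one_parameter_scale:
  assumes \<Gamma>: "one_parameter v \<Gamma>"
  shows "one_parameter (a *\<^sub>R v) (\<lambda>t. \<Gamma> (t * a))"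
proof -
  have "((\<lambda>t. psi (\<Gamma> (t * a))) has_vector_derivative a *\<^sub>R v) (at 0)"
    using has_vector_derivative_affine[of "\<lambda>t. psi (\<Gamma> t)" v a 0 0] \<Gamma>
    by (simp add: one_parameter_def mult.commute)
  moreover have "continuous_on UNIV (\<lambda>t. \<Gamma> (t * a))"
    by (rule continuous_on_compose2[OF one_parameter_continuous[OF \<Gamma>]]) (auto intro!: continuous_intros)
  then obtain \<delta> where "\<delta> > 0" "\<And>t. \<bar>t\<bar> < \<delta> \<Longrightarrow> \<Gamma> (t * a) \<in> fst c"
    using continuous_near_one[of "\<lambda>t. \<Gamma> (t * a)"] one_parameter_zero[OF \<Gamma>] by auto
  moreover have "\<Gamma> ((s + t) * a) = \<Gamma> (s * a) \<otimes> \<Gamma> (t * a)" for s t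
    using \<Gamma> by (simp add: one_parameter_def distrib_right)
  ultimately show ?thesis unfolding one_parameter_def by blast
qed

text \<open>The derivative of the multiplication at the identity is addition.\<close>

lemma one_parameter_mult:
  assumes \<Gamma>: "one_parameter v \<Gamma>" and \<Delta>: "one_parameter w \<Delta>" and comm: "\<And>s t. \<Gamma> s \<otimes> \<Delta> t = \<Delta> t \<otimes> \<Gamma> s"
  shows "one_parameter (v + w) (\<lambda>t. \<Gamma> t \<otimes> \<Delta> t)"
proof -
  have G: "\<Gamma> (s + t) = \<Gamma> s \<otimes> \<Gamma> t" and D: "\<Delta> (s + t) = \<Delta> s \<otimes> \<Delta> t" for s t
    using \<Gamma> \<Delta> by (auto simp: one_parameter_def)
  have hom: "\<Gamma> (s + t) \<otimes> \<Delta> (s + t) = (\<Gamma> s \<otimes> \<Delta> s) \<otimes> (\<Gamma> t \<otimes> \<Delta> t)" for s t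
  proof -
    have "\<Gamma> (s + t) \<otimes> \<Delta> (s + t) = \<Gamma> s \<otimes> ((\<Gamma> t \<otimes> \<Delta> s) \<otimes> \<Delta> t)" by (simp add: G D m_assoc)
    also have "\<dots> = (\<Gamma> s \<otimes> \<Delta> s) \<otimes> (\<Gamma> t \<otimes> \<Delta> t)" unfolding comm[of t s] by (simp add: m_assoc)
    finally show ?thesis .
  qed
  have zero: "\<Gamma> 0 = \<one>" "\<Delta> 0 = \<one>" using one_parameter_zero[OF \<Gamma>] one_parameter_zero[OF \<Delta>] by simp_all
  have cG: "continuous_on UNIV \<Gamma>" and cD: "continuous_on UNIV \<Delta>" using one_parameter_continuous[OF \<Gamma>] one_parameter_continuous[OF \<Delta>] by simp_all
  have "continuous_on UNIV (\<lambda>t. \<Gamma> t \<otimes> \<Delta> t)" by (intro continuous_mult cG cD)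
  then obtain \<delta> where \<delta>: "\<delta> > 0" "\<And>t. \<bar>t\<bar> < \<delta> \<Longrightarrow> \<Gamma> t \<otimes> \<Delta> t \<in> fst c"
    using continuous_near_one[of "\<lambda>t. \<Gamma> t \<otimes> \<Delta> t"] zero by auto
  obtain \<delta>1 where \<delta>1: "\<delta>1 > 0" "\<And>t. \<bar>t\<bar> < \<delta>1 \<Longrightarrow> \<Gamma> t \<in> fst c" using continuous_near_one[OF cG zero(1)] by blast
  obtain \<delta>2 where \<delta>2: "\<delta>2 > 0" "\<And>t. \<bar>t\<bar> < \<delta>2 \<Longrightarrow> \<Delta> t \<in> fst c" using continuous_near_one[OF cD zero(2)] by blast
  let ?D = "frechet_derivative lmult (at (e0, e0))"
  have dp: "((\<lambda>t. (psi (\<Gamma> t), psi (\<Delta> t))) has_derivative (\<lambda>h. (h *\<^sub>R v, h *\<^sub>R w))) (at 0)"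
    using \<Gamma> \<Delta> unfolding one_parameter_def has_vector_derivative_def by (intro has_derivative_Pair) auto
  have "((\<lambda>t. lmult (psi (\<Gamma> t), psi (\<Delta> t))) has_derivative (\<lambda>h. ?D (h *\<^sub>R v, h *\<^sub>R w))) (at 0)"
    using has_derivative_compose[OF dp, of lmult] lmult_has_derivative[OF lmult_dom_e0[OF e0_in]] zero by simp
  moreover have "?D (h *\<^sub>R v, h *\<^sub>R w) = h *\<^sub>R (v + w)" for h
  proof -
    have lin: "linear ?D" using lmult_has_derivative[OF lmult_dom_e0[OF e0_in]] has_derivative_linear by blast
    have "?D (0, u) = u" for u using X_e0[of u] by (simp add: X_def)
    moreover have "?D (u, 0) = u" for u
    proof -
      have "((\<lambda>x. lmult (x, e0)) has_derivative (\<lambda>h. h)) (at e0)"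
        by (rule has_derivative_transform_within_open[OF has_derivative_ident open_Ch e0_in]) (simp add: lmult_e0)
      then show ?thesis using has_derivative_unique[OF right_mult_has_derivative[OF lmult_dom_e0[OF e0_in]]] by metis
    qed
    moreover have "?D (v, w) = ?D (v, 0) + ?D (0, w)" using linear_add[OF lin, of "(v, 0)" "(0, w)"] by simp
    moreover have "?D (h *\<^sub>R v, h *\<^sub>R w) = h *\<^sub>R ?D (v, w)" using linear_scale[OF lin, of h "(v, w)"] by simp
    ultimately show ?thesis by simp
  qed
  ultimately have dl: "((\<lambda>t. lmult (psi (\<Gamma> t), psi (\<Delta> t))) has_vector_derivative v + w) (at 0)"
    by (simp add: has_vector_derivative_def)
  have "((\<lambda>t. psi (\<Gamma> t \<otimes> \<Delta> t)) has_vector_derivative v + w) (at 0)"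
  proof (rule has_vector_derivative_transform_within_open[OF dl, of "{- min \<delta>1 \<delta>2<..<min \<delta>1 \<delta>2}"])
    fix t assume "t \<in> {- min \<delta>1 \<delta>2<..<min \<delta>1 \<delta>2}"
    then have "\<bar>t\<bar> < \<delta>1" "\<bar>t\<bar> < \<delta>2" by auto
    then show "lmult (psi (\<Gamma> t), psi (\<Delta> t)) = psi (\<Gamma> t \<otimes> \<Delta> t)"
      using \<delta>1(2) \<delta>2(2) by (simp add: lmult_def par_psi)
  qed (use \<delta>1 \<delta>2 in auto)
  then show ?thesis unfolding one_parameter_def using hom \<delta> by blast
qed

text \<open>The curve \<open>t \<mapsto> g \<otimes> \<Gamma> t\<close> has the constant left velocity \<open>v\<close>.\<close>

lemma one_parameter_dist:
  assumes \<Gamma>: "one_parameter v \<Gamma>" and B: "inner_product_form B"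
  shows "rdist B g (g \<otimes> \<Gamma> 1) \<le> sqrt (B v v)"
proof -
  let ?\<gamma> = "\<lambda>t. g \<otimes> \<Gamma> t"
  have G: "\<Gamma> (s + t) = \<Gamma> s \<otimes> \<Gamma> t" for s t using \<Gamma> by (simp add: one_parameter_def)
  have zero: "\<Gamma> 0 = \<one>" by (rule one_parameter_zero[OF \<Gamma>])
  have invG: "inv (\<Gamma> t) \<otimes> \<Gamma> s = \<Gamma> (s - t)" for s t
    using G[of t "s - t"] by (simp add: cancel_simps)
  have c\<gamma>: "continuous_on UNIV ?\<gamma>" by (intro continuous_mult continuous_on_const one_parameter_continuous[OF \<Gamma>])
  have shift: "((\<lambda>s. psi (\<Gamma> (s - t))) has_vector_derivative v) (at t)" for t
    using has_vector_derivative_shift[of "\<lambda>t. psi (\<Gamma> t)" v t "- t"] \<Gamma> by (simp add: one_parameter_def)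
  (* In an arbitrary chart the curve is an integral curve of the continuous vector field Z. *)
  have C1: "(snd c' \<circ> ?\<gamma>) C1_differentiable_on {t\<in>{0..1}. ?\<gamma> t \<in> fst c'}" if c': "c' \<in> A" for c'
  proof -
    let ?O = "snd c' ` fst c'"
    let ?k = "\<lambda>z :: 'e \<times> 'e. snd c' (chart_param c' (fst z) \<otimes> par (snd z))"
    let ?dom = "{z \<in> ?O \<times> Ch. chart_param c' (fst z) \<otimes> par (snd z) \<in> fst c'}"
    have O: "open ?O" by (rule chart_facts(2)[OF c'])
    have m1: "Ck_map k (?O \<times> Ch) (\<lambda>z. chart_param c' (fst z))" for k
      by (rule Ck_map_compose[OF Ck_map_param[OF c']]) (auto intro: C_k_on_linear bounded_linear_fst open_Times O open_Ch)
    have m2: "Ck_map k (?O \<times> Ch) (\<lambda>z. par (snd z))" for k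
      by (rule Ck_map_compose[OF Ck_map_par]) (auto intro: C_k_on_linear bounded_linear_snd open_Times O open_Ch)
    have sm: "open ?dom" "C_k_on k ?dom ?k" for k using Ck_map_on_chart[OF Ck_map_mult[OF m1 m2] c'] by auto
    define Z where "Z x = frechet_derivative ?k (at (x, e0)) (0, v)" for x
    have inO: "(x, e0) \<in> ?dom" if "x \<in> ?O" for x using that chart_facts(7)[OF c'] by simp
    have "continuous_on ?O Z"
    proof -
      have "C_k_on 0 ?O (\<lambda>x. (x, e0))" by (intro C_k_on_Pair C_k_on_const C_k_on_linear[OF bounded_linear_ident])
      then have "C_k_on 0 ?O Z" unfolding Z_def[abs_def]
        by (intro C_k_on_derivative_dir[OF sm(2,1)]) (use inO O in auto)
      then show ?thesis by simp
    qed
    then have cZ: "continuous_on {t\<in>{0..1}. ?\<gamma> t \<in> fst c'} (\<lambda>t. Z (snd c' (?\<gamma> t)))"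
      by (rule continuous_on_compose2[OF _ continuous_on_compose2[OF chart_facts(3)[OF c'] continuous_on_subset[OF c\<gamma>]]]) auto
    have "((snd c' \<circ> ?\<gamma>) has_vector_derivative Z (snd c' (?\<gamma> t))) (at t)" if t: "?\<gamma> t \<in> fst c'" for t
    proof -
      let ?x = "snd c' (?\<gamma> t)"
      have xO: "?x \<in> ?O" using t by simp
      have dk: "((\<lambda>y. ?k (?x, y)) has_derivative (\<lambda>h. frechet_derivative ?k (at (?x, e0)) (0, h))) (at (psi (\<Gamma> (t - t))))"
        using has_derivative_Pair_right[OF C_k_on_derivative(1)[OF sm(2)[of "Suc 0"] sm(1) inO[OF xO]]] zero by simp
      from has_derivative_compose[OF shift[of t, unfolded has_vector_derivative_def] dk]
      have 1: "((\<lambda>s. ?k (?x, psi (\<Gamma> (s - t)))) has_derivative (\<lambda>h. frechet_derivative ?k (at (?x, e0)) (0, h *\<^sub>R v))) (at t)" .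
      have "linear (frechet_derivative ?k (at (?x, e0)))"
        using C_k_on_derivative(1)[OF sm(2)[of "Suc 0"] sm(1) inO[OF xO]] has_derivative_linear by blast
      from linear_scale[OF this, of _ "(0, v)"]
      have "frechet_derivative ?k (at (?x, e0)) (0, h *\<^sub>R v) = h *\<^sub>R Z ?x" for h by (simp add: Z_def)
      with 1 have 2: "((\<lambda>s. ?k (?x, psi (\<Gamma> (s - t)))) has_vector_derivative Z ?x) (at t)"
        by (simp add: has_vector_derivative_def)
      obtain \<delta> where \<delta>: "\<delta> > 0" "\<And>t. \<bar>t\<bar> < \<delta> \<Longrightarrow> \<Gamma> t \<in> fst c"
        using continuous_near_one[OF one_parameter_continuous[OF \<Gamma>] zero] by blast
      show ?thesis
      proof (rule has_vector_derivative_transform_within_open[OF 2, of "{t - \<delta><..<t + \<delta>}"])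
        fix s assume "s \<in> {t - \<delta><..<t + \<delta>}"
        then have "\<Gamma> (s - t) \<in> fst c" by (intro \<delta>(2)) auto
        then have "?k (?x, psi (\<Gamma> (s - t))) = snd c' (?\<gamma> t \<otimes> \<Gamma> (s - t))"
          using t by (simp add: par_psi chart_facts(5)[OF c'])
        also have "?\<gamma> t \<otimes> \<Gamma> (s - t) = ?\<gamma> s" using G[of t "s - t"] by (simp add: m_assoc)
        finally show "?k (?x, psi (\<Gamma> (s - t))) = (snd c' \<circ> ?\<gamma>) s" by simp
      qed (use \<delta> in auto)
    qed
    then show ?thesis unfolding C1_differentiable_on_def using cZ
      by (intro exI[of _ "\<lambda>t. Z (snd c' (?\<gamma> t))"]) auto
  qed
  have pw: "piecewise_C1_curve A ?\<gamma>"
    unfolding piecewise_C1_curve_def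
  proof (intro conjI exI[of _ "{}"] ballI)
    show "path ?\<gamma>" unfolding path_def by (rule continuous_on_subset[OF c\<gamma>]) simp
  qed (use C1 in auto)
  have lv: "left_velocity G c ?\<gamma> t = v" for t
  proof -
    have "psi (inv (?\<gamma> t) \<otimes> ?\<gamma> s) = psi (\<Gamma> (s - t))" for s
      by (simp add: inv_mult_group m_assoc cancel_simps invG)
    then show ?thesis unfolding left_velocity_def using shift by (simp add: vector_derivative_at)
  qed
  have "riemannian_length G c B ?\<gamma> = ennreal (sqrt (B v v))"
    unfolding riemannian_length_def lv by (simp add: nn_integral_cmult_indicator)
  moreover have "B v v \<ge> 0"
  proof (cases "v = 0")
    case True
    have "bilinear B" using B by (simp add: inner_product_form_def)
    then show ?thesis using True bilinear_lzero[of B 0] by simp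
  next
    case False then show ?thesis using B by (auto simp: inner_product_form_def intro: less_imp_le)
  qed
  ultimately show ?thesis
    using zero by (intro rdist_le_length[OF pw]) (auto simp: pathstart_def pathfinish_def)
qed

text \<open>\<open>\<pi> \<circ> \<Gamma>\<close> is additive and differentiable at \<open>0\<close>, hence linear.\<close>

lemma homomorphism_one_parameter:
  fixes \<pi> :: "'g \<Rightarrow> real"
  assumes hom: "\<And>g h. \<pi> (g \<otimes> h) = \<pi> g + \<pi> h" and d: "((\<lambda>x. \<pi> (par x)) has_derivative \<mu>) (at e0)"
    and \<Gamma>: "one_parameter v \<Gamma>"
  shows "\<pi> (\<Gamma> t) = t * \<mu> v"
proof (rule additive_derivative_linear)
  show "\<pi> (\<Gamma> (s + t)) = \<pi> (\<Gamma> s) + \<pi> (\<Gamma> t)" for s t using \<Gamma> hom by (simp add: one_parameter_def)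
  obtain \<delta> where \<delta>: "\<delta> > 0" "\<And>t. \<bar>t\<bar> < \<delta> \<Longrightarrow> \<Gamma> t \<in> fst c" using \<Gamma> unfolding one_parameter_def by blast
  have dv: "((\<lambda>t. psi (\<Gamma> t)) has_derivative (\<lambda>h. h *\<^sub>R v)) (at 0)"
    using \<Gamma> by (simp add: one_parameter_def has_vector_derivative_def)
  have "((\<lambda>t. \<pi> (par (psi (\<Gamma> t)))) has_derivative (\<lambda>h. \<mu> (h *\<^sub>R v))) (at 0)"
    using has_derivative_compose[OF dv, of "\<lambda>x. \<pi> (par x)" \<mu>] d one_parameter_zero[OF \<Gamma>] by simp
  then have "((\<lambda>t. \<pi> (\<Gamma> t)) has_derivative (\<lambda>h. \<mu> (h *\<^sub>R v))) (at 0)"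
    by (rule has_derivative_transform_within_open[of _ _ _ _ "{- \<delta><..<\<delta>}"]) (use \<delta> par_psi in \<open>auto simp: abs_less_iff\<close>)
  moreover have "linear \<mu>" using d has_derivative_linear by blast
  ultimately show "((\<lambda>t. \<pi> (\<Gamma> t)) has_vector_derivative \<mu> v) (at 0)"
    by (simp add: has_vector_derivative_def linear_scale)
qed

primrec flat :: "(nat \<Rightarrow> real \<Rightarrow> 'g) \<Rightarrow> nat \<Rightarrow> (nat \<Rightarrow> real) \<Rightarrow> 'g" where
  "flat \<Gamma> 0 x = \<one>"
| "flat \<Gamma> (Suc n) x = flat \<Gamma> n x \<otimes> \<Gamma> n (x n)"

lemma flat_commute:
  assumes comm: "\<And>i j s t. i < m \<Longrightarrow> j < m \<Longrightarrow> \<Gamma> i s \<otimes> \<Gamma> j t = \<Gamma> j t \<otimes> \<Gamma> i s" and "n \<le> m" "j < m"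
  shows "flat \<Gamma> n x \<otimes> \<Gamma> j t = \<Gamma> j t \<otimes> flat \<Gamma> n x"
  using assms(2)
proof (induction n)
  case (Suc n)
  have "flat \<Gamma> (Suc n) x \<otimes> \<Gamma> j t = flat \<Gamma> n x \<otimes> (\<Gamma> n (x n) \<otimes> \<Gamma> j t)" by (simp add: m_assoc)
  also have "\<dots> = (flat \<Gamma> n x \<otimes> \<Gamma> j t) \<otimes> \<Gamma> n (x n)" using comm[of n j] Suc.prems assms(3) by (simp add: m_assoc)
  also have "\<dots> = \<Gamma> j t \<otimes> flat \<Gamma> (Suc n) x" using Suc by (simp add: m_assoc)
  finally show ?case .
qed simp

lemma flat_add:
  assumes comm: "\<And>i j s t. i < m \<Longrightarrow> j < m \<Longrightarrow> \<Gamma> i s \<otimes> \<Gamma> j t = \<Gamma> j t \<otimes> \<Gamma> i s"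
    and hom: "\<And>i s t. i < m \<Longrightarrow> \<Gamma> i (s + t) = \<Gamma> i s \<otimes> \<Gamma> i t" and "n \<le> m"
  shows "flat \<Gamma> n (\<lambda>i. x i + y i) = flat \<Gamma> n x \<otimes> flat \<Gamma> n y"
  using assms(3)
proof (induction n)
  case (Suc n)
  have "flat \<Gamma> (Suc n) (\<lambda>i. x i + y i) = flat \<Gamma> n x \<otimes> ((flat \<Gamma> n y \<otimes> \<Gamma> n (x n)) \<otimes> \<Gamma> n (y n))"
    using Suc hom[of n] by (simp add: m_assoc)
  also have "flat \<Gamma> n y \<otimes> \<Gamma> n (x n) = \<Gamma> n (x n) \<otimes> flat \<Gamma> n y"
    by (rule flat_commute[OF comm]) (use Suc.prems in auto)
  finally show ?case by (simp add: m_assoc)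
qed simp

lemma one_parameter_flat:
  assumes comm: "\<And>i j s t. i < m \<Longrightarrow> j < m \<Longrightarrow> \<Gamma> i s \<otimes> \<Gamma> j t = \<Gamma> j t \<otimes> \<Gamma> i s"
    and \<Gamma>: "\<And>i. i < m \<Longrightarrow> one_parameter (v i) (\<Gamma> i)" and "n \<le> m"
  shows "one_parameter (\<Sum>i<n. h i *\<^sub>R v i) (\<lambda>t. flat \<Gamma> n (\<lambda>i. t * h i))"
  using assms(3)
proof (induction n)
  case 0
  show ?case by (simp add: one_parameter_trivial)
next
  case (Suc n)
  have "one_parameter ((\<Sum>i<n. h i *\<^sub>R v i) + h n *\<^sub>R v n) (\<lambda>t. flat \<Gamma> n (\<lambda>i. t * h i) \<otimes> \<Gamma> n (t * h n))"
    using Suc by (intro one_parameter_mult one_parameter_scale \<Gamma> flat_commute[OF comm]) auto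
  then show ?case by simp
qed

text \<open>The flat is a left translate through \<open>bp\<close> of the abelian subgroup generated by commuting one-parameter subgroups.
Two of its points differ by an element of a one-parameter subgroup, which bounds their distance from above; the
homomorphisms with derivatives \<open>\<mu> i\<close> recover the coordinates and bound it from below.\<close>

theorem bilipschitz_flat_exists:
  fixes v :: "nat \<Rightarrow> 'e" and \<mu> :: "nat \<Rightarrow> 'e \<Rightarrow> real"
  assumes sc: "simply_connected (UNIV :: 'g set)" and B: "inner_product_form B"
    and br0: "\<And>i j. i < m \<Longrightarrow> j < m \<Longrightarrow> br (v i) (v j) = 0"
    and lin: "\<And>i. i < m \<Longrightarrow> linear (\<mu> i)" and \<mu>0: "\<And>i u w. i < m \<Longrightarrow> \<mu> i (br u w) = 0"
    and dual: "\<And>i j. i < m \<Longrightarrow> j < m \<Longrightarrow> \<mu> i (v j) = (if i = j then 1 else 0)"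
  obtains \<phi> :: "(nat \<Rightarrow> real) \<Rightarrow> 'g" and \<pi> C K where "C > 0" "K > 0"
    "\<And>x y. rdist B (\<phi> x) (\<phi> y) \<le> C * (\<Sum>i<m. \<bar>x i - y i\<bar>)"
    "\<And>i x y. i < m \<Longrightarrow> \<bar>\<pi> i x - \<pi> i y\<bar> \<le> K * rdist B x y"
    "\<And>i x. i < m \<Longrightarrow> \<pi> i (\<phi> x) = \<pi> i bp + x i"
proof -
  have "\<exists>\<Gamma>. (\<forall>i<m. one_parameter (v i) (\<Gamma> i)) \<and>
      (\<forall>i<m. \<forall>j<m. \<forall>s t. \<Gamma> i s \<otimes> \<Gamma> j t = \<Gamma> j t \<otimes> \<Gamma> i s)"
    by (rule commuting_one_parameter_subgroups) (rule br0)
  then obtain \<Gamma> where \<Gamma>: "\<And>i. i < m \<Longrightarrow> one_parameter (v i) (\<Gamma> i)"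
    and comm: "\<And>i j s t. i < m \<Longrightarrow> j < m \<Longrightarrow> \<Gamma> i s \<otimes> \<Gamma> j t = \<Gamma> j t \<otimes> \<Gamma> i s"
    by blast
  have G: "\<Gamma> i (s + t) = \<Gamma> i s \<otimes> \<Gamma> i t" if "i < m" for i s t using \<Gamma>[OF that] by (simp add: one_parameter_def)
  have "\<exists>\<pi> K. (\<forall>g h. \<pi> (g \<otimes> h) = \<pi> g + \<pi> h) \<and> ((\<lambda>x. \<pi> (par x)) has_derivative \<mu> i) (at e0) \<and>
      K > 0 \<and> (\<forall>x y. \<bar>\<pi> x - \<pi> y\<bar> \<le> K * rdist B x y)" if i: "i < m" for i
  proof -
    obtain f r where f: "r > 0" "ball e0 r \<subseteq> Ch" "continuous_on (ball e0 r) f" "(f has_derivative \<mu> i) (at e0)"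
      "\<And>x y. x \<in> ball e0 r \<Longrightarrow> y \<in> ball e0 r \<Longrightarrow> (x, y) \<in> lmult_dom \<and> f (lmult (x, y)) = f x + f y"
      by (rule local_homomorphism[OF lin[OF i] \<mu>0[OF i]]) blast
    interpret local_hom G A c f r by unfold_locales (use f in auto)
    obtain \<pi> where \<pi>: "\<And>g h. \<pi> (g \<otimes> h) = \<pi> g + \<pi> h" "\<And>g. g \<in> W \<Longrightarrow> \<pi> g = f (psi g)" "continuous_on UNIV \<pi>"
      by (rule global_homomorphism[OF sc]) blast
    have d: "((\<lambda>x. \<pi> (par x)) has_derivative \<mu> i) (at e0)"
    proof (rule has_derivative_transform_within_open[OF f(4) open_ball])
      show "f x = \<pi> (par x)" if "x \<in> ball e0 r" for x
        using \<pi>(2)[of "par x"] that f(2) psi_par[of x] by (auto simp: W_def)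
    qed (use f(1) in simp)
    obtain K where "K > 0" "\<And>x y. \<bar>\<pi> x - \<pi> y\<bar> \<le> K * rdist B x y"
      by (rule homomorphism_lipschitz[OF sc B \<pi>(1,3) d]) blast
    then show ?thesis using \<pi>(1) d by blast
  qed
  then obtain \<pi> K0 where \<pi>: "\<And>i g h. i < m \<Longrightarrow> \<pi> i (g \<otimes> h) = \<pi> i g + \<pi> i h"
    "\<And>i. i < m \<Longrightarrow> ((\<lambda>x. \<pi> i (par x)) has_derivative \<mu> i) (at e0)"
    "\<And>i. i < m \<Longrightarrow> K0 i > 0" "\<And>i x y. i < m \<Longrightarrow> \<bar>\<pi> i x - \<pi> i y\<bar> \<le> K0 i * rdist B x y"
    by metis
  define K where "K = (\<Sum>i<m. K0 i) + 1"
  have K0: "K0 i \<le> K" if "i < m" for i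
  proof -
    have "K0 i \<le> (\<Sum>i<m. K0 i)" by (rule member_le_sum) (use that \<pi>(3) less_imp_le in auto)
    then show ?thesis by (simp add: K_def)
  qed
  have K: "K > 0" unfolding K_def using \<pi>(3) by (intro add_nonneg_pos sum_nonneg) (auto intro: less_imp_le)
  obtain k C0 where C0: "C0 > 0" "\<And>v. sqrt (B v v) \<le> C0 * norm v" using inner_product_form_bounds[OF B] by metis
  define C where "C = C0 * ((\<Sum>i<m. norm (v i)) + 1)"
  have C: "C > 0" using C0 unfolding C_def by (intro mult_pos_pos add_nonneg_pos sum_nonneg) auto
  define \<phi> where "\<phi> x = bp \<otimes> flat \<Gamma> m x" for x
  show thesis
  proof (rule that[OF C K, of \<phi> \<pi>])
    fix x y :: "nat \<Rightarrow> real"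
    let ?h = "\<lambda>i. y i - x i"
    have "flat \<Gamma> m y = flat \<Gamma> m x \<otimes> flat \<Gamma> m ?h"
      using flat_add[where \<Gamma> = \<Gamma> and x = x and y = ?h and m = m and n = m, OF comm G order_refl] by simp
    then have "rdist B (\<phi> x) (\<phi> y) \<le> sqrt (B (\<Sum>i<m. ?h i *\<^sub>R v i) (\<Sum>i<m. ?h i *\<^sub>R v i))"
      using one_parameter_dist[OF one_parameter_flat[where \<Gamma> = \<Gamma> and v = v and h = ?h and m = m and n = m, OF comm \<Gamma> order_refl] B, of "\<phi> x"]
      by (simp add: \<phi>_def m_assoc)
    also have "\<dots> \<le> C0 * norm (\<Sum>i<m. ?h i *\<^sub>R v i)" by (rule C0(2))
    also have "norm (\<Sum>i<m. ?h i *\<^sub>R v i) \<le> (\<Sum>i<m. \<bar>x i - y i\<bar> * ((\<Sum>i<m. norm (v i)) + 1))"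
    proof (rule sum_norm_le)
      fix i assume "i \<in> {..<m}"
      then have "norm (v i) \<le> (\<Sum>i<m. norm (v i))" by (intro member_le_sum) auto
      then show "norm (?h i *\<^sub>R v i) \<le> \<bar>x i - y i\<bar> * ((\<Sum>i<m. norm (v i)) + 1)"
        by (simp add: abs_minus_commute[of "x i"] mult_left_mono)
    qed
    also have "C0 * (\<Sum>i<m. \<bar>x i - y i\<bar> * ((\<Sum>i<m. norm (v i)) + 1)) = C * (\<Sum>i<m. \<bar>x i - y i\<bar>)"
      by (simp add: C_def sum_distrib_right[symmetric] mult_ac)
    finally show "rdist B (\<phi> x) (\<phi> y) \<le> C * (\<Sum>i<m. \<bar>x i - y i\<bar>)" using C0(1) by (simp add: mult_left_mono)
  next
    fix i x y assume i: "i < m"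
    show "\<bar>\<pi> i x - \<pi> i y\<bar> \<le> K * rdist B x y"
      using \<pi>(4)[OF i, of x y] mult_right_mono[OF K0[OF i] rdist_nonneg[of B x y]] by linarith
  next
    fix i and x :: "nat \<Rightarrow> real" assume i: "i < m"
    have one: "\<pi> i \<one> = 0" using \<pi>(1)[OF i, of \<one> \<one>] by simp
    have "n \<le> m \<Longrightarrow> \<pi> i (flat \<Gamma> n x) = (\<Sum>j<n. if i = j then x j else 0)" for n
    proof (induction n)
      case (Suc n)
      then have "\<pi> i (\<Gamma> n (x n)) = x n * \<mu> i (v n)"
        using homomorphism_one_parameter[OF \<pi>(1)[OF i] \<pi>(2)[OF i] \<Gamma>[of n]] by simp
      then show ?case using Suc \<pi>(1)[OF i] dual[OF i, of n] by simp
    qed (simp add: one)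
    from this[OF order_refl] show "\<pi> i (\<phi> x) = \<pi> i bp + x i" using i by (simp add: \<phi>_def \<pi>(1)[OF i])
  qed
qed

end

section \<open>Divergence of a space with a flat\<close>

lemma mass_eq_sum:
  assumes "finite S" "Poly_Mapping.keys a \<subseteq> S"
  shows "mass dst m a = (\<Sum>f\<in>S. ennreal (real_of_int \<bar>Poly_Mapping.lookup a f\<bar>) * hausdorff_measure dst m (f ` standard_simplex m))"
  unfolding mass_def using assms
  by (intro sum.mono_neutral_left) (auto simp: in_keys_iff)

lemma mass_add_le: "mass dst m (a + b) \<le> mass dst m a + mass dst m b"
proof -
  let ?S = "Poly_Mapping.keys a \<union> Poly_Mapping.keys b"
  let ?H = "\<lambda>f. hausdorff_measure dst m (f ` standard_simplex m)"
  have "mass dst m (a + b) = (\<Sum>f\<in>?S. ennreal (real_of_int \<bar>Poly_Mapping.lookup (a + b) f\<bar>) * ?H f)"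
    by (rule mass_eq_sum) (auto dest: subsetD[OF keys_add])
  also have "\<dots> \<le> (\<Sum>f\<in>?S. ennreal (real_of_int \<bar>Poly_Mapping.lookup a f\<bar>) * ?H f + ennreal (real_of_int \<bar>Poly_Mapping.lookup b f\<bar>) * ?H f)"
    by (intro sum_mono) (simp add: distrib_right[symmetric] lookup_add ennreal_plus[symmetric] mult_right_mono ennreal_leI del: ennreal_plus)
  also have "\<dots> = mass dst m a + mass dst m b"
    by (simp add: sum.distrib mass_eq_sum[of ?S])
  finally show ?thesis .
qed

lemma mass_sum_le: "mass dst m (\<Sum>i\<in>I. a i) \<le> (\<Sum>i\<in>I. mass dst m (a i))"
proof (induction I rule: infinite_finite_induct)
  case (insert x F)
  then show ?case using mass_add_le[of dst m "a x" "sum a F"] by (simp add: add_left_mono order_trans)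
qed (auto simp: mass_def)

lemma mass_signed_simplex:
  "mass dst m (frag_cmul ((-1) ^ k) (frag_of f)) = hausdorff_measure dst m (f ` standard_simplex m)"
  by (cases "even k") (simp_all add: mass_def)

lemma keys_simplex_boundary:
  "Poly_Mapping.keys (chain_boundary (Suc j) (frag_of \<sigma>)) \<subseteq> (\<lambda>k. singular_face (Suc j) k \<sigma>) ` {..Suc j}"
proof -
  have "Poly_Mapping.keys (\<Sum>k\<le>Suc j. frag_cmul ((-1) ^ k) (frag_of (singular_face (Suc j) k \<sigma>)))
      \<subseteq> (\<Union>k\<in>{..Suc j}. Poly_Mapping.keys (frag_cmul ((-1) ^ k) (frag_of (singular_face (Suc j) k \<sigma>))))"
    by (rule keys_sum)
  also have "\<dots> \<subseteq> (\<lambda>k. singular_face (Suc j) k \<sigma>) ` {..Suc j}"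
    using keys_cmul by fastforce
  finally show ?thesis by (simp only: chain_boundary_of) simp
qed

lemma sum_hausdorff_le_mass:
  "(\<Sum>f\<in>Poly_Mapping.keys b. hausdorff_measure dst m (f ` standard_simplex m)) \<le> mass dst m b"
  unfolding mass_def
proof (rule sum_mono)
  fix f assume "f \<in> Poly_Mapping.keys b"
  then have "\<bar>Poly_Mapping.lookup b f\<bar> \<ge> 1" by (simp add: in_keys_iff)
  then have "1 \<le> ennreal (real_of_int \<bar>Poly_Mapping.lookup b f\<bar>)" by (simp flip: ennreal_1 del: ennreal_1)
  from mult_right_mono[OF this, of "hausdorff_measure dst m (f ` standard_simplex m)"]
  show "hausdorff_measure dst m (f ` standard_simplex m)
      \<le> ennreal (real_of_int \<bar>Poly_Mapping.lookup b f\<bar>) * hausdorff_measure dst m (f ` standard_simplex m)"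
    by simp
qed

lemma abs_diff_le_simplex_norm:
  fixes x y :: "nat \<Rightarrow> real"
  assumes "i \<le> m"
  shows "\<bar>x i - y i\<bar> \<le> sqrt (\<Sum>i\<le>m. (x i - y i)\<^sup>2)"
proof -
  have "(x i - y i)\<^sup>2 \<le> (\<Sum>i\<le>m. (x i - y i)\<^sup>2)" by (rule member_le_sum) (use assms in auto)
  from real_sqrt_le_mono[OF this] show ?thesis by (simp only: real_sqrt_abs)
qed

lemma lipschitz_on_simplex_continuous:
  assumes "\<And>x y. x \<in> standard_simplex m \<Longrightarrow> y \<in> standard_simplex m \<Longrightarrow>
    \<bar>g x - g y\<bar> \<le> L * sqrt (\<Sum>i\<le>m. (x i - y i)\<^sup>2)"
  shows "continuous_map (subtopology (powertop_real UNIV) (standard_simplex m)) euclideanreal g"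
proof -
  have "continuous_on (standard_simplex m) g"
    unfolding continuous_on_eq_continuous_within continuous_within
  proof
    fix x assume x: "x \<in> standard_simplex m"
    have "continuous_on (standard_simplex m) (\<lambda>y. \<bar>L\<bar> * sqrt (\<Sum>i\<le>m. (y i - x i)\<^sup>2))"
      by (intro continuous_intros continuous_on_subset[OF continuous_on_product_coordinates]) auto
    then have "((\<lambda>y. \<bar>L\<bar> * sqrt (\<Sum>i\<le>m. (y i - x i)\<^sup>2)) \<longlongrightarrow> \<bar>L\<bar> * sqrt (\<Sum>i\<le>m. (x i - x i)\<^sup>2)) (at x within standard_simplex m)"
      using x unfolding continuous_on_def by blast
    then have z: "((\<lambda>y. \<bar>L\<bar> * sqrt (\<Sum>i\<le>m. (y i - x i)\<^sup>2)) \<longlongrightarrow> 0) (at x within standard_simplex m)" by simp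
    have "\<forall>\<^sub>F y in at x within standard_simplex m. norm (g y - g x) \<le> \<bar>L\<bar> * sqrt (\<Sum>i\<le>m. (y i - x i)\<^sup>2)"
    proof (rule eventually_at_topological[THEN iffD2], intro exI[of _ UNIV] conjI ballI impI)
      fix y assume "y \<in> standard_simplex m"
      then have "\<bar>g y - g x\<bar> \<le> L * sqrt (\<Sum>i\<le>m. (y i - x i)\<^sup>2)" using assms x by blast
      also have "\<dots> \<le> \<bar>L\<bar> * sqrt (\<Sum>i\<le>m. (y i - x i)\<^sup>2)" by (intro mult_right_mono) (auto intro: sum_nonneg)
      finally show "norm (g y - g x) \<le> \<bar>L\<bar> * sqrt (\<Sum>i\<le>m. (y i - x i)\<^sup>2)" by simp
    qed auto
    from Lim_null_comparison[OF this z] show "(g \<longlongrightarrow> g x) (at x within standard_simplex m)"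
      by (rule Lim_null[THEN iffD2])
  qed
  then have "continuous_map (subtopology euclidean (standard_simplex m)) euclideanreal g" by simp
  then show ?thesis by (simp add: euclidean_product_topology)
qed

text \<open>A flat \<open>\<phi>\<close> of dimension \<open>j + 1\<close> with coordinate functions \<open>\<pi> i\<close> that are defined and Lipschitz on the whole
space; its origin has the same coordinates as the base point \<open>bp\<close>.\<close>

locale bilipschitz_flat =
  fixes dst :: "'x \<Rightarrow> 'x \<Rightarrow> real" and bp :: 'x and j :: nat
    and \<phi> :: "(nat \<Rightarrow> real) \<Rightarrow> 'x" and \<pi> :: "nat \<Rightarrow> 'x \<Rightarrow> real" and C K :: real
  assumes nonneg: "\<And>x y. 0 \<le> dst x y" and C: "C > 0" and K: "K > 0" and j: "j \<ge> 1"
    and \<phi>_lip: "\<And>x y. dst (\<phi> x) (\<phi> y) \<le> C * (\<Sum>i<Suc j. \<bar>x i - y i\<bar>)"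
    and \<pi>_lip: "\<And>i x y. i < Suc j \<Longrightarrow> \<bar>\<pi> i x - \<pi> i y\<bar> \<le> K * dst x y"
    and \<pi>\<phi>: "\<And>i x. i < Suc j \<Longrightarrow> \<pi> i (\<phi> x) = \<pi> i bp + x i"
begin

text \<open>The factor is chosen such that the boundary of a simplex of this side, with its barycentre at the origin of the flat, avoids the ball of
radius \<open>R\<close>; see \<open>bigsimplex_face_far\<close>.\<close>

definition side :: "real \<Rightarrow> real" where "side R = real (Suc j) * real (Suc (Suc j)) * K * R"

definition bigsimplex :: "real \<Rightarrow> (nat \<Rightarrow> real) \<Rightarrow> 'x" where
  "bigsimplex R = (\<lambda>x\<in>standard_simplex (Suc j). \<phi> (\<lambda>i. side R * (x i - 1 / real (Suc (Suc j)))))"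

text \<open>The barycentric coordinates of \<open>bigsimplex R\<close>, extended from the flat to the whole space.\<close>

definition bary :: "real \<Rightarrow> nat \<Rightarrow> 'x \<Rightarrow> real" where
  "bary R i z = (if i < Suc j then (\<pi> i z - \<pi> i bp) / side R + 1 / real (Suc (Suc j))
     else 1 - (\<Sum>i<Suc j. (\<pi> i z - \<pi> i bp) / side R + 1 / real (Suc (Suc j))))"

definition sphere_mass_coeff :: real where
  "sphere_mass_coeff = real (Suc (Suc j)) * (unit_ball_vol (real j) *
     (C * (real (Suc j) * real (Suc (Suc j)) * K) * real (Suc j) * (2 * real j)) ^ j)"

definition fill_mass_coeff :: real where
  "fill_mass_coeff = unit_ball_vol (real (Suc j)) * (real (Suc (Suc j)) / 16) ^ Suc j"

lemma side_pos: "R > 0 \<Longrightarrow> side R > 0" using K by (simp add: side_def)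

lemma bigsimplex_lip:
  assumes R: "R > 0" and x: "x \<in> standard_simplex (Suc j)" "y \<in> standard_simplex (Suc j)"
    and e: "\<And>i. i < Suc j \<Longrightarrow> \<bar>x i - y i\<bar> \<le> e"
  shows "dst (bigsimplex R x) (bigsimplex R y) \<le> C * side R * real (Suc j) * e"
proof -
  have "dst (bigsimplex R x) (bigsimplex R y)
      \<le> C * (\<Sum>i<Suc j. \<bar>side R * (x i - 1 / real (Suc (Suc j))) - side R * (y i - 1 / real (Suc (Suc j)))\<bar>)"
    unfolding bigsimplex_def using x by (simp del: of_nat_Suc sum.lessThan_Suc add: \<phi>_lip)
  also have "\<dots> \<le> C * (\<Sum>i<Suc j. side R * e)"
  proof (intro mult_left_mono sum_mono)
    fix i assume i: "i \<in> {..<Suc j}"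
    have "\<bar>side R * (x i - 1 / real (Suc (Suc j))) - side R * (y i - 1 / real (Suc (Suc j)))\<bar> = side R * \<bar>x i - y i\<bar>"
      using side_pos[OF R] by (simp add: right_diff_distrib[symmetric] abs_mult del: of_nat_Suc)
    also have "\<dots> \<le> side R * e" using side_pos[OF R] e i by (intro mult_left_mono) auto
    finally show "\<bar>side R * (x i - 1 / real (Suc (Suc j))) - side R * (y i - 1 / real (Suc (Suc j)))\<bar> \<le> side R * e" .
  qed (use C in simp)
  also have "\<dots> = C * side R * real (Suc j) * e" by (simp add: algebra_simps)
  finally show ?thesis .
qed

lemma bary_bigsimplex:
  assumes R: "R > 0" and x: "x \<in> standard_simplex (Suc j)" and i: "i \<le> Suc j"
  shows "bary R i (bigsimplex R x) = x i"
proof -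
  have v: "(\<pi> i (bigsimplex R x) - \<pi> i bp) / side R + 1 / real (Suc (Suc j)) = x i" if "i < Suc j" for i
    unfolding bigsimplex_def using x side_pos[OF R] that by (simp add: \<pi>\<phi> del: of_nat_Suc)
  show ?thesis
  proof (cases "i < Suc j")
    case True then show ?thesis using v by (simp add: bary_def del: of_nat_Suc)
  next
    case False
    then have [simp]: "i = Suc j" using i by simp
    have "(\<Sum>i<Suc j. (\<pi> i (bigsimplex R x) - \<pi> i bp) / side R + 1 / real (Suc (Suc j))) = (\<Sum>i<Suc j. x i)"
      by (rule sum.cong) (use v in auto)
    then have "bary R i (bigsimplex R x) = 1 - (\<Sum>i<Suc j. x i)"
      unfolding bary_def by (simp del: of_nat_Suc sum.lessThan_Suc)
    also have "\<dots> = x i" using x by (simp add: standard_simplex_def lessThan_Suc_atMost)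
    finally show ?thesis .
  qed
qed

lemma bary_lip:
  assumes R: "R > 0" and i: "i < Suc j"
  shows "\<bar>bary R i x - bary R i y\<bar> \<le> K / side R * dst x y"
proof -
  have "bary R i x - bary R i y = (\<pi> i x - \<pi> i y) / side R"
    using i by (simp add: bary_def diff_divide_distrib del: of_nat_Suc)
  then show ?thesis using \<pi>_lip[OF i, of x y] side_pos[OF R] by (simp add: abs_divide divide_right_mono)
qed

lemma sum_bary_low: "(\<Sum>i<Suc j. bary R i z) = (\<Sum>i<Suc j. (\<pi> i z - \<pi> i bp) / side R + 1 / real (Suc (Suc j)))"
  by (rule sum.cong) (auto simp: bary_def)

lemma sum_bary: "(\<Sum>i\<le>Suc j. bary R i z) = 1"
proof -
  have "(\<Sum>i\<le>Suc j. bary R i z) = (\<Sum>i<Suc j. bary R i z) + bary R (Suc j) z"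
    by (simp add: lessThan_Suc_atMost[symmetric])
  also have "\<dots> = 1"
    unfolding sum_bary_low by (simp add: bary_def del: sum.lessThan_Suc of_nat_Suc)
  finally show ?thesis .
qed

lemma singular_face_bigsimplex:
  assumes k: "k \<le> Suc j" and z: "z \<in> standard_simplex j"
  shows "singular_face (Suc j) k (bigsimplex R) z = bigsimplex R (simplical_face k z)"
    "simplical_face k z \<in> standard_simplex (Suc j)" "simplical_face k z k = 0"
  using simplical_face_in_standard_simplex[of "Suc j" k z] k z by (auto simp: singular_face_def simplical_face_def)

lemma face_lipschitz:
  assumes R: "R > 0" and k: "k \<le> Suc j" and z: "z \<in> standard_simplex j" "z' \<in> standard_simplex j"
  shows "dst (singular_face (Suc j) k (bigsimplex R) z) (singular_face (Suc j) k (bigsimplex R) z')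
     \<le> C * side R * real (Suc j) * sqrt (\<Sum>i\<le>j. (z i - z' i)\<^sup>2)"
  unfolding singular_face_bigsimplex(1)[OF k z(1)] singular_face_bigsimplex(1)[OF k z(2)]
proof (rule bigsimplex_lip[OF R singular_face_bigsimplex(2)[OF k z(1)] singular_face_bigsimplex(2)[OF k z(2)]])
  fix i assume i: "i < Suc j"
  have "0 \<le> sqrt (\<Sum>i\<le>j. (z i - z' i)\<^sup>2)" by (simp add: sum_nonneg)
  then show "\<bar>simplical_face k z i - simplical_face k z' i\<bar> \<le> sqrt (\<Sum>i\<le>j. (z i - z' i)\<^sup>2)"
    using i abs_diff_le_simplex_norm[of i j z z'] abs_diff_le_simplex_norm[of "i - 1" j z z']
    by (auto simp: simplical_face_def)
qed

text \<open>A point of the boundary has a vanishing barycentric coordinate. If it is one of the first \<open>j + 1\<close>, it deviates from its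
value at the barycentre by \<open>1 / (j + 2)\<close>; if it is the last one, the others sum to one, and one of them exceeds its
value at the barycentre by at least \<open>1 / ((j + 1) * (j + 2))\<close>.\<close>

lemma bigsimplex_face_far:
  assumes R: "R > 0" and x: "x \<in> standard_simplex (Suc j)" and k: "k \<le> Suc j" "x k = 0"
  shows "R \<le> dst bp (bigsimplex R x)"
proof -
  let ?n = "real (Suc (Suc j))"
  have Rn: "side R / (real (Suc j) * ?n) = K * R" by (simp add: side_def del: of_nat_Suc)
  have coord: "\<bar>\<pi> i (bigsimplex R x) - \<pi> i bp\<bar> = side R * \<bar>x i - 1 / ?n\<bar>" if "i < Suc j" for i
    unfolding bigsimplex_def using x side_pos[OF R] that by (simp add: \<pi>\<phi> abs_mult del: of_nat_Suc)
  obtain i where i: "i < Suc j" "\<bar>x i - 1 / ?n\<bar> \<ge> 1 / (real (Suc j) * ?n)"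
  proof (cases "k < Suc j")
    case True
    have "1 / (real (Suc j) * ?n) \<le> 1 / ?n"
      by (intro divide_left_mono) auto
    then show thesis using that[OF True] k(2) by simp
  next
    case False
    then have kj: "k = Suc j" using k by simp
    have s1: "(\<Sum>i<Suc j. x i) = 1" using x k kj by (simp add: standard_simplex_def lessThan_Suc_atMost)
    note found = that
    show thesis
    proof (rule ccontr)
      assume none: "\<not> thesis"
      have "x i - 1 / ?n < 1 / (real (Suc j) * ?n)" if "i < Suc j" for i
        using found[OF that] none by fastforce
      then have "(\<Sum>i<Suc j. x i - 1 / ?n) < (\<Sum>i<Suc j. 1 / (real (Suc j) * ?n))"
        by (intro sum_strict_mono) auto
      also have "\<dots> = 1 / ?n" by simp
      finally have "1 - real (Suc j) / ?n < 1 / ?n"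
        by (simp add: sum_subtractf s1 del: of_nat_Suc sum.lessThan_Suc)
      then show False by (simp add: field_simps)
    qed
  qed
  have "K * R = side R * (1 / (real (Suc j) * ?n))" using Rn by simp
  also have "\<dots> \<le> side R * \<bar>x i - 1 / ?n\<bar>" using i(2) side_pos[OF R] by (intro mult_left_mono) auto
  also have "\<dots> = \<bar>\<pi> i bp - \<pi> i (bigsimplex R x)\<bar>" using coord[OF i(1)] by (simp add: abs_minus_commute)
  also have "\<dots> \<le> K * dst bp (bigsimplex R x)" by (rule \<pi>_lip[OF i(1)])
  finally show ?thesis using K by simp
qed

definition bigsphere :: "real \<Rightarrow> 'x chain" where
  "bigsphere R = chain_boundary (Suc j) (frag_of (bigsimplex R))"

lemma avoidant_bigsphere: "R > 0 \<Longrightarrow> avoidant dst bp R j (bigsphere R)"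
  unfolding avoidant_def
proof
  fix f assume R: "R > 0" and "f \<in> Poly_Mapping.keys (bigsphere R)"
  then obtain k where k: "k \<le> Suc j" "f = singular_face (Suc j) k (bigsimplex R)"
    using keys_simplex_boundary unfolding bigsphere_def by blast
  have "R \<le> dst bp (f z)" if "z \<in> standard_simplex j" for z
    unfolding k(2) using bigsimplex_face_far[OF R, of "simplical_face k z" k] singular_face_bigsimplex[OF k(1) that] k(1) by simp
  then show "f ` standard_simplex j \<inter> {x. dst bp x < R} = {}" by force
qed

lemma lipschitz_cycle_bigsphere:
  assumes R: "R > 0"
  shows "lipschitz_cycle dst j (bigsphere R)"
proof -
  have "lipschitz_chain dst j (bigsphere R)"
    unfolding lipschitz_chain_def
  proof
    fix f assume "f \<in> Poly_Mapping.keys (bigsphere R)"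
    then obtain k where k: "k \<le> Suc j" "f = singular_face (Suc j) k (bigsimplex R)"
      using keys_simplex_boundary unfolding bigsphere_def by blast
    show "lipschitz_simplex dst j f"
      unfolding lipschitz_simplex_def
    proof (intro conjI exI ballI)
      show "f \<in> extensional (standard_simplex j)" unfolding k(2) singular_face_def by simp
    qed (use face_lipschitz[OF R k(1)] k(2) in blast)
  qed
  moreover have "chain_boundary j (bigsphere R) = 0"
  proof -
    (* The boundary of a boundary vanishes for singular chains in any topology; in the indiscrete one every
       map is a singular simplex. *)
    let ?X = "topology_generated_by {UNIV :: 'x set}"
    have "continuous_map (subtopology (powertop_real UNIV) (standard_simplex (Suc j))) ?X (bigsimplex R)"
      by (rule continuous_on_generated_topo)
         (use openin_topspace[of "subtopology (powertop_real UNIV) (standard_simplex (Suc j))"] in auto)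
    then have "singular_simplex (Suc j) ?X (bigsimplex R)"
      by (simp add: singular_simplex_def bigsimplex_def)
    then show ?thesis unfolding bigsphere_def
      using chain_boundary_boundary_alt[of j ?X "frag_of (bigsimplex R)"] by (simp add: singular_chain_of)
  qed
  ultimately show ?thesis using j by (simp add: lipschitz_cycle_def)
qed

lemma mass_bigsphere_le:
  assumes R: "R > 0"
  shows "mass dst j (bigsphere R) \<le> ennreal (sphere_mass_coeff * R ^ j)"
proof -
  let ?D = "C * side R * real (Suc j)"
  have D: "?D \<ge> 0" using C side_pos[OF R] by simp
  have "mass dst j (bigsphere R) \<le> (\<Sum>k\<le>Suc j. hausdorff_measure dst j (singular_face (Suc j) k (bigsimplex R) ` standard_simplex j))"
    unfolding bigsphere_def chain_boundary_of using mass_sum_le[of dst j _ "{..Suc j}"]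
    by (simp only: mass_signed_simplex if_False nat.distinct(2)) (metis (no_types, lifting) mass_signed_simplex sum.cong)
  also have "\<dots> \<le> (\<Sum>k\<le>Suc j. ennreal (unit_ball_vol (real j) * (?D * (2 * real j)) ^ j))"
    using face_lipschitz[OF R] D by (intro sum_mono hausdorff_measure_lipschitz_simplex_le) auto
  also have "\<dots> = ennreal (real (Suc (Suc j)) * (unit_ball_vol (real j) * (?D * (2 * real j)) ^ j))"
    using D by (simp add: ennreal_mult ennreal_of_nat_eq_real_of_nat del: of_nat_Suc)
  also have "real (Suc (Suc j)) * (unit_ball_vol (real j) * (?D * (2 * real j)) ^ j) = sphere_mass_coeff * R ^ j"
  proof -
    have "?D * (2 * real j) = (C * (real (Suc j) * real (Suc (Suc j)) * K) * real (Suc j) * (2 * real j)) * R"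
      by (simp add: side_def algebra_simps)
    then show ?thesis unfolding sphere_mass_coeff_def by (simp only: power_mult_distrib mult.assoc)
  qed
  finally show ?thesis .
qed

text \<open>Every filling passes through all points of a cube in the interior of the simplex of barycentric coordinates, which are
Lipschitz with constant \<open>K / side R\<close>.\<close>

lemma mass_filling_ge:
  assumes R: "R > 0" and b: "lipschitz_chain dst (Suc j) b" and bd: "chain_boundary (Suc j) b = bigsphere R"
  shows "ennreal (fill_mass_coeff * R ^ Suc j) \<le> mass dst (Suc j) b"
proof -
  let ?P = "\<lambda>z i. bary R i z"
  (* The coarsest topology in which the barycentric coordinates are continuous. Lipschitz simplices are
     continuous for it, so Lipschitz chains become singular chains. *)
  let ?X = "pullback_topology UNIV ?P (powertop_real UNIV)"
  have contP: "continuous_map ?X (powertop_real UNIV) ?P"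
    using continuous_map_pullback[OF continuous_map_id[of "powertop_real UNIV"], of UNIV ?P] by simp
  have contb: "continuous_map ?X euclideanreal (bary R i)" for i
    using contP by (auto simp: continuous_map_componentwise_UNIV)
  have sing: "singular_simplex (Suc j) ?X f"
    if ext: "f \<in> extensional (standard_simplex (Suc j))"
      and lip: "\<And>x y. x \<in> standard_simplex (Suc j) \<Longrightarrow> y \<in> standard_simplex (Suc j) \<Longrightarrow>
        dst (f x) (f y) \<le> M * sqrt (\<Sum>i\<le>Suc j. (x i - y i)\<^sup>2)" for f M
  proof -
    let ?T = "subtopology (powertop_real UNIV) (standard_simplex (Suc j))"
    have low: "continuous_map ?T euclideanreal (\<lambda>x. bary R i (f x))" if i: "i < Suc j" for i
    proof (rule lipschitz_on_simplex_continuous)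
      fix x y assume xy: "x \<in> standard_simplex (Suc j)" "y \<in> standard_simplex (Suc j)"
      have "\<bar>bary R i (f x) - bary R i (f y)\<bar> \<le> K / side R * dst (f x) (f y)" by (rule bary_lip[OF R i])
      also have "\<dots> \<le> K / side R * (M * sqrt (\<Sum>i\<le>Suc j. (x i - y i)\<^sup>2))"
        using lip[OF xy] K side_pos[OF R] by (intro mult_left_mono) auto
      finally show "\<bar>bary R i (f x) - bary R i (f y)\<bar> \<le> (K / side R * M) * sqrt (\<Sum>i\<le>Suc j. (x i - y i)\<^sup>2)"
        by (simp add: mult.assoc)
    qed
    have "continuous_map ?T euclideanreal (\<lambda>x. bary R i (f x))" for i
    proof (cases "i < Suc j")
      case False
      have eq: "bary R i z = 1 - (\<Sum>i<Suc j. bary R i z)" for z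
        using False sum_bary_low[of R z]
        by (simp add: bary_def[of R i] del: of_nat_Suc sum.lessThan_Suc sum.atMost_Suc)
      have "continuous_map ?T euclideanreal (\<lambda>x. 1 - (\<Sum>i<Suc j. bary R i (f x)))"
        by (intro continuous_map_diff continuous_map_sum) (use low in auto)
      then show ?thesis unfolding eq .
    qed (rule low)
    then have "continuous_map ?T (powertop_real UNIV) (?P \<circ> f)"
      by (simp add: continuous_map_componentwise_UNIV comp_def)
    then have "continuous_map ?T ?X f" by (intro continuous_map_pullback') auto
    then show ?thesis using ext by (simp add: singular_simplex_def)
  qed
  have chb: "singular_chain (Suc j) ?X b"
    unfolding singular_chain_def
  proof clarify
    fix f assume "f \<in> Poly_Mapping.keys b"
    then have "lipschitz_simplex dst (Suc j) f" using b by (simp add: lipschitz_chain_def)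
    then show "singular_simplex (Suc j) ?X f" unfolding lipschitz_simplex_def using sing by blast
  qed
  have sig: "singular_simplex (Suc j) ?X (bigsimplex R)"
  proof (rule sing)
    show "bigsimplex R \<in> extensional (standard_simplex (Suc j))" by (simp add: bigsimplex_def)
    show "dst (bigsimplex R x) (bigsimplex R y) \<le> (C * side R * real (Suc j)) * sqrt (\<Sum>i\<le>Suc j. (x i - y i)\<^sup>2)"
      if "x \<in> standard_simplex (Suc j)" "y \<in> standard_simplex (Suc j)" for x y
      by (rule bigsimplex_lip[OF R that abs_diff_le_simplex_norm]) simp
  qed
  (* The coordinates of the points of the cube [a, 2a]^(j+1) are positive and sum to at most 1/2, so with
     the last barycentric coordinate they give interior points of the simplex. *)
  let ?a = "1 / (4 * real (Suc j))"
  have "ennreal (unit_ball_vol (real (Suc j)) * (?a / (4 * (K / side R))) ^ Suc j)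
      \<le> (\<Sum>f\<in>Poly_Mapping.keys b. hausdorff_measure dst (Suc j) (f ` standard_simplex (Suc j)))"
  proof (rule hausdorff_sum_ge_of_covers_box[where \<beta>="bary R" and a="\<lambda>_. ?a"])
    show "K / side R > 0" using K side_pos[OF R] by simp
    show "\<bar>bary R i x - bary R i y\<bar> \<le> K / side R * dst x y" if "i < Suc j" for i x y by (rule bary_lip[OF R that])
    fix q assume q: "\<And>i. i < Suc j \<Longrightarrow> ?a \<le> q i \<and> q i \<le> ?a + ?a"
    define q' where "q' i = (if i < Suc j then q i else 1 - (\<Sum>i<Suc j. q i))" for i
    have "(\<Sum>i<Suc j. q i) \<le> (\<Sum>i<Suc j. ?a + ?a)" using q by (intro sum_mono) auto
    also have "\<dots> = 1 / 2" by (simp add: field_simps)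
    finally have half: "(\<Sum>i<Suc j. q i) \<le> 1 / 2" .
    have pos: "0 < q' i" if "i \<le> Suc j" for i
    proof (cases "i < Suc j")
      case True
      have "0 < ?a" by simp
      moreover have "q' i = q i" using True by (simp add: q'_def)
      ultimately show ?thesis using q[OF True] by linarith
    next
      case False
      then have "q' i = 1 - (\<Sum>i<Suc j. q i)" by (simp add: q'_def)
      then show ?thesis using half by linarith
    qed
    have sum1: "(\<Sum>i\<le>Suc j. q' i) = 1"
    proof -
      have "(\<Sum>i\<le>Suc j. q' i) = (\<Sum>i<Suc j. q' i) + q' (Suc j)" by (simp add: lessThan_Suc_atMost[symmetric])
      also have "(\<Sum>i<Suc j. q' i) = (\<Sum>i<Suc j. q i)" by (intro sum.cong) (auto simp: q'_def)
      also have "\<dots> + q' (Suc j) = 1" by (simp add: q'_def)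
      finally show ?thesis .
    qed
    have "\<exists>f\<in>Poly_Mapping.keys b. \<exists>x\<in>standard_simplex (Suc j).
        \<forall>i\<le>Suc j. \<forall>i'\<le>Suc j. bary R i (f x) - q' i = bary R i' (f x) - q' i'"
      by (rule filling_hits_interior_point[OF chb sig bd[unfolded bigsphere_def] contb bary_bigsimplex[OF R] pos sum1])
    then obtain f x where fx: "f \<in> Poly_Mapping.keys b" "x \<in> standard_simplex (Suc j)"
      and same: "\<forall>i\<le>Suc j. \<forall>i'\<le>Suc j. bary R i (f x) - q' i = bary R i' (f x) - q' i'"
      by (elim bexE)
    have zero: "bary R i (f x) = q' i" if i: "i \<le> Suc j" for i
    proof -
      have "(\<Sum>i'\<le>Suc j. bary R i' (f x) - q' i') = (\<Sum>i'\<le>Suc j. bary R i (f x) - q' i)"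
        using i by (intro sum.cong[OF refl] same[rule_format]) auto
      moreover have "(\<Sum>i'\<le>Suc j. bary R i' (f x) - q' i') = 0" by (simp only: sum_subtractf sum_bary sum1)
      ultimately show ?thesis by simp
    qed
    have "\<forall>i<Suc j. bary R i (f x) = q i" using zero by (auto simp: q'_def)
    then show "\<exists>f\<in>Poly_Mapping.keys b. \<exists>x\<in>f ` standard_simplex (Suc j). \<forall>i<Suc j. bary R i x = q i"
      using fx by blast
  qed (use nonneg in auto)
  also have "\<dots> \<le> mass dst (Suc j) b" by (rule sum_hausdorff_le_mass)
  finally have "ennreal (unit_ball_vol (real (Suc j)) * (?a / (4 * (K / side R))) ^ Suc j) \<le> mass dst (Suc j) b" .
  moreover have "?a / (4 * (K / side R)) = real (Suc (Suc j)) / 16 * R"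
  proof -
    have "1 / (4 * a) / (4 * (K / (a * b * K * R))) = b / 16 * R" if "a > 0" for a b :: real
      using K that by (cases "b = 0 \<or> R = 0") (auto simp: divide_simps)
    from this[of "real (Suc j)"] show ?thesis by (simp add: side_def del: of_nat_Suc)
  qed
  ultimately show ?thesis unfolding fill_mass_coeff_def by (simp only: power_mult_distrib mult.assoc)
qed

text \<open>The boundary of the big simplex is an admissible cycle as soon as the mass parameter is at least
\<open>sphere_mass_coeff\<close>; the coefficient of the filling mass is absorbed by the multiplicative constant of the comparison.\<close>

theorem divergence_of_flat: "family_le j (\<lambda>_ _ r. ennreal (r ^ (j + 1))) (Div dst bp j)"
proof -
  have sm: "sphere_mass_coeff \<ge> 0" unfolding sphere_mass_coeff_def using C K by (intro mult_nonneg_nonneg zero_le_power) auto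
  have fm: "fill_mass_coeff > 0" unfolding fill_mass_coeff_def by (intro mult_pos_pos zero_less_power) auto
  have Div: "ennreal (fill_mass_coeff * R ^ Suc j) \<le> Div dst bp j s t R" if R: "R > 0" and t: "sphere_mass_coeff \<le> t" for s t R
  proof -
    have "mass dst j (bigsphere R) \<le> ennreal (sphere_mass_coeff * R ^ j)" by (rule mass_bigsphere_le[OF R])
    also have "\<dots> \<le> ennreal (t * R ^ j)" using t R by (intro ennreal_leI mult_right_mono) auto
    finally show ?thesis unfolding Div_def
      using lipschitz_cycle_bigsphere[OF R] avoidant_bigsphere[OF R] mass_filling_ge[OF R]
      by (intro SUP_upper2[of "bigsphere R"] INF_greatest) auto
  qed
  define A where "A = max 1 (1 / fill_mass_coeff)"
  have A: "A \<ge> 1" "A * fill_mass_coeff \<ge> 1"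
    using fm by (auto simp: A_def max_def field_simps)
  have main: "ennreal (x ^ (j + 1)) \<le> ennreal A * Div dst bp j s t (A * x + A)" if x: "x \<ge> 1" and t: "sphere_mass_coeff \<le> t" for x s t
  proof -
    have "x \<le> A * x" using A x by simp
    then have R: "0 < A * x + A" "x \<le> A * x + A" using A x by linarith+
    have "x ^ Suc j \<le> (A * x + A) ^ Suc j" using R x by (intro power_mono) auto
    also have "\<dots> \<le> (A * fill_mass_coeff) * (A * x + A) ^ Suc j" using mult_right_mono[OF A(2), of "(A * x + A) ^ Suc j"] R by simp
    finally have "ennreal (x ^ Suc j) \<le> ennreal (A * (fill_mass_coeff * (A * x + A) ^ Suc j))"
      by (intro ennreal_leI) (simp add: mult.assoc)
    also have "\<dots> = ennreal A * ennreal (fill_mass_coeff * (A * x + A) ^ Suc j)"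
      using A fm R by (intro ennreal_mult) auto
    also have "\<dots> \<le> ennreal A * Div dst bp j s t (A * x + A)" by (intro mult_left_mono Div R t) simp
    finally show ?thesis by simp
  qed
  show ?thesis unfolding family_le_def
  proof (rule exI[of _ 1], rule exI[of _ "sphere_mass_coeff + 1"], rule exI[of _ 1], rule exI[of _ 1], intro conjI allI impI)
    fix s t :: real assume "0 < s \<and> s \<le> 1 \<and> sphere_mass_coeff + 1 \<le> t"
    then show "\<exists>A\<ge>1. \<exists>C\<ge>0. \<exists>x\<^sub>0>0. \<forall>x\<ge>x\<^sub>0.
        ennreal (x ^ (j + 1)) \<le> ennreal A * Div dst bp j (1 * s) (1 * t) (A * x + A) + ennreal (C * x ^ j)"
      using A main[of _ t s] by (intro exI[of _ A] conjI exI[of _ 0] exI[of _ 1]) auto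
  qed (use sm in auto)
qed

end

section \<open>Divergence of a stratified group\<close>

theorem theorem5:
  fixes G :: "'g::{t2_space,second_countable_topology} monoid"
    and A :: "('g, 'e::euclidean_space) chart set"
    and c :: "('g, 'e) chart"
    and V :: "nat \<Rightarrow> 'e set"
    and B :: "'e \<Rightarrow> 'e \<Rightarrow> real"
    and \<eta> :: "nat \<Rightarrow> 'e \<Rightarrow> real"
    and bp :: 'g
    and d k :: nat
  assumes "stratified_nilpotent_group G A c d V"
    and "inner_product_form B"
    and "horizontal_coframe (V 1) \<eta>"
    and "\<exists>\<Gamma>. lattice_in G \<Gamma> \<and> scaling_automorphism G A c d V 2 ` \<Gamma> \<subseteq> \<Gamma>"
    and "\<exists>S. subspace S \<and> S \<subseteq> V 1 \<and> dim S = k + 1 \<and>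
           Omega_isotropic (lie_bracket G c) (V 1) \<eta> S \<and>
           Omega_regular (lie_bracket G c) (V 1) \<eta> S"
  shows "\<forall>j. 1 \<le> j \<and> j \<le> k \<and> ereal (real j) \<le> divdim (riemannian_dist G A c B) bp \<longrightarrow>
           family_le j (\<lambda>_ _ r. ennreal (r ^ (j + 1))) (Div (riemannian_dist G A c B) bp j)"
proof (intro allI impI)
  fix j
  assume j: "1 \<le> j \<and> j \<le> k \<and> ereal (real j) \<le> divdim (riemannian_dist G A c B) bp"
  let ?br = "lie_bracket G c"
  have sc: "simply_connected (UNIV :: 'g set)" and nil: "nilpotent_of_step ?br d"
    and strat: "stratification ?br d V"
    using assms(1) by (auto simp: stratified_nilpotent_group_def)
  interpret lie_chart G A c
    by unfold_locales (use assms(1) in \<open>auto simp: stratified_nilpotent_group_def\<close>)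
  obtain S where S: "subspace S" "S \<subseteq> V 1" "dim S = k + 1"
    and iso: "Omega_isotropic ?br (V 1) \<eta> S" and reg: "Omega_regular ?br (V 1) \<eta> S"
    using assms(5) by blast
  let ?L = "span {?br u w | u w. True}"
  have disj: "S \<inter> ?L = {0}"
  proof -
    have "s = 0" if "s \<in> S" "s \<in> ?L" for s
      by (rule regular_subspace_avoids_brackets[OF bilinear_br br_antisym nil strat assms(3) S(1,2) reg that])
    then show ?thesis using subspace_0[OF S(1)] span_zero by blast
  qed
  have dim: "Suc j \<le> dim S" using S(3) j by simp
  obtain v and \<mu> :: "nat \<Rightarrow> 'e \<Rightarrow> real" where v: "\<And>i. i < Suc j \<Longrightarrow> v i \<in> S"
    and \<mu>: "\<And>i. i < Suc j \<Longrightarrow> linear (\<mu> i)" "\<And>i x. i < Suc j \<Longrightarrow> x \<in> ?L \<Longrightarrow> \<mu> i x = 0"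
    and dual: "\<And>i i'. i < Suc j \<Longrightarrow> i' < Suc j \<Longrightarrow> \<mu> i (v i') = (if i = i' then 1 else 0)"
    by (rule dual_functionals[OF S(1) subspace_span disj dim]) (rule that, assumption+)
  have br0: "?br (v i) (v i') = 0" if "i < Suc j" "i' < Suc j" for i i'
    by (rule isotropic_subspace_abelian[OF strat assms(3) iso S(2) v v]) (rule that)+
  have \<mu>0: "\<mu> i (?br u w) = 0" if "i < Suc j" for i u w
    by (rule \<mu>(2)[OF that]) (intro span_base, blast)
  obtain \<phi> :: "(nat \<Rightarrow> real) \<Rightarrow> 'g" and \<pi> C K where "C > 0" "K > 0"
    "\<And>x y. riemannian_dist G A c B (\<phi> x) (\<phi> y) \<le> C * (\<Sum>i<Suc j. \<bar>x i - y i\<bar>)"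
    "\<And>i x y. i < Suc j \<Longrightarrow> \<bar>\<pi> i x - \<pi> i y\<bar> \<le> K * riemannian_dist G A c B x y"
    "\<And>i x. i < Suc j \<Longrightarrow> \<pi> i (\<phi> x) = \<pi> i bp + x i"
    by (rule bilipschitz_flat_exists[where m = "Suc j" and v = v and \<mu> = \<mu>, OF sc assms(2) br0 \<mu>(1) \<mu>0 dual]) (assumption+, rule that, assumption+)
  then interpret bilipschitz_flat "riemannian_dist G A c B" bp j \<phi> \<pi> C K
    by unfold_locales (use j rdist_nonneg in auto)
  show "family_le j (\<lambda>_ _ r. ennreal (r ^ (j + 1))) (Div (riemannian_dist G A c B) bp j)"
    by (rule divergence_of_flat)
qed

end
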